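(* Let $P_0=\begin{pmatrix}q&s\\ s&r\end{pmatrix}\in\mathbb S^2$ with $r\le0$. Let $\psi$ be a stable transfer matrix of dimension $l\times1$ that has full column rank on $i\mathbb R\cup\{\infty\}$, with minimal realization $(A_\psi,B_\psi,C_\psi,D_\psi)$, and let $M\in\mathbb S^l$ be such that $\psi^*M\psi\succ0$ on $i\mathbb R\cup\{\infty\}$. Let $K=K^T$ be a certificate of $\psi^*M\psi\succ0$, i.e., $$\begin{pmatrix}A_\psi&B_\psi\\ I&0\end{pmatrix}^T\begin{pmatrix}0&K\\ K&0\end{pmatrix}\begin{pmatrix}A_\psi&B_\psi\\ I&0\end{pmatrix}\prec\begin{pmatrix}C_\psi&D_\psi\end{pmatrix}^TM\begin{pmatrix}C_\psi&D_\psi\end{pmatrix}.$$ Then the dynamic uncertainty $$\boldsymbol{\Delta_{\rm dy}}(z):=\Big\{\delta z\ \Big|\ \delta\text{ is a stable transfer function with }\begin{pmatrix}1\\ \delta\end{pmatrix}^*P_0\begin{pmatrix}1\\ \delta\end{pmatrix}\succ0\text{ on }i\mathbb R\cup\{\infty\}\Big\},\quad z\in\mathcal S,$$ satisfies an IQC with multiplier $\operatorname{diag}(\psi,\psi)^*(P_0\otimes M)\operatorname{diag}(\psi,\psi)$ and terminal cost $Z=P_0\otimes K$; that is, for all $z\in\mathcal S$ and $w\in\boldsymbol{\Delta_{\rm dy}}(z)$, the response of $$\dot\xi=\operatorname{diag}(A_\psi,A_\psi)\xi+\operatorname{diag}(B_\psi,B_\psi)\begin{pmatrix}z\\ w\end{pmatrix},\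 \xi(0)=0,\quad v=\operatorname{diag}(C_\psi,C_\psi)\xi+\operatorname{diag}(D_\psi,D_\psi)\begin{pmatrix}z\\ w\end{pmatrix}$$ satisfies $$\int_0^Tv(t)^T(P_0\otimes M)v(t)\,dt-\xi(T)^T(P_0\otimes K)\xi(T)\ge0\quad\text{for all }T\ge0 .$$
   Context: $\mathbb S^l$ denotes the real symmetric $l\times l$ matrices; $\otimes$ is the Kronecker product; $\prec,\succ$ refer to the (negative/positive definite) ordering of symmetric or Hermitian matrices; $^*$ is the conjugate transpose of the value at points of $i\mathbb R\cup\{\infty\}$. $\mathcal S$ is the set of all $u:[0,\infty)\to\mathbb R$ that are piecewise continuous and right-continuous. Transfer functions/matrices are real rational and proper; stable means all poles lie in the open left half-plane. For a stable transfer function $\delta$ (of any degree) with minimal realization $\delta(s)=C_\delta(sI-A_\delta)^{-1}B_\delta+D_\delta$, $w=\delta z$ denotes the output of $\dot x=A_\delta x+B_\delta z$, $w=C_\delta x+D_\delta z$, $x(0)=0$. *)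

theory Defs
  imports
    "HOL-Analysis.Analysis"
    "HOL-Computational_Algebra.Field_as_Ring"
    "HOL-Computational_Algebra.Polynomial_Factorial"
    "Jordan_Normal_Form.Char_Poly"
    "Jordan_Normal_Form.Schur_Decomposition"
    "Jordan_Normal_Form.DL_Rank"
begin

unbundle no vec_syntax
unbundle no inner_syntax

text \<open>
  Vectors and matrices are those of Jordan_Normal_Form: their dimensions are natural numbers
  that may be quantified over and may be zero, so static systems (no states) are included.
\<close>


section \<open>Matrices\<close>

definition symmetric_mats :: "nat \<Rightarrow> real mat set" where
  "symmetric_mats n = {X \<in> carrier_mat n n. transpose_mat X = X}"

text \<open>
  Over the complex numbers, \<open>0 < c\<close> says that \<open>c\<close> is real and positive.
\<close>

definition pos_def :: "'a :: conjugatable_ordered_field mat \<Rightarrow> bool" where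
  "pos_def X \<longleftrightarrow> square_mat X \<and> mat_adjoint X = X \<and>
     (\<forall>x \<in> carrier_vec (dim_col X). x \<noteq> 0\<^sub>v (dim_col X) \<longrightarrow> 0 < (X *\<^sub>v x) \<bullet>c x)"

definition def_less :: "'a :: conjugatable_ordered_field mat \<Rightarrow> 'a mat \<Rightarrow> bool" (infix "\<prec>" 50) where
  "X \<prec> Y \<longleftrightarrow> pos_def (Y - X)"

definition kronecker :: "'a :: times mat \<Rightarrow> 'a mat \<Rightarrow> 'a mat" (infixl "\<otimes>\<^sub>K" 70) where
  "X \<otimes>\<^sub>K Y = mat (dim_row X * dim_row Y) (dim_col X * dim_col Y)
     (\<lambda>(i, j). X $$ (i div dim_row Y, j div dim_col Y) * Y $$ (i mod dim_row Y, j mod dim_col Y))"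

definition append_cols :: "'a :: zero mat \<Rightarrow> 'a mat \<Rightarrow> 'a mat" where
  "append_cols X Y = four_block_mat X Y (0\<^sub>m 0 (dim_col X)) (0\<^sub>m 0 (dim_col Y))"

abbreviation diag2 :: "'a :: zero mat \<Rightarrow> 'a mat" where
  "diag2 X \<equiv> diag_block_mat [X, X]"

definition full_column_rank :: "'a :: field mat \<Rightarrow> bool" where
  "full_column_rank X \<longleftrightarrow> vec_space.rank (dim_row X) X = dim_col X"


section \<open>Transfer functions and transfer matrices\<close>

type_synonym tf = "real poly fract"

text \<open>
  \<open>quot_of_fract\<close> yields the representation with coprime numerator and denominator, so that
  the poles of a rational function are the roots of that denominator.
\<close>

definition tf_num :: "tf \<Rightarrow> real poly" where
  "tf_num f = fst (quot_of_fract f)"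

definition tf_den :: "tf \<Rightarrow> real poly" where
  "tf_den f = snd (quot_of_fract f)"

definition tf_poles :: "tf \<Rightarrow> complex set" where
  "tf_poles f = {s. poly (map_poly complex_of_real (tf_den f)) s = 0}"

definition tf_proper :: "tf \<Rightarrow> bool" where
  "tf_proper f \<longleftrightarrow> degree (tf_num f) \<le> degree (tf_den f)"

definition tf_stable :: "tf \<Rightarrow> bool" where
  "tf_stable f \<longleftrightarrow> (\<forall>s \<in> tf_poles f. Re s < 0)"

definition tf_at :: "tf \<Rightarrow> complex \<Rightarrow> complex" where
  "tf_at f s = poly (map_poly complex_of_real (tf_num f)) s
             / poly (map_poly complex_of_real (tf_den f)) s"

definition tf_at_inf :: "tf \<Rightarrow> complex" where
  "tf_at_inf f = Lim at_infinity (tf_at f)"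

definition stable_transfer_mat :: "nat \<Rightarrow> nat \<Rightarrow> tf mat \<Rightarrow> bool" where
  "stable_transfer_mat p m G \<longleftrightarrow> G \<in> carrier_mat p m \<and>
     (\<forall>f \<in> elements_mat G. tf_proper f \<and> tf_stable f)"

text \<open>The values taken on the extended imaginary axis.\<close>

definition axis_values :: "tf mat \<Rightarrow> complex mat set" where
  "axis_values G = insert (map_mat tf_at_inf G)
     (range (\<lambda>\<omega> :: real. map_mat (\<lambda>f. tf_at f (\<i> * complex_of_real \<omega>)) G))"

definition full_column_rank_on_axis :: "tf mat \<Rightarrow> bool" where
  "full_column_rank_on_axis G \<longleftrightarrow> (\<forall>V \<in> axis_values G. full_column_rank V)"

text \<open>\<open>fdi G P\<close> says that \<open>G\<^sup>* P G\<close> is positive definite on the extended imaginary axis.\<close>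

definition fdi :: "tf mat \<Rightarrow> real mat \<Rightarrow> bool" where
  "fdi G P \<longleftrightarrow>
     (\<forall>V \<in> axis_values G. pos_def (mat_adjoint V * map_mat complex_of_real P * V))"


section \<open>Realizations\<close>

definition tf_const_mat :: "real mat \<Rightarrow> tf mat" where
  "tf_const_mat = map_mat (\<lambda>a. to_fract [:a:])"

text \<open>
  \<open>G = C (s I - A)\<^sup>-\<^sup>1 B + D\<close> as an identity of matrices over the field of rational functions;
  \<open>char_poly_matrix A\<close> is the polynomial matrix \<open>s I - A\<close>.
\<close>

definition realization ::
    "nat \<Rightarrow> real mat \<Rightarrow> real mat \<Rightarrow> real mat \<Rightarrow> real mat \<Rightarrow> tf mat \<Rightarrow> bool" where
  "realization n A B C D G \<longleftrightarrow>
     A \<in> carrier_mat n n \<and> B \<in> carrier_mat n (dim_col G) \<and>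
     C \<in> carrier_mat (dim_row G) n \<and> D \<in> carrier_mat (dim_row G) (dim_col G) \<and>
     (\<exists>R \<in> carrier_mat n n.
        inverts_mat (map_mat to_fract (char_poly_matrix A)) R \<and>
        inverts_mat R (map_mat to_fract (char_poly_matrix A)) \<and>
        G = tf_const_mat C * R * tf_const_mat B + tf_const_mat D)"

definition minimal_realization ::
    "nat \<Rightarrow> real mat \<Rightarrow> real mat \<Rightarrow> real mat \<Rightarrow> real mat \<Rightarrow> tf mat \<Rightarrow> bool" where
  "minimal_realization n A B C D G \<longleftrightarrow> realization n A B C D G \<and>
     (\<forall>n' A' B' C' D'. realization n' A' B' C' D' G \<longrightarrow> n \<le> n')"


section \<open>Signals and responses\<close>

text \<open>
  Signals on \<open>[0,\<infinity>)\<close> are functions on the reals whose values at negative times are irrelevant.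
  Piecewise continuity means finitely many discontinuities in every bounded interval, with
  finite one-sided limits there; the right limits exist by right-continuity.
\<close>

definition signals :: "(real \<Rightarrow> real) set" where
  "signals = {u.
     (\<forall>t\<ge>0. continuous (at_right t) u) \<and>
     (\<forall>t>0. \<exists>l. (u \<longlongrightarrow> l) (at_left t)) \<and>
     (\<forall>T. finite {t \<in> {0..T}. \<not> continuous (at t within {0..}) u})}"

text \<open>
  The input of a system may jump, so its state is continuous and satisfies the differential
  equation at all times at which the input is continuous. For piecewise continuous inputs this
  determines the state on \<open>[0,\<infinity>)\<close> uniquely.
\<close>

definition state_response ::
    "real mat \<Rightarrow> real mat \<Rightarrow> (real \<Rightarrow> real vec) \<Rightarrow> (real \<Rightarrow> real vec) \<Rightarrow> bool" where
  "state_response A B u x \<longleftrightarrow>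
     (\<forall>t\<ge>0. x t \<in> carrier_vec (dim_row A)) \<and>
     x 0 = 0\<^sub>v (dim_row A) \<and>
     (\<forall>i < dim_row A. continuous_on {0..} (\<lambda>t. x t $ i)) \<and>
     (\<forall>t\<ge>0. (\<forall>j < dim_col B. continuous (at t within {0..}) (\<lambda>\<tau>. u \<tau> $ j)) \<longrightarrow>
        (\<forall>i < dim_row A. ((\<lambda>\<tau>. x \<tau> $ i) has_real_derivative (A *\<^sub>v x t + B *\<^sub>v u t) $ i)
                            (at t within {0..})))"

definition response ::
    "real mat \<Rightarrow> real mat \<Rightarrow> real mat \<Rightarrow> real mat \<Rightarrow> (real \<Rightarrow> real vec) \<Rightarrow>
     (real \<Rightarrow> real vec) \<Rightarrow> (real \<Rightarrow> real vec) \<Rightarrow> bool" where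
  "response A B C D u x y \<longleftrightarrow>
     state_response A B u x \<and> (\<forall>t\<ge>0. y t = C *\<^sub>v x t + D *\<^sub>v u t)"

definition tf_output :: "tf \<Rightarrow> (real \<Rightarrow> real) \<Rightarrow> (real \<Rightarrow> real) \<Rightarrow> bool" where
  "tf_output \<delta> z w \<longleftrightarrow> (\<exists>n A B C D x.
     minimal_realization n A B C D (mat 1 1 (\<lambda>_. \<delta>)) \<and>
     response A B C D (\<lambda>t. vec_of_list [z t]) x (\<lambda>t. vec_of_list [w t]))"


section \<open>Uncertainties and integral quadratic constraints\<close>

definition dynamic_uncertainty :: "real mat \<Rightarrow> (real \<Rightarrow> real) \<Rightarrow> (real \<Rightarrow> real) set" where
  "dynamic_uncertainty P z = {w. \<exists>\<delta>.
     tf_proper \<delta> \<and> tf_stable \<delta> \<and> fdi (mat_of_rows_list 1 [[1], [\<delta>]]) P \<and> tf_output \<delta> z w}"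

text \<open>
  The IQC with multiplier \<open>\<Psi>\<^sup>* P \<Psi>\<close> and terminal cost \<open>Z\<close>, where \<open>(A, B, C, D)\<close> realizes the
  filter \<open>\<Psi>\<close> and \<open>\<xi>\<close> is its state.
\<close>

definition satisfies_iqc ::
    "((real \<Rightarrow> real) \<Rightarrow> (real \<Rightarrow> real) set) \<Rightarrow>
     real mat \<Rightarrow> real mat \<Rightarrow> real mat \<Rightarrow> real mat \<Rightarrow> real mat \<Rightarrow> real mat \<Rightarrow> bool" where
  "satisfies_iqc \<Delta> A B C D P Z \<longleftrightarrow>
     (\<forall>z \<in> signals. \<forall>w \<in> \<Delta> z. \<forall>\<xi> v.
        response A B C D (\<lambda>t. vec_of_list [z t, w t]) \<xi> v \<longrightarrow>
        (\<forall>T\<ge>0. integral {0..T} (\<lambda>t. v t \<bullet> (P *\<^sub>v v t)) - \<xi> T \<bullet> (Z *\<^sub>v \<xi> T) \<ge> 0))"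

end

theory Submission
  imports Defs
begin

text \<open>
  The certificate says that the matrix \<open>Q\<close> obtained by subtracting the left side of the matrix
  inequality from the right side is positive definite. Along a trajectory of the filter with state
  \<open>x\<close>, input \<open>u\<close> and output \<open>y\<close>, the quadratic form of \<open>Q\<close> in \<open>(x, u)\<close> is \<open>y\<^sup>T M y\<close> minus the
  derivative of the storage \<open>x\<^sup>T K x\<close>, and this identity polarizes to two trajectories. Let \<open>f\<close>
  collect the filter state and input belonging to \<open>z\<close>, and \<open>g\<close> those belonging to \<open>w\<close>. Then the left
  side of the IQC, terminal cost included, equals
  \<open>\<integral> \<Sum>\<^sub>j\<^sub>k Q\<^sub>j\<^sub>k (q f\<^sub>j f\<^sub>k + s f\<^sub>j g\<^sub>k + s g\<^sub>j f\<^sub>k + r g\<^sub>j g\<^sub>k) dt\<close> over \<open>[0, T]\<close>.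

  Since \<open>\<delta>\<close> is scalar, it commutes with the filter, so that \<open>g\<^sub>j = \<delta> f\<^sub>j\<close> for every \<open>j\<close>. Now
  replace every \<open>f\<^sub>j\<close> by its truncation at \<open>T\<close>. By causality nothing changes on \<open>[0, T]\<close>, and after
  \<open>T\<close> only the term with \<open>r \<le> 0\<close> survives, which is nonpositive because \<open>Q\<close> is positive
  semidefinite. Therefore the integral over \<open>[0, T]\<close> is at least the limit of the integrals over
  \<open>[0, S]\<close> as \<open>S\<close> tends to infinity, and this limit is controlled by the frequency domain inequality
  for \<open>\<delta>\<close>. This is the content of \<open>truncated_quadratic_constraint\<close>.

  Both the commutation and the frequency domain step are carried out in the time domain, by an
  operational calculus. Piecewise continuous functions form a module over the complex polynomials,
  the variable \<open>X = 1/s\<close> acting as integration from \<open>0\<close>. A polynomial with nonzero constant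
  coefficient acts bijectively (\<open>vpoly_uniqueness\<close>, \<open>vpoly_existence\<close>), so a proper transfer function
  is a fraction \<open>n/d\<close> of such polynomials with \<open>d(0) \<noteq> 0\<close>, and a realization is turned into such a
  fraction by the adjugate of \<open>1 - X A\<close>. If \<open>\<delta> = n/d\<close> is stable and \<open>d e = f\<close> with \<open>f\<close> vanishing after
  \<open>T\<close>, then \<open>X\<^sup>k e\<close> tends to \<open>0\<close> for all \<open>k\<close> up to the degree of \<open>d\<close> (\<open>vpoly_decay\<close>). Integration by
  parts then makes \<open>X\<close> skew-adjoint up to vanishing boundary terms, whence \<open>\<integral> (u e) (v e)\<^sup>*\<close> depends
  asymptotically only on the polynomial \<open>u v\<^sup>~\<close>, where \<open>v\<^sup>~(X)\<close> conjugates the coefficients of \<open>v(-X)\<close>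
  (\<open>pairing_asymptotics\<close>). The frequency domain inequality says that
  \<open>q d d\<^sup>~ + s (d n\<^sup>~ + n d\<^sup>~) + r n n\<^sup>~\<close> is positive on the imaginary axis, hence of the form \<open>h h\<^sup>~\<close>
  (\<open>spectral_factorization\<close>), and the integral becomes, in the limit, the integral of the
  nonnegative form of \<open>Q\<close> in the signals \<open>h e\<^sub>j\<close>.
\<close>

section \<open>Piecewise continuous signals and integration\<close>

text \<open>
  Boundedness on compact intervals replaces the existence of one-sided limits. This makes the class
  closed under products and still guarantees integrability.
\<close>

definition piecewise_cont :: "(real \<Rightarrow> complex) \<Rightarrow> bool" where
  "piecewise_cont f \<longleftrightarrow> (\<forall>T. bounded (f ` {0..T}) \<and>
     finite {t \<in> {0..T}. \<not> continuous (at t within {0..}) f})"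

lemma piecewise_contD:
  assumes "piecewise_cont f"
  shows "bounded (f ` {0..T})" "finite {t \<in> {0..T}. \<not> continuous (at t within {0..}) f}"
  using assms by (auto simp: piecewise_cont_def)

lemma piecewise_contI_bound:
  assumes "\<And>T. \<exists>c. \<forall>t\<in>{0..T}. norm (f t) \<le> c"
    and "\<And>T. finite {t \<in> {0..T}. \<not> continuous (at t within {0..}) f}"
  shows "piecewise_cont f"
  using assms unfolding piecewise_cont_def bounded_iff by fastforce

lemma piecewise_cont_compose2:
  assumes f: "piecewise_cont f" and g: "piecewise_cont g"
    and bnd: "\<And>T. bounded ((\<lambda>t. h (f t) (g t)) ` {0..T})"
    and cont: "\<And>t. continuous (at t within {0..}) f \<Longrightarrow> continuous (at t within {0..}) g \<Longrightarrow>
                continuous (at t within {0..}) (\<lambda>t. h (f t) (g t))"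
  shows "piecewise_cont (\<lambda>t. h (f t) (g t))"
  unfolding piecewise_cont_def
proof (intro allI conjI bnd)
  fix T
  have "{t \<in> {0..T}. \<not> continuous (at t within {0..}) (\<lambda>t. h (f t) (g t))} \<subseteq>
      {t \<in> {0..T}. \<not> continuous (at t within {0..}) f} \<union>
      {t \<in> {0..T}. \<not> continuous (at t within {0..}) g}"
    using cont by blast
  then show "finite {t \<in> {0..T}. \<not> continuous (at t within {0..}) (\<lambda>t. h (f t) (g t))}"
    by (rule finite_subset) (use f g in \<open>auto dest: piecewise_contD(2)\<close>)
qed

lemma piecewise_cont_add [intro]:
  assumes "piecewise_cont f" "piecewise_cont g"
  shows "piecewise_cont (\<lambda>t. f t + g t)"
proof (rule piecewise_cont_compose2[OF assms])
  show "bounded ((\<lambda>t. f t + g t) ` {0..T})" for T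
    using piecewise_contD(1)[OF assms(1), of T] piecewise_contD(1)[OF assms(2), of T]
    by (rule bounded_plus_comp)
qed (intro continuous_intros)

lemma piecewise_cont_mult [intro]:
  assumes "piecewise_cont f" "piecewise_cont g"
  shows "piecewise_cont (\<lambda>t. f t * g t)"
proof (rule piecewise_cont_compose2[OF assms])
  show "bounded ((\<lambda>t. f t * g t) ` {0..T})" for T
  proof -
    obtain a where "\<forall>t\<in>{0..T}. norm (f t) \<le> a"
      using piecewise_contD(1)[OF assms(1), of T] by (auto simp: bounded_iff)
    moreover obtain b where "\<forall>t\<in>{0..T}. norm (g t) \<le> b"
      using piecewise_contD(1)[OF assms(2), of T] by (auto simp: bounded_iff)
    ultimately show ?thesis
      unfolding bounded_iff by (force simp: norm_mult intro!: exI[of _ "a * b"] mult_mono intro: order_trans[OF norm_ge_zero])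
  qed
qed (intro continuous_intros)

lemma piecewise_cont_of_continuous:
  assumes "continuous_on {0..} f"
  shows "piecewise_cont f"
  unfolding piecewise_cont_def
proof (intro allI conjI)
  show "bounded (f ` {0..T})" for T
    by (intro compact_imp_bounded compact_continuous_image continuous_on_subset[OF assms]) auto
  have "{t \<in> {0..T}. \<not> continuous (at t within {0..}) f} = {}" for T
    using assms by (auto simp: continuous_on_eq_continuous_within)
  then show "finite {t \<in> {0..T}. \<not> continuous (at t within {0..}) f}" for T by (simp only: finite.emptyI)
qed

lemma piecewise_cont_const [simp, intro]: "piecewise_cont (\<lambda>t. c)"
  by (rule piecewise_cont_of_continuous) simp

lemma piecewise_cont_cmult [intro]: "piecewise_cont f \<Longrightarrow> piecewise_cont (\<lambda>t. c * f t)"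
  by (rule piecewise_cont_mult) auto

lemma piecewise_cont_minus [intro]: "piecewise_cont f \<Longrightarrow> piecewise_cont (\<lambda>t. - f t)"
  using piecewise_cont_cmult[of f "-1"] by simp

lemma piecewise_cont_diff [intro]: "piecewise_cont f \<Longrightarrow> piecewise_cont g \<Longrightarrow> piecewise_cont (\<lambda>t. f t - g t)"
  using piecewise_cont_add[of f "\<lambda>t. - g t"] by auto

lemma piecewise_cont_sum [intro]: "(\<And>i. i \<in> A \<Longrightarrow> piecewise_cont (f i)) \<Longrightarrow> piecewise_cont (\<lambda>t. \<Sum>i\<in>A. f i t)"
  by (induction A rule: infinite_finite_induct) auto

lemma piecewise_cont_cnj [intro]:
  assumes "piecewise_cont f"
  shows "piecewise_cont (\<lambda>t. cnj (f t))"
proof (rule piecewise_cont_compose2[OF assms assms])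
  show "bounded ((\<lambda>t. cnj (f t)) ` {0..T})" for T
    using piecewise_contD(1)[OF assms, of T] by (auto simp: bounded_iff)
qed (intro continuous_intros)

text \<open>
  Off the finite set of jumps the function is continuous, hence measurable, and it is bounded.
\<close>

lemma piecewise_cont_integrable:
  assumes f: "piecewise_cont f" and a: "0 \<le> a"
  shows "f integrable_on {a..b}"
proof -
  let ?F = "{t \<in> {0..b}. \<not> continuous (at t within {0..}) f}"
  have fin: "finite ?F" using piecewise_contD(2)[OF f] .
  obtain c where c: "\<forall>t\<in>{0..b}. norm (f t) \<le> c"
    using piecewise_contD(1)[OF f, of b] by (auto simp: bounded_iff)
  let ?S = "{a..b} - ?F"
  have S: "?S \<in> sets lebesgue"
    using fin by (intro sets.Diff) (auto intro: negligible_imp_sets negligible_finite)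
  have "continuous_on ?S f"
    unfolding continuous_on_eq_continuous_within
  proof
    fix t assume "t \<in> ?S"
    then have "continuous (at t within {0..}) f" using a by auto
    then show "continuous (at t within ?S) f"
      by (rule continuous_within_subset) (use a in auto)
  qed
  then have meas: "f \<in> borel_measurable (lebesgue_on ?S)"
    using S by (rule continuous_imp_measurable_on_sets_lebesgue)
  have const: "(\<lambda>x. c) integrable_on ?S"
    by (rule integrable_spike_set[of _ "{a..b}"])
       (auto intro: negligible_subset[OF negligible_finite[OF fin]])
  have "f integrable_on ?S"
    by (rule measurable_bounded_by_integrable_imp_integrable[OF meas const _ S])
       (use c a in auto)
  then show ?thesis
    by (rule integrable_spike_set) (auto intro: negligible_subset[OF negligible_finite[OF fin]])
qed

text \<open>
  This operator plays the part of \<open>1/s\<close>. As an integral over \<open>{0..t}\<close> it vanishes at negative times,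
  so that identities between its powers hold as identities of functions.
\<close>

definition volterra :: "(real \<Rightarrow> complex) \<Rightarrow> real \<Rightarrow> complex" where
  "volterra f t = integral {0..t} f"

lemma volterra_0 [simp]: "t \<le> 0 \<Longrightarrow> volterra f t = 0"
  by (cases "t = 0") (auto simp: volterra_def)

lemma volterra_cong: "(\<And>t. t \<in> {0..T} \<Longrightarrow> f t = g t) \<Longrightarrow> t \<in> {0..T} \<Longrightarrow> volterra f t = volterra g t"
  unfolding volterra_def by (rule integral_cong) auto

lemma continuous_on_volterra:
  assumes "piecewise_cont f"
  shows "continuous_on {0..} (volterra f)"
  unfolding continuous_on_eq_continuous_within
proof
  fix t :: real assume t: "t \<in> {0..}"
  have "continuous_on {0..t+1} (volterra f)"
    unfolding volterra_def
    by (rule indefinite_integral_continuous_1) (use assms piecewise_cont_integrable in auto)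
  then have "continuous (at t within {0..t+1}) (volterra f)"
    using t by (auto simp: continuous_on_eq_continuous_within)
  moreover have "at t within {0..t+1} = at t within {0..}"
    by (rule at_within_nhd[of _ "{..<t+1}"]) (use t in auto)
  ultimately show "continuous (at t within {0..}) (volterra f)"
    by simp
qed

lemma piecewise_cont_volterra [intro]: "piecewise_cont f \<Longrightarrow> piecewise_cont (volterra f)"
  by (rule piecewise_cont_of_continuous, rule continuous_on_volterra)

lemma volterra_deriv:
  assumes f: "piecewise_cont f" and t: "t > 0" and c: "continuous (at t within {0..}) f"
  shows "(volterra f has_vector_derivative f t) (at t)"
proof -
  have "((\<lambda>u. integral {0..u} f) has_vector_derivative f t) (at t within ({0..t+1} - {}))"
    by (rule integral_has_vector_derivative_continuous_at)
       (use f t c piecewise_cont_integrable in \<open>auto intro: continuous_within_subset\<close>)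
  moreover have "at t within ({0..t+1} - {}) = at t"
    by (rule at_within_interior) (use t in auto)
  ultimately show ?thesis unfolding volterra_def[abs_def] by simp
qed

text \<open>
  The integrand is matched with a derivative only off a finite set, since the states of a system
  with jumping input are differentiable only there.
\<close>

lemma volterra_eqI_finite:
  assumes F: "finite F" and y: "continuous_on {0..T} y"
    and d: "\<And>t. 0 < t \<Longrightarrow> t < T \<Longrightarrow> t \<notin> F \<Longrightarrow> (y has_vector_derivative f t) (at t)"
    and t: "0 \<le> t" "t \<le> T"
  shows "volterra f t = y t - y 0"
proof -
  have "(f has_integral (y t - y 0)) {0..t}"
  proof (rule fundamental_theorem_of_calculus_interior_strong[OF F])
    show "continuous_on {0..t} y" by (rule continuous_on_subset[OF y]) (use t in auto)
  qed (use d t in auto)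
  then show ?thesis by (simp add: volterra_def integral_unique)
qed

lemma volterra_eqI:
  assumes f: "piecewise_cont f" and y: "continuous_on {0..T} y"
    and d: "\<And>t. 0 < t \<Longrightarrow> t < T \<Longrightarrow> continuous (at t within {0..}) f \<Longrightarrow> (y has_vector_derivative f t) (at t)"
    and t: "0 \<le> t" "t \<le> T"
  shows "volterra f t = y t - y 0"
  by (rule volterra_eqI_finite[OF piecewise_contD(2)[OF f, of T] y d t]) auto

lemma piecewise_cont_cong:
  assumes f: "piecewise_cont f" and eq: "\<And>t. 0 \<le> t \<Longrightarrow> f t = g t"
  shows "piecewise_cont g"
  unfolding piecewise_cont_def
proof (intro allI conjI)
  fix T
  have "f ` {0..T} = g ` {0..T}" using eq by (intro image_cong) auto
  then show "bounded (g ` {0..T})" using piecewise_contD(1)[OF f, of T] by simp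
  have "continuous (at t within {0..}) g" if "continuous (at t within {0..}) f" "0 \<le> t" for t
    by (rule continuous_transform_within[OF that(1), of 1]) (use eq that in auto)
  then have "{t \<in> {0..T}. \<not> continuous (at t within {0..}) g} \<subseteq> {t \<in> {0..T}. \<not> continuous (at t within {0..}) f}"
    by auto
  then show "finite {t \<in> {0..T}. \<not> continuous (at t within {0..}) g}"
    by (rule finite_subset) (use piecewise_contD(2)[OF f] in auto)
qed

lemma volterra_add: "piecewise_cont f \<Longrightarrow> piecewise_cont g \<Longrightarrow>
    volterra (\<lambda>t. f t + g t) = (\<lambda>t. volterra f t + volterra g t)"
  unfolding volterra_def[abs_def] by (intro ext integral_add piecewise_cont_integrable) auto

lemma volterra_cmult: "volterra (\<lambda>t. c * f t) = (\<lambda>t. c * volterra f t)"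
  unfolding volterra_def[abs_def] by (intro ext integral_mult_right)

text \<open>
  Integration by parts. It makes integration skew-symmetric for the pairing \<open>\<integral> f g\<close>, up to a boundary
  term at the end of the interval.
\<close>

lemma volterra_mult:
  assumes f: "piecewise_cont f" and g: "piecewise_cont g" and t: "0 \<le> t"
  shows "volterra (\<lambda>t. volterra f t * g t + f t * volterra g t) t = volterra f t * volterra g t"
proof -
  let ?h = "\<lambda>t. volterra f t * g t + f t * volterra g t"
  let ?F = "{s \<in> {0..t}. \<not> continuous (at s within {0..}) f} \<union> {s \<in> {0..t}. \<not> continuous (at s within {0..}) g}"
  have "(?h has_integral (volterra f t * volterra g t - volterra f 0 * volterra g 0)) {0..t}"
  proof (rule fundamental_theorem_of_calculus_interior_strong)
    show "finite ?F" using f g by (auto dest: piecewise_contD(2))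
    show "continuous_on {0..t} (\<lambda>t. volterra f t * volterra g t)"
      by (intro continuous_intros continuous_on_subset[OF continuous_on_volterra] f g) auto
    show "((\<lambda>t. volterra f t * volterra g t) has_vector_derivative ?h s) (at s)" if "s \<in> {0<..<t} - ?F" for s
      by (rule has_vector_derivative_mult) (use that in \<open>auto intro!: volterra_deriv f g\<close>)
  qed (use t in auto)
  then show ?thesis unfolding volterra_def[of "?h"] by (simp add: integral_unique)
qed

section \<open>Polynomials in the integration operator\<close>

text \<open>
  The action of the polynomial ring on signals in which the variable integrates from \<open>0\<close>.
\<close>

definition vpoly :: "complex poly \<Rightarrow> (real \<Rightarrow> complex) \<Rightarrow> real \<Rightarrow> complex" where
  "vpoly p f t = (\<Sum>k\<le>degree p. coeff p k * (volterra ^^ k) f t)"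

lemma vpoly_eq_sum:
  assumes "degree p \<le> N"
  shows "vpoly p f t = (\<Sum>k\<le>N. coeff p k * (volterra ^^ k) f t)"
  unfolding vpoly_def
  by (rule sum.mono_neutral_left) (use assms in \<open>auto simp: coeff_eq_0\<close>)

lemma piecewise_cont_funpow [intro]: "piecewise_cont f \<Longrightarrow> piecewise_cont ((volterra ^^ k) f)"
  by (induction k) auto

lemma piecewise_cont_vpoly [intro]: "piecewise_cont f \<Longrightarrow> piecewise_cont (vpoly p f)"
  unfolding vpoly_def[abs_def] by (intro piecewise_cont_sum piecewise_cont_cmult piecewise_cont_funpow)

lemma volterra_sum:
  "(\<And>i. i \<in> A \<Longrightarrow> piecewise_cont (f i)) \<Longrightarrow>
    volterra (\<lambda>t. \<Sum>i\<in>A. f i t) = (\<lambda>t. \<Sum>i\<in>A. volterra (f i) t)"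
proof (induction A rule: infinite_finite_induct)
  case (insert a A)
  then show ?case by (simp add: volterra_add piecewise_cont_sum)
qed (auto simp: volterra_def)

lemma volterra_vpoly:
  assumes "piecewise_cont f"
  shows "volterra (vpoly p f) = vpoly p (volterra f)"
  unfolding vpoly_def[abs_def] using assms
  by (subst volterra_sum) (auto simp: volterra_cmult funpow_swap1)

lemma funpow_volterra_add: "piecewise_cont f \<Longrightarrow> piecewise_cont g \<Longrightarrow>
    (volterra ^^ k) (\<lambda>t. f t + g t) = (\<lambda>t. (volterra ^^ k) f t + (volterra ^^ k) g t)"
  by (induction k) (auto simp: volterra_add piecewise_cont_funpow)

lemma funpow_volterra_cmult: "(volterra ^^ k) (\<lambda>t. c * f t) = (\<lambda>t. c * (volterra ^^ k) f t)"
  by (induction k) (auto simp: volterra_cmult)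

lemma vpoly_fun_add: "piecewise_cont f \<Longrightarrow> piecewise_cont g \<Longrightarrow>
    vpoly p (\<lambda>t. f t + g t) = (\<lambda>t. vpoly p f t + vpoly p g t)"
  by (auto simp: vpoly_def funpow_volterra_add sum.distrib algebra_simps)

lemma vpoly_fun_cmult: "vpoly p (\<lambda>t. c * f t) = (\<lambda>t. c * vpoly p f t)"
  by (auto simp: vpoly_def funpow_volterra_cmult sum_distrib_left algebra_simps)

lemma vpoly_fun_diff: "piecewise_cont f \<Longrightarrow> piecewise_cont g \<Longrightarrow>
    vpoly p (\<lambda>t. f t - g t) = (\<lambda>t. vpoly p f t - vpoly p g t)"
  using vpoly_fun_add[of f "\<lambda>t. (-1) * g t" p] vpoly_fun_cmult[of p "-1" g]
  by (simp add: piecewise_cont_minus)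

lemma vpoly_fun_zero [simp]: "vpoly p (\<lambda>t. 0) = (\<lambda>t. 0)"
  using vpoly_fun_cmult[of p 0 "\<lambda>t. 0"] by simp

lemma vpoly_fun_sum:
  "(\<And>i. i \<in> A \<Longrightarrow> piecewise_cont (f i)) \<Longrightarrow>
    vpoly p (\<lambda>t. \<Sum>i\<in>A. f i t) = (\<lambda>t. \<Sum>i\<in>A. vpoly p (f i) t)"
proof (induction A rule: infinite_finite_induct)
  case (insert a A)
  then show ?case by (simp add: vpoly_fun_add piecewise_cont_sum)
qed auto

lemma vpoly_add: "vpoly (p + q) f t = vpoly p f t + vpoly q f t"
proof -
  define N where "N = max (degree p) (degree q)"
  have "degree (p + q) \<le> N" "degree p \<le> N" "degree q \<le> N"
    by (auto simp: N_def degree_add_le_max)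
  then show ?thesis by (simp add: vpoly_eq_sum sum.distrib algebra_simps)
qed

lemma vpoly_smult: "vpoly (Polynomial.smult c p) f t = c * vpoly p f t"
  by (simp add: vpoly_eq_sum[of _ "degree p"] degree_smult_le sum_distrib_left algebra_simps)

lemma vpoly_zero [simp]: "vpoly 0 f = (\<lambda>t. 0)"
  by (auto simp: vpoly_def)

lemma vpoly_pCons: "vpoly (pCons a p) f t = a * f t + vpoly p (volterra f) t"
  by (subst vpoly_eq_sum[of _ "Suc (degree p)"])
     (auto simp: degree_pCons_le sum.atMost_Suc_shift vpoly_def funpow_swap1 simp del: sum.atMost_Suc)

lemma vpoly_const [simp]: "vpoly [:c:] f = (\<lambda>t. c * f t)"
  by (auto simp: vpoly_def)

lemma vpoly_linear: "vpoly [:a, b:] f = (\<lambda>t. a * f t + b * volterra f t)"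
  by (auto simp: vpoly_pCons)

lemma vpoly_monom_funpow: "vpoly (Polynomial.monom 1 k) f = (volterra ^^ k) f"
proof
  show "vpoly (Polynomial.monom 1 k) f t = (volterra ^^ k) f t" for t
    by (simp add: vpoly_eq_sum[OF degree_monom_le] if_distrib[of "\<lambda>x. x * _"] cong: if_cong)
qed

text \<open>
  Products act by composition, so signals form a module. Every identity between transfer functions
  below becomes a polynomial identity through this law.
\<close>

lemma vpoly_mult:
  assumes f: "piecewise_cont f"
  shows "vpoly (p * q) f = vpoly p (vpoly q f)"
  using f
proof (induction p arbitrary: f)
  case (pCons a p)
  have "vpoly (pCons a p * q) f t = vpoly (pCons a p) (vpoly q f) t" for t
    using pCons.IH[of "volterra f"] pCons.prems
    by (simp add: mult_pCons_left vpoly_add vpoly_smult vpoly_pCons volterra_vpoly piecewise_cont_volterra)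
  then show ?case by blast
qed simp

text \<open>
  Causality: the action on \<open>[0, T]\<close> only sees the signal on \<open>[0, T]\<close>.
\<close>

lemma vpoly_cong:
  assumes "\<And>t. t \<in> {0..T} \<Longrightarrow> f t = g t" and "t \<in> {0..T}"
  shows "vpoly p f t = vpoly p g t"
proof -
  have "\<forall>t\<in>{0..T}. (volterra ^^ k) f t = (volterra ^^ k) g t" for k
    by (induction k) (use assms in \<open>auto intro: volterra_cong\<close>)
  then show ?thesis using assms by (simp add: vpoly_def)
qed

text \<open>
  A complex polynomial with nonzero constant coefficient is a constant times a product of factors
  \<open>1 - a X\<close> with \<open>a \<noteq> 0\<close>, one for each root \<open>1/a\<close>. The factor \<open>1 - a X\<close> corresponds to the first-order
  operator \<open>s - a\<close>.
\<close>

lemma poly_nonzero_const_induct [consumes 1, case_names const factor]: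
  fixes p :: "complex poly"
  assumes "poly p 0 \<noteq> 0"
    and const: "\<And>c. c \<noteq> 0 \<Longrightarrow> P [:c:]"
    and factor: "\<And>a p. a \<noteq> 0 \<Longrightarrow> poly p 0 \<noteq> 0 \<Longrightarrow> P p \<Longrightarrow> P ([:1, - a:] * p)"
  shows "P p"
  using assms(1)
proof (induction "degree p" arbitrary: p rule: less_induct)
  case less
  show ?case
  proof (cases "degree p = 0")
    case True
    then obtain c where "p = [:c:]" by (rule degree_eq_zeroE)
    then show ?thesis using const less.prems by auto
  next
    case False
    then obtain x where x: "poly p x = 0"
      using fundamental_theorem_of_algebra by (metis constant_degree)
    have x0: "x \<noteq> 0" using x less.prems by auto
    from x obtain r where r: "p = [:- x, 1:] * r" using poly_eq_0_iff_dvd by (metis dvdE)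
    define s where "s = Polynomial.smult (- x) r"
    have p: "p = [:1, - inverse x:] * s"
      unfolding r s_def using x0 by (intro poly_eqI) (simp add: coeff_pCons field_simps split: nat.splits)
    have s0: "poly s 0 \<noteq> 0" using less.prems unfolding p by simp
    then have "s \<noteq> 0" by auto
    then have "degree p = Suc (degree s)"
      unfolding p using x0 by (subst degree_mult_eq) auto
    then have "P s" using less.hyps s0 by simp
    then show ?thesis unfolding p using x0 s0 by (intro factor) auto
  qed
qed

lemma exp_deriv: "((\<lambda>t. exp (a * complex_of_real t)) has_vector_derivative a * exp (a * complex_of_real t)) (at t)"
  by (rule has_vector_derivative_eq_rhs, rule has_vector_derivative_real_field)
     (auto intro!: derivative_eq_intros)

text \<open>
  The integral \<open>y\<close> of \<open>h\<close> solves \<open>y' = a y\<close> with \<open>y(0) = 0\<close>, so \<open>exp (- a t) y(t)\<close> is constant.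
\<close>

lemma first_order_uniqueness:
  assumes h: "piecewise_cont h" and eq: "\<And>t. t \<in> {0..T} \<Longrightarrow> h t - a * volterra h t = 0" and t: "t \<in> {0..T}"
  shows "h t = 0"
proof -
  have cont: "continuous (at s within {0..}) h" if "0 < s" "s < T" for s
  proof -
    have "continuous (at s within {0..}) (\<lambda>t. a * volterra h t)"
      using continuous_on_volterra[OF h] that
      by (intro continuous_intros) (auto simp: continuous_on_eq_continuous_within)
    then show ?thesis
      by (rule continuous_transform_within[of _ _ _ "T - s"]) (use that eq in \<open>auto simp: dist_real_def\<close>)
  qed
  have "volterra (\<lambda>t. 0) t = exp (- a * t) * volterra h t - exp (- a * (0::real)) * volterra h 0"
  proof (rule volterra_eqI)
    show "continuous_on {0..T} (\<lambda>t. exp (- a * t) * volterra h t)"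
      by (intro continuous_intros continuous_on_subset[OF continuous_on_volterra] h) auto
    show "((\<lambda>t. exp (- a * t) * volterra h t) has_vector_derivative 0) (at s)" if "0 < s" "s < T" for s
    proof (rule has_vector_derivative_eq_rhs)
      show "((\<lambda>t. exp (- a * t) * volterra h t) has_vector_derivative
         (exp (- a * s) * h s + - a * exp (- a * s) * volterra h s)) (at s)"
        by (intro has_vector_derivative_mult exp_deriv volterra_deriv h that cont)
      show "exp (- a * s) * h s + - a * exp (- a * s) * volterra h s = 0"
        using eq[of s] that by (auto simp: algebra_simps)
    qed
  qed (use t in auto)
  then have "volterra h t = 0" by (simp add: volterra_def)
  then show ?thesis using eq[OF t] by simp
qed

text \<open>
  With \<open>E' = a E + f\<close> and \<open>E(0) = 0\<close>, given by variation of constants, the function \<open>f + a E\<close> has the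
  integral \<open>E\<close>.
\<close>

lemma first_order_existence:
  assumes f: "piecewise_cont f"
  shows "\<exists>h. piecewise_cont h \<and> (\<forall>t\<ge>0. h t - a * volterra h t = f t)"
proof -
  define E where "E t = exp (a * complex_of_real t) * volterra (\<lambda>s. exp (- a * complex_of_real s) * f s) t" for t
  have ef: "piecewise_cont (\<lambda>s. exp (- a * complex_of_real s) * f s)"
    by (intro piecewise_cont_mult f piecewise_cont_of_continuous continuous_intros)
  have E: "continuous_on {0..} E"
    unfolding E_def[abs_def] by (intro continuous_intros continuous_on_volterra ef)
  define h where "h t = f t + a * E t" for t
  have h: "piecewise_cont h"
    unfolding h_def[abs_def] by (intro piecewise_cont_add f piecewise_cont_cmult piecewise_cont_of_continuous E)
  have "volterra h t = E t - E 0" if "t \<ge> 0" for t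
  proof (rule volterra_eqI[OF h])
    show "continuous_on {0..t} E" by (rule continuous_on_subset[OF E]) auto
    fix s assume s: "0 < s" "s < t" "continuous (at s within {0..}) h"
    have "continuous (at s within {0..}) (\<lambda>t. h t - a * E t)"
      using s E by (intro continuous_intros) (auto simp: continuous_on_eq_continuous_within)
    then have fc: "continuous (at s within {0..}) f" by (simp add: h_def)
    have "continuous (at s within {0..}) (\<lambda>s. exp (- a * complex_of_real s) * f s)"
      by (intro continuous_intros fc)
    then have "(E has_vector_derivative (exp (a * s) * (exp (- a * s) * f s) +
        a * exp (a * s) * volterra (\<lambda>s. exp (- a * complex_of_real s) * f s) s)) (at s)"
      unfolding E_def[abs_def] by (intro has_vector_derivative_mult exp_deriv volterra_deriv ef s)
    also have "exp (a * s) * (exp (- a * s) * f s) +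
        a * exp (a * s) * volterra (\<lambda>s. exp (- a * complex_of_real s) * f s) s = h s"
      by (simp add: h_def E_def exp_minus field_simps)
    finally show "(E has_vector_derivative h s) (at s)" .
  qed (use that in auto)
  moreover have "E 0 = 0" by (simp add: E_def)
  ultimately show ?thesis using h by (intro exI[of _ h]) (auto simp: h_def)
qed

lemma vpoly_uniqueness:
  assumes "poly p 0 \<noteq> 0" "piecewise_cont g" "\<And>t. t \<in> {0..T} \<Longrightarrow> vpoly p g t = 0" "t \<in> {0..T}"
  shows "g t = 0"
  using assms
proof (induction p arbitrary: g t rule: poly_nonzero_const_induct)
  case (factor a p)
  have "vpoly [:1, - a:] (vpoly p g) t = 0" if "t \<in> {0..T}" for t
    using factor.prems that by (metis vpoly_mult)
  then have "vpoly p g t = 0" if "t \<in> {0..T}" for t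
    using that factor.prems by (intro first_order_uniqueness[of "vpoly p g" T a]) (auto simp: vpoly_linear)
  then show ?case using factor by blast
qed auto

lemma vpoly_existence:
  assumes "poly p 0 \<noteq> 0" "piecewise_cont f"
  shows "\<exists>g. piecewise_cont g \<and> (\<forall>t\<ge>0. vpoly p g t = f t)"
  using assms
proof (induction p arbitrary: f rule: poly_nonzero_const_induct)
  case (const c)
  then show ?case by (intro exI[of _ "\<lambda>t. inverse c * f t"]) auto
next
  case (factor a p)
  obtain h where h: "piecewise_cont h" "\<forall>t\<ge>0. h t - a * volterra h t = f t"
    using first_order_existence[OF factor.prems] by blast
  obtain g where g: "piecewise_cont g" "\<forall>t\<ge>0. vpoly p g t = h t"
    using factor.IH[OF h(1)] by blast
  have "vpoly ([:1, - a:] * p) g t = f t" if "t \<ge> 0" for t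
  proof -
    have "vpoly ([:1, - a:] * p) g t = vpoly [:1, - a:] h t"
      unfolding vpoly_mult[OF g(1)] by (rule vpoly_cong[of t]) (use g that in auto)
    then show ?thesis using h that by (simp add: vpoly_linear)
  qed
  then show ?case using g by blast
qed

text \<open>
  The integral \<open>y\<close> of \<open>h\<close> solves \<open>y' = a y + f\<close> with \<open>Re a < 0\<close>. By variation of constants the part of
  \<open>f\<close> before a large time contributes an exponentially decaying term, and the part after it a term
  bounded by the supremum of \<open>\<bar>f\<bar>\<close> there, divided by \<open>- Re a\<close>.
\<close>

lemma first_order_decay:
  assumes h: "piecewise_cont h" and f: "piecewise_cont f" and eq: "\<And>t. t \<ge> 0 \<Longrightarrow> h t - a * volterra h t = f t"
    and a: "Re a < 0" and lim: "(f \<longlongrightarrow> 0) at_top"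
  shows "(volterra h \<longlongrightarrow> 0) at_top"
proof -
  define \<mu> where "\<mu> = - Re a"
  have \<mu>: "\<mu> > 0" using a by (simp add: \<mu>_def)
  define ef where "ef s = exp (- a * complex_of_real s) * f s" for s
  have ef: "piecewise_cont ef"
    unfolding ef_def[abs_def] by (intro piecewise_cont_mult f piecewise_cont_of_continuous continuous_intros)
  have sol: "volterra ef t = exp (- a * t) * volterra h t" if "t \<ge> 0" for t
  proof -
    have "volterra ef t = exp (- a * t) * volterra h t - exp (- a * (0::real)) * volterra h 0"
    proof (rule volterra_eqI[OF ef])
      show "continuous_on {0..t} (\<lambda>t. exp (- a * t) * volterra h t)"
        by (intro continuous_intros continuous_on_subset[OF continuous_on_volterra] h) auto
      fix s assume s: "0 < s" "s < t" "continuous (at s within {0..}) ef"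
      have "continuous (at s within {0..}) (\<lambda>t. exp (a * t) * ef t + a * volterra h t)"
        using s continuous_on_volterra[OF h]
        by (intro continuous_intros) (auto simp: continuous_on_eq_continuous_within)
      then have hc: "continuous (at s within {0..}) h"
        by (rule continuous_transform_within[of _ _ _ 1])
           (use s eq in \<open>auto simp: ef_def algebra_simps simp flip: exp_add mult.assoc\<close>)
      show "((\<lambda>t. exp (- a * t) * volterra h t) has_vector_derivative ef s) (at s)"
      proof (rule has_vector_derivative_eq_rhs)
        show "((\<lambda>t. exp (- a * t) * volterra h t) has_vector_derivative
           (exp (- a * s) * h s + - a * exp (- a * s) * volterra h s)) (at s)"
          by (intro has_vector_derivative_mult exp_deriv volterra_deriv h s hc)
        show "exp (- a * s) * h s + - a * exp (- a * s) * volterra h s = ef s"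
          using eq[of s] s by (auto simp: ef_def algebra_simps)
      qed
    qed (use that in auto)
    then show ?thesis by simp
  qed
  have nexp: "norm (exp (a * complex_of_real t)) = exp (- \<mu> * t)"
      "norm (exp (- (a * complex_of_real t))) = exp (\<mu> * t)" for t
    by (simp_all add: \<mu>_def)
  show ?thesis
  proof (rule tendstoI)
    fix e :: real assume e: "e > 0"
    \<comment> \<open>a tail bounded by \<open>d\<close> contributes at most \<open>d/\<mu> = e/2\<close> to the solution\<close>
    define d where "d = \<mu> * e / 2"
    have d: "d > 0" using e \<mu> by (simp add: d_def)
    have "\<forall>\<^sub>F t in at_top. norm (f t) < d"
      using tendstoD[OF lim d] by simp
    then obtain T0 where T0: "\<And>t. t \<ge> T0 \<Longrightarrow> norm (f t) < d" by (auto simp: eventually_at_top_linorder)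
    define T where "T = max 0 T0"
    have T: "T \<ge> 0" "\<And>t. t \<ge> T \<Longrightarrow> norm (f t) < d" using T0 by (auto simp: T_def)
    have bound: "norm (volterra h t) \<le> exp (- \<mu> * t) * norm (volterra ef T) + e / 2" if t: "t \<ge> T" for t
    proof -
      have int: "((\<lambda>s. d * exp (\<mu> * s)) has_integral (d / \<mu> * exp (\<mu> * t) - d / \<mu> * exp (\<mu> * T))) {T..t}"
        by (rule fundamental_theorem_of_calculus)
           (use t \<mu> in \<open>auto intro!: derivative_eq_intros simp flip: has_real_derivative_iff_has_vector_derivative\<close>)
      have "norm (integral {T..t} ef) \<le> integral {T..t} (\<lambda>s. d * exp (\<mu> * s))"
      proof (rule integral_norm_bound_integral)
        show "ef integrable_on {T..t}" using ef T by (intro piecewise_cont_integrable)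
        show "(\<lambda>s. d * exp (\<mu> * s)) integrable_on {T..t}" using int by blast
        show "norm (ef s) \<le> d * exp (\<mu> * s)" if "s \<in> {T..t}" for s
          using T(2)[of s] that by (simp add: ef_def norm_mult \<mu>_def)
      qed
      also have "\<dots> = d / \<mu> * exp (\<mu> * t) - d / \<mu> * exp (\<mu> * T)" using int by (rule integral_unique)
      also have "\<dots> \<le> d / \<mu> * exp (\<mu> * t)" using d \<mu> by simp
      finally have tail: "norm (integral {T..t} ef) \<le> d / \<mu> * exp (\<mu> * t)" .
      have "volterra ef t = volterra ef T + integral {T..t} ef"
        unfolding volterra_def using T t ef by (subst Henstock_Kurzweil_Integration.integral_combine) (auto intro: piecewise_cont_integrable)
      then have "norm (volterra ef t) \<le> norm (volterra ef T) + d / \<mu> * exp (\<mu> * t)"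
        using tail norm_triangle_ineq[of "volterra ef T" "integral {T..t} ef"] by simp
      then have "exp (- \<mu> * t) * norm (volterra ef t) \<le> exp (- \<mu> * t) * (norm (volterra ef T) + d / \<mu> * exp (\<mu> * t))"
        by (intro mult_left_mono) auto
      also have "\<dots> = exp (- \<mu> * t) * norm (volterra ef T) + d / \<mu> * (exp (- \<mu> * t) * exp (\<mu> * t))"
        by (simp only: distrib_left mult_ac)
      also have "\<dots> = exp (- \<mu> * t) * norm (volterra ef T) + e / 2"
        using \<mu> by (simp add: d_def flip: exp_add)
      also have "volterra h t = exp (a * t) * volterra ef t"
        using sol[of t] t T by (simp flip: mult.assoc exp_add)
      then have "exp (- \<mu> * t) * norm (volterra ef t) = norm (volterra h t)"
        by (simp only: norm_mult nexp)
      finally show ?thesis .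
    qed
    have "((\<lambda>t. exp (- \<mu> * t)) \<longlongrightarrow> 0) at_top"
      using \<mu> by (intro filterlim_compose[OF exp_at_bot]
          filterlim_tendsto_neg_mult_at_bot[OF tendsto_const _ filterlim_ident]) auto
    then have "((\<lambda>t. exp (- \<mu> * t) * norm (volterra ef T)) \<longlongrightarrow> 0) at_top"
      by (rule tendsto_mult_left_zero)
    then have "\<forall>\<^sub>F t in at_top. exp (- \<mu> * t) * norm (volterra ef T) < e / 2"
      using e by (intro order_tendstoD) auto
    then show "\<forall>\<^sub>F t in at_top. dist (volterra h t) 0 < e"
      using eventually_ge_at_top[of T]
    proof eventually_elim
      case (elim t)
      then show ?case using bound[of t] by simp
    qed
  qed
qed

text \<open>
  A factor \<open>1 - a X\<close> of \<open>p\<close> has the root \<open>1/a\<close>, so that \<open>Re a < 0\<close> as well. Peeling off one such factor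
  at a time gives one further power of integration that tends to \<open>0\<close>.
\<close>

lemma vpoly_decay:
  assumes "poly p 0 \<noteq> 0" "\<And>x. poly p x = 0 \<Longrightarrow> Re x < 0"
    and "piecewise_cont h" "piecewise_cont f" "\<And>t. t \<ge> 0 \<Longrightarrow> vpoly p h t = f t" "(f \<longlongrightarrow> 0) at_top"
    and "k \<le> degree p"
  shows "((volterra ^^ k) h \<longlongrightarrow> 0) at_top"
  using assms
proof (induction p arbitrary: h f k rule: poly_nonzero_const_induct)
  case (const c)
  have "((\<lambda>t. inverse c * f t) \<longlongrightarrow> inverse c * 0) at_top"
    using const by (intro tendsto_intros)
  moreover have "\<forall>\<^sub>F t in at_top. inverse c * f t = h t"
    using eventually_ge_at_top[of 0] by eventually_elim (use const in \<open>auto simp: field_simps\<close>)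
  ultimately have "(h \<longlongrightarrow> 0) at_top" by (simp add: tendsto_cong)
  then show ?case using const.prems by simp
next
  case (factor a p)
  have "Re (inverse a) < 0" using factor.prems(1)[of "inverse a"] factor.hyps by simp
  then have a: "Re a < 0" by (simp add: divide_less_0_iff power2_eq_square not_sum_squares_lt_zero)
  have deg: "degree ([:1, - a:] * p) = Suc (degree p)"
    using factor.hyps by (subst degree_mult_eq) auto
  define \<theta> where "\<theta> = vpoly [:1, - a:] h"
  have \<theta>: "piecewise_cont \<theta>" unfolding \<theta>_def using factor.prems by auto
  have "vpoly p \<theta> t = f t" if "t \<ge> 0" for t
    using factor.prems(4)[OF that] vpoly_mult[OF factor.prems(2), of p "[:1, - a:]"]
    unfolding \<theta>_def by (simp add: mult.commute)
  then have IH: "((volterra ^^ j) \<theta> \<longlongrightarrow> 0) at_top" if "j \<le> degree p" for j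
    using factor.IH[OF _ \<theta> factor.prems(3) _ factor.prems(5) that] factor.prems(1) by auto
  have step: "((volterra ^^ Suc j) h \<longlongrightarrow> 0) at_top" if "j \<le> degree p" for j
  proof -
    have "(volterra ^^ j) \<theta> t = (volterra ^^ j) h t - a * volterra ((volterra ^^ j) h) t" for t
    proof -
      have "(volterra ^^ j) \<theta> = vpoly [:1, - a:] ((volterra ^^ j) h)"
        unfolding \<theta>_def using factor.prems(2)
        by (simp flip: vpoly_monom_funpow vpoly_mult add: mult.commute)
      then show ?thesis by (simp add: vpoly_linear)
    qed
    then show ?thesis
      using first_order_decay[of "(volterra ^^ j) h" "(volterra ^^ j) \<theta>" a] \<theta> factor.prems(2) a IH[OF that]
      by auto
  qed
  show ?case
  proof (cases k)
    case 0
    have "((\<lambda>t. \<theta> t + a * volterra h t) \<longlongrightarrow> 0 + a * 0) at_top"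
      using IH[of 0] step[of 0] by (intro tendsto_intros) auto
    then show ?thesis using 0 by (simp add: \<theta>_def vpoly_linear)
  next
    case (Suc j)
    then show ?thesis using step[of j] factor.prems(6) deg by simp
  qed
qed

section \<open>Spectral factorization and integration by parts\<close>

text \<open>
  The para-Hermitian conjugate: on the imaginary axis its values are the complex conjugates of those
  of \<open>p\<close>.
\<close>

definition para :: "complex poly \<Rightarrow> complex poly" where
  "para p = map_poly cnj (pcompose p [:0, -1:])"

lemma coeff_para: "coeff (para p) k = (-1) ^ k * cnj (coeff p k)"
  by (simp add: para_def coeff_map_poly coeff_pcompose_linear)

lemma degree_para [simp]: "degree (para p) = degree p"
proof -
  have "coeff (para p) k = 0 \<longleftrightarrow> coeff p k = 0" for k by (simp add: coeff_para)
  then show ?thesis unfolding Polynomial.degree_def by simp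
qed

lemma poly_para: "poly (para p) x = cnj (poly p (- cnj x))"
  by (simp add: poly_altdef coeff_para power_minus[of "cnj x"] power_minus[of x] algebra_simps)

lemma para_add: "para (p + q) = para p + para q"
  by (intro poly_eqI) (simp add: coeff_para algebra_simps)

lemma para_smult: "para (Polynomial.smult c p) = Polynomial.smult (cnj c) (para p)"
  by (intro poly_eqI) (simp add: coeff_para algebra_simps)

lemma para_mult: "para (p * q) = para p * para q"
  by (rule iffD1[OF poly_eq_poly_eq_iff]) (auto simp: poly_para fun_eq_iff)

lemma para_para [simp]: "para (para p) = p"
  by (intro poly_eqI) (simp add: coeff_para flip: power_add mult.assoc)

lemma poly_para_imag_axis: "poly (para p) (\<i> * complex_of_real \<omega>) = cnj (poly p (\<i> * complex_of_real \<omega>))"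
  by (simp add: poly_para)

text \<open>
  The roots of \<open>p\<close> come in pairs \<open>a, - cnj a\<close>, which are distinct because \<open>p\<close> has no root on the
  imaginary axis. Splitting off the factor \<open>X - a\<close> together with its para-Hermitian conjugate
  preserves both hypotheses and lowers the degree.
\<close>

lemma spectral_factorization:
  fixes p :: "complex poly"
  assumes "para p = p" "\<And>\<omega>. 0 < Re (poly p (\<i> * complex_of_real \<omega>))"
  shows "\<exists>h. p = h * para h"
  using assms
proof (induction "degree p" arbitrary: p rule: less_induct)
  case less
  show ?case
  proof (cases "degree p = 0")
    case True
    then obtain c where c: "p = [:c:]" by (rule degree_eq_zeroE)
    have "coeff (para p) 0 = coeff p 0" using less.prems(1) by simp
    then have "cnj c = c" by (simp add: coeff_para c)
    then have cr: "c = complex_of_real (Re c)" by (simp add: complex_eq_iff)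
    have "Re c > 0" using less.prems(2)[of 0] by (simp add: c)
    then have "c = complex_of_real (sqrt (Re c)) * complex_of_real (sqrt (Re c))"
      using cr by (simp flip: of_real_mult)
    then have "p = [:complex_of_real (sqrt (Re c)):] * para [:complex_of_real (sqrt (Re c)):]"
      by (intro poly_eqI) (auto simp: c coeff_para coeff_pCons split: nat.splits)
    then show ?thesis by blast
  next
    case False
    then obtain a where a: "poly p a = 0"
      using fundamental_theorem_of_algebra by (metis constant_degree)
    have Rea: "Re a \<noteq> 0"
    proof
      assume "Re a = 0"
      then have "a = \<i> * complex_of_real (Im a)" by (simp add: complex_eq_iff)
      then show False using less.prems(2)[of "Im a"] a by simp
    qed
    \<comment> \<open>the second root of the pair\<close>
    have pa: "poly p (- cnj a) = 0"
      using a poly_para[of p "- cnj a"] less.prems(1) by simp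
    obtain p1 where p1: "p = [:- a, 1:] * p1" using a poly_eq_0_iff_dvd by (metis dvdE)
    have "a \<noteq> - cnj a" using Rea by (auto simp: complex_eq_iff)
    then have "poly p1 (- cnj a) = 0" using pa unfolding p1 by (auto simp: complex_eq_iff)
    then obtain p2 where p2: "p1 = [:- (- cnj a), 1:] * p2" using poly_eq_0_iff_dvd by (metis dvdE)
    define L where "L = [:- a, 1:]"
    have paraL: "para L = - [:cnj a, 1:]"
      by (intro poly_eqI) (auto simp: L_def coeff_para coeff_pCons split: nat.splits)
    have p: "p = (L * para L) * (- p2)" unfolding paraL unfolding p1 p2 L_def
      by (simp only: minus_minus mult_minus_left mult_minus_right mult.assoc)
    have "para L \<noteq> 0" unfolding paraL by simp
    moreover have "L \<noteq> 0" by (simp add: L_def)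
    ultimately have L0: "L \<noteq> 0" "para L \<noteq> 0" by blast+
    have p0: "p \<noteq> 0" using less.prems(2)[of 0] by auto
    then have p20: "p2 \<noteq> 0" unfolding p by auto
    have "degree p = degree L + degree (para L) + degree (- p2)"
      unfolding p using L0 p20 by (simp add: degree_mult_eq)
    then have deg: "degree (- p2) < degree p" by (simp add: L_def)
    have "(L * para L) * para (- p2) = (L * para L) * (- p2)"
    proof -
      have "para p = (L * para L) * para (- p2)" unfolding p by (simp only: para_mult para_para mult_ac)
      then show ?thesis using less.prems(1) p by simp
    qed
    then have sym: "para (- p2) = - p2" using L0 unfolding mult_cancel_left by simp
    have pos: "0 < Re (poly (- p2) (\<i> * complex_of_real \<omega>))" for \<omega>
    proof -
      let ?x = "\<i> * complex_of_real \<omega>"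
      have "poly p ?x = complex_of_real ((cmod (poly L ?x))\<^sup>2) * poly (- p2) ?x"
        unfolding p poly_mult poly_para_imag_axis by (simp only: complex_norm_square)
      then have "Re (poly p ?x) = (cmod (poly L ?x))\<^sup>2 * Re (poly (- p2) ?x)" by simp
      then show ?thesis using less.prems(2)[of \<omega>] by (simp add: zero_less_mult_iff mult_less_0_iff)
    qed
    obtain h where h: "- p2 = h * para h" using less.hyps[OF deg sym pos] by blast
    have "p = (L * h) * para (L * h)" unfolding p h para_mult by (simp add: algebra_simps)
    then show ?thesis by blast
  qed
qed

lemma volterra_cnj: "volterra (\<lambda>t. cnj (f t)) = (\<lambda>t. cnj (volterra f t))"
  unfolding volterra_def[abs_def] by (simp add: integral_cnj)

text \<open>
  The linear functional with the value \<open>b m\<close> on the \<open>m\<close>th power, applied to a product of polynomials.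
\<close>

lemma sum_coeff_mult:
  fixes u w :: "complex poly" and b :: "nat \<Rightarrow> complex"
  assumes "degree u \<le> N" "degree w \<le> N"
  shows "(\<Sum>m\<le>2*N. coeff (u * w) m * b m) = (\<Sum>i\<le>N. \<Sum>j\<le>N. coeff u i * coeff w j * b (i + j))"
proof -
  have u: "u = (\<Sum>i\<le>N. Polynomial.monom (coeff u i) i)" and w: "w = (\<Sum>j\<le>N. Polynomial.monom (coeff w j) j)"
    using assms by (simp_all add: poly_as_sum_of_monoms')
  have uw: "u * w = (\<Sum>i\<le>N. \<Sum>j\<le>N. Polynomial.monom (coeff u i * coeff w j) (i + j))"
    by (subst u, subst w) (simp add: sum_product mult_monom)
  have "(\<Sum>m\<le>2*N. coeff (u * w) m * b m) =
      (\<Sum>m\<le>2*N. \<Sum>i\<le>N. \<Sum>j\<le>N. (if i + j = m then coeff u i * coeff w j * b m else 0))"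
    unfolding uw by (simp add: coeff_sum sum_distrib_right if_distrib[of "\<lambda>x. x * _"] cong: if_cong)
  also have "\<dots> = (\<Sum>i\<le>N. \<Sum>m\<le>2*N. \<Sum>j\<le>N. (if i + j = m then coeff u i * coeff w j * b m else 0))"
    by (rule sum.swap)
  also have "\<dots> = (\<Sum>i\<le>N. \<Sum>j\<le>N. \<Sum>m\<le>2*N. (if i + j = m then coeff u i * coeff w j * b m else 0))"
    by (intro sum.cong refl sum.swap)
  also have "\<dots> = (\<Sum>i\<le>N. \<Sum>j\<le>N. coeff u i * coeff w j * b (i + j))"
    by (intro sum.cong refl) (simp add: sum.delta')
  finally show ?thesis .
qed

text \<open>
  By integration by parts, moving one power of integration from the left factor to the right one
  changes the sign of the pairing, up to a boundary term that tends to \<open>0\<close>. Hence the pairing of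
  \<open>X\<^sup>i e\<close> with \<open>X\<^sup>j e'\<close> is asymptotically \<open>(-1)\<^sup>j B\<^sub>i\<^sub>+\<^sub>j\<close>, and the pairing of \<open>u e\<close> with \<open>v e'\<close> is a linear
  functional of \<open>u\<close> times the para-Hermitian conjugate of \<open>v\<close>. The pairings themselves need not
  converge, which is why the functional depends on the horizon \<open>S\<close>.
\<close>

lemma pairing_asymptotics:
  assumes e: "piecewise_cont e" "piecewise_cont e'"
    and dec: "\<And>k. k \<le> N \<Longrightarrow> ((volterra ^^ k) e \<longlongrightarrow> 0) at_top" "\<And>k. k \<le> N \<Longrightarrow> ((volterra ^^ k) e' \<longlongrightarrow> 0) at_top"
  shows "\<exists>B :: nat \<Rightarrow> real \<Rightarrow> complex. \<forall>u v. degree u \<le> N \<longrightarrow> degree v \<le> N \<longrightarrow>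
    ((\<lambda>S. volterra (\<lambda>t. vpoly u e t * cnj (vpoly v e' t)) S -
       (\<Sum>m\<le>2*N. coeff (u * para v) m * B m S)) \<longlongrightarrow> 0) at_top"
proof -
  define A where "A i j S = volterra (\<lambda>t. (volterra ^^ i) e t * cnj ((volterra ^^ j) e' t)) S" for i j S
  have pcA: "piecewise_cont (\<lambda>t. (volterra ^^ i) e t * cnj ((volterra ^^ j) e' t))" for i j
    using e by (intro piecewise_cont_mult piecewise_cont_cnj piecewise_cont_funpow)
  have step: "((\<lambda>S. A (Suc i) j S + A i (Suc j) S) \<longlongrightarrow> 0) at_top" if "i < N" "j < N" for i j
  proof -
    let ?a = "(volterra ^^ i) e" and ?b = "\<lambda>t. cnj ((volterra ^^ j) e' t)"
    have sum: "A (Suc i) j S + A i (Suc j) S = volterra ?a S * volterra ?b S" if "0 \<le> S" for S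
    proof -
      have "A (Suc i) j S + A i (Suc j) S = volterra (\<lambda>t. volterra ?a t * ?b t + ?a t * volterra ?b t) S"
        unfolding A_def using pcA[of "Suc i" j] pcA[of i "Suc j"] by (simp add: volterra_add volterra_cnj)
      then show ?thesis
        using volterra_mult[of ?a ?b S] e that by (simp add: piecewise_cont_funpow piecewise_cont_cnj)
    qed
    have "\<forall>\<^sub>F S in at_top. (volterra ^^ Suc i) e S * cnj ((volterra ^^ Suc j) e' S) = A (Suc i) j S + A i (Suc j) S"
      using eventually_ge_at_top[of 0] by eventually_elim (simp add: sum volterra_cnj)
    moreover have "((\<lambda>S. (volterra ^^ Suc i) e S * cnj ((volterra ^^ Suc j) e' S)) \<longlongrightarrow> 0 * cnj 0) at_top"
      using that by (intro tendsto_intros dec) auto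
    ultimately show ?thesis by (simp add: tendsto_cong)
  qed
  \<comment> \<open>among the pairs \<open>(i, j)\<close> with \<open>i + j = m\<close> and both at most \<open>N\<close>, take the one with the smallest \<open>j\<close>\<close>
  define B where "B m S = (-1) ^ (m - N) * A (m - (m - N)) (m - N) S" for m S
  have AB: "((\<lambda>S. A i j S - (-1) ^ j * B (i + j) S) \<longlongrightarrow> 0) at_top" if "i \<le> N" "j \<le> N" for i j
    using that
  proof (induction j arbitrary: i)
    case 0
    then show ?case by (simp add: B_def)
  next
    case (Suc j)
    show ?case
    proof (cases "i = N")
      case True
      then show ?thesis by (simp add: B_def flip: mult.assoc power_mult_distrib)
    next
      case False
      have 1: "((\<lambda>S. A (Suc i) j S + A i (Suc j) S) \<longlongrightarrow> 0) at_top" using step False Suc.prems by simp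
      have 2: "((\<lambda>S. A (Suc i) j S - (-1) ^ j * B (Suc i + j) S) \<longlongrightarrow> 0) at_top"
        using Suc.IH[of "Suc i"] Suc.prems False by simp
      show ?thesis using tendsto_diff[OF 1 2] by simp
    qed
  qed
  have "((\<lambda>S. volterra (\<lambda>t. vpoly u e t * cnj (vpoly v e' t)) S -
       (\<Sum>m\<le>2*N. coeff (u * para v) m * B m S)) \<longlongrightarrow> 0) at_top"
    if u: "degree u \<le> N" and v: "degree v \<le> N" for u v
  proof -
    have "(\<lambda>t. vpoly u e t * cnj (vpoly v e' t)) =
        (\<lambda>t. \<Sum>i\<le>N. \<Sum>j\<le>N. (coeff u i * cnj (coeff v j)) * ((volterra ^^ i) e t * cnj ((volterra ^^ j) e' t)))"
      by (simp add: vpoly_eq_sum[OF u] vpoly_eq_sum[OF v] sum_product algebra_simps)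
    then have J: "volterra (\<lambda>t. vpoly u e t * cnj (vpoly v e' t)) =
        (\<lambda>S. \<Sum>i\<le>N. \<Sum>j\<le>N. (coeff u i * cnj (coeff v j)) * A i j S)"
      by (simp add: volterra_sum volterra_cmult piecewise_cont_sum piecewise_cont_cmult pcA A_def)
    have "(\<Sum>m\<le>2*N. coeff (u * para v) m * B m S) =
        (\<Sum>i\<le>N. \<Sum>j\<le>N. (coeff u i * cnj (coeff v j)) * ((-1) ^ j * B (i + j) S))" for S
      using u v by (subst sum_coeff_mult) (auto simp: coeff_para algebra_simps intro!: sum.cong)
    then have eq: "volterra (\<lambda>t. vpoly u e t * cnj (vpoly v e' t)) S - (\<Sum>m\<le>2*N. coeff (u * para v) m * B m S) =
        (\<Sum>i\<le>N. \<Sum>j\<le>N. (coeff u i * cnj (coeff v j)) * (A i j S - (-1) ^ j * B (i + j) S))" for S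
      by (simp add: J sum_subtractf algebra_simps)
    have "((\<lambda>S. \<Sum>i\<le>N. \<Sum>j\<le>N. (coeff u i * cnj (coeff v j)) * (A i j S - (-1) ^ j * B (i + j) S))
        \<longlongrightarrow> (\<Sum>i\<le>N. \<Sum>j\<le>N. (coeff u i * cnj (coeff v j)) * 0)) at_top"
      by (intro tendsto_sum tendsto_mult tendsto_const AB) auto
    then show ?thesis unfolding eq by simp
  qed
  then show ?thesis by blast
qed

section \<open>Quadratic constraints on a finite horizon\<close>

lemma piecewise_cont_truncate:
  assumes f: "piecewise_cont f"
  shows "piecewise_cont (\<lambda>t. if t \<le> T then f t else 0)"
proof (rule piecewise_contI_bound)
  fix S
  obtain c where c: "\<forall>t\<in>{0..S}. norm (f t) \<le> c"
    using piecewise_contD(1)[OF f, of S] by (auto simp: bounded_iff)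
  then show "\<exists>c. \<forall>t\<in>{0..S}. norm (if t \<le> T then f t else 0) \<le> c"
    by (intro exI[of _ "max c 0"]) auto
  let ?g = "\<lambda>t. if t \<le> T then f t else 0"
  have "{t \<in> {0..S}. \<not> continuous (at t within {0..}) ?g} \<subseteq>
      insert T {t \<in> {0..S}. \<not> continuous (at t within {0..}) f}"
  proof
    fix t assume t: "t \<in> {t \<in> {0..S}. \<not> continuous (at t within {0..}) ?g}"
    show "t \<in> insert T {t \<in> {0..S}. \<not> continuous (at t within {0..}) f}"
    proof (rule ccontr)
      assume neg: "t \<notin> insert T {t \<in> {0..S}. \<not> continuous (at t within {0..}) f}"
      then have c: "continuous (at t within {0..}) f" using t by blast
      consider "t < T" | "t > T" using neg by fastforce
      then have "continuous (at t within {0..}) ?g"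
      proof cases
        case 1
        with t show ?thesis
          by (intro continuous_transform_within[OF c, of "T - t"]) (auto simp: dist_real_def)
      next
        case 2
        have "continuous (at t within {0..}) (\<lambda>t. 0 :: complex)" by simp
        then show ?thesis
          by (rule continuous_transform_within[of _ _ _ "t - T"]) (use 2 t in \<open>auto simp: dist_real_def\<close>)
      qed
      with t show False by simp
    qed
  qed
  then show "finite {t \<in> {0..S}. \<not> continuous (at t within {0..}) ?g}"
    by (rule finite_subset) (use piecewise_contD(2)[OF f] in auto)
qed

text \<open>
  The condition excludes the time \<open>a\<close> itself, where a truncated signal still has its old value.
\<close>

lemma Re_volterra_antimono:
  assumes f: "piecewise_cont f" and ab: "0 \<le> a" "a \<le> b" and neg: "\<And>t. a < t \<Longrightarrow> t \<le> b \<Longrightarrow> Re (f t) \<le> 0"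
  shows "Re (volterra f b) \<le> Re (volterra f a)"
proof -
  have "volterra f b = volterra f a + integral {a..b} f"
    unfolding volterra_def using ab
    by (subst Henstock_Kurzweil_Integration.integral_combine) (auto intro: piecewise_cont_integrable f)
  moreover have "((\<lambda>t. Re (f t)) has_integral Re (integral {a..b} f)) {a..b}"
    using has_integral_linear[OF integrable_integral[OF piecewise_cont_integrable[OF f ab(1)]] bounded_linear_Re]
    by (simp add: o_def)
  then have "((\<lambda>t. if t = a then 0 else Re (f t)) has_integral Re (integral {a..b} f)) {a..b}"
    by (rule has_integral_spike[of "{a}", rotated 2]) auto
  then have "Re (integral {a..b} f) \<le> 0"
    by (rule has_integral_le[OF _ has_integral_0]) (use neg in auto)
  ultimately show ?thesis by simp
qed

lemma Re_hermitian_form_nonneg: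
  fixes Q :: "nat \<Rightarrow> nat \<Rightarrow> real" and c :: "nat \<Rightarrow> complex"
  assumes psd: "\<And>x. 0 \<le> (\<Sum>j<m. \<Sum>k<m. Q j k * (x j * x k))"
  shows "0 \<le> Re (\<Sum>j<m. \<Sum>k<m. complex_of_real (Q j k) * (c j * cnj (c k)))"
proof -
  have "Re (\<Sum>j<m. \<Sum>k<m. complex_of_real (Q j k) * (c j * cnj (c k))) =
      (\<Sum>j<m. \<Sum>k<m. Q j k * (Re (c j) * Re (c k))) + (\<Sum>j<m. \<Sum>k<m. Q j k * (Im (c j) * Im (c k)))"
    by (simp add: sum.distrib algebra_simps)
  then show ?thesis using psd[of "\<lambda>j. Re (c j)"] psd[of "\<lambda>j. Im (c j)"] by simp
qed

lemma volterra_double_sum: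
  fixes c :: "nat \<Rightarrow> nat \<Rightarrow> complex"
  assumes "\<And>j k. j < m \<Longrightarrow> k < m \<Longrightarrow> piecewise_cont (f j k)"
  shows "volterra (\<lambda>t. \<Sum>j<m. \<Sum>k<m. c j k * f j k t) = (\<lambda>S. \<Sum>j<m. \<Sum>k<m. c j k * volterra (f j k) S)"
proof -
  have "volterra (\<lambda>t. \<Sum>k<m. c j k * f j k t) = (\<lambda>S. \<Sum>k<m. c j k * volterra (f j k) S)" if "j < m" for j
    using volterra_sum[of "{..<m}" "\<lambda>k t. c j k * f j k t"] assms that
    by (simp add: volterra_cmult piecewise_cont_cmult)
  moreover have "volterra (\<lambda>t. \<Sum>j<m. \<Sum>k<m. c j k * f j k t) = (\<lambda>S. \<Sum>j<m. volterra (\<lambda>t. \<Sum>k<m. c j k * f j k t) S)"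
    by (rule volterra_sum) (intro piecewise_cont_sum piecewise_cont_cmult assms, auto)
  ultimately show ?thesis by simp
qed

text \<open>
  Here \<open>g\<^sub>j = (nn/d) f\<^sub>j\<close> on \<open>[0, T]\<close>, in the variable \<open>1/s\<close>. The truncated signals \<open>fT\<^sub>j\<close> are written as
  \<open>d e\<^sub>j\<close>, the responses \<open>nn e\<^sub>j\<close> agree with \<open>g\<^sub>j\<close> up to \<open>T\<close>, and all the pairings of the \<open>e\<^sub>j\<close> are reduced to
  those of \<open>h e\<^sub>j\<close> for a spectral factor \<open>h\<close> of the quadratic form in \<open>d\<close> and \<open>nn\<close>.
\<close>

lemma truncated_quadratic_constraint:
  fixes Q :: "nat \<Rightarrow> nat \<Rightarrow> real" and f g :: "nat \<Rightarrow> real \<Rightarrow> complex" and nn d :: "complex poly" and q s r T :: real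
  assumes r: "r \<le> 0" and psd: "\<And>x. 0 \<le> (\<Sum>j<m. \<Sum>k<m. Q j k * (x j * x k))"
    and deg: "degree nn \<le> degree d" and d0: "poly d 0 \<noteq> 0" and stable: "\<And>x. poly d x = 0 \<Longrightarrow> Re x < 0"
    and pos: "\<And>\<omega>. 0 < q * (cmod (poly d (\<i> * complex_of_real \<omega>)))\<^sup>2
               + 2 * s * Re (poly nn (\<i> * complex_of_real \<omega>) * cnj (poly d (\<i> * complex_of_real \<omega>)))
               + r * (cmod (poly nn (\<i> * complex_of_real \<omega>)))\<^sup>2"
    and f: "\<And>j. j < m \<Longrightarrow> piecewise_cont (f j)" and g: "\<And>j. j < m \<Longrightarrow> piecewise_cont (g j)"
    and rel: "\<And>j t. j < m \<Longrightarrow> t \<in> {0..T} \<Longrightarrow> vpoly d (g j) t = vpoly nn (f j) t"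
    and T: "0 \<le> T"
  shows "0 \<le> Re (volterra (\<lambda>t. \<Sum>j<m. \<Sum>k<m. Q j k *
      (q * (f j t * cnj (f k t)) + s * (f j t * cnj (g k t)) + s * (g j t * cnj (f k t)) + r * (g j t * cnj (g k t)))) T)"
proof -
  define N where "N = degree d"
  define fT where "fT j t = (if t \<le> T then f j t else 0)" for j t
  have fT: "piecewise_cont (fT j)" if "j < m" for j
    unfolding fT_def[abs_def] using f[OF that] by (rule piecewise_cont_truncate)
  have fT_lim: "(fT j \<longlongrightarrow> 0) at_top" for j
    by (rule tendsto_eventually) (use eventually_gt_at_top[of T] in \<open>eventually_elim, auto simp: fT_def\<close>)
  have "\<forall>j. \<exists>e. j < m \<longrightarrow> piecewise_cont e \<and> (\<forall>t\<ge>0. vpoly d e t = fT j t)"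
    using vpoly_existence[OF d0 fT] by blast
  then obtain e where e: "\<And>j. j < m \<Longrightarrow> piecewise_cont (e j)"
      and de: "\<And>j t. j < m \<Longrightarrow> 0 \<le> t \<Longrightarrow> vpoly d (e j) t = fT j t" by metis
  define gT where "gT j = vpoly nn (e j)" for j
  have gT: "piecewise_cont (gT j)" if "j < m" for j unfolding gT_def using e[OF that] by auto
  \<comment> \<open>causality: up to \<open>T\<close> the truncation is not felt\<close>
  have gT_eq: "gT j t = g j t" if j: "j < m" and t: "t \<in> {0..T}" for j t
  proof -
    have "vpoly d (\<lambda>t. gT j t - g j t) t = 0" if t: "t \<in> {0..T}" for t
    proof -
      have "vpoly d (gT j) t = vpoly nn (vpoly d (e j)) t"
        unfolding gT_def using e[OF j] by (simp flip: vpoly_mult add: mult.commute)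
      also have "\<dots> = vpoly nn (f j) t"
        by (rule vpoly_cong[of T]) (use t de[OF j] in \<open>auto simp: fT_def\<close>)
      finally show ?thesis using rel[OF j t] by (simp add: vpoly_fun_diff gT[OF j] g[OF j])
    qed
    then have "gT j t - g j t = 0"
      by (intro vpoly_uniqueness[OF d0 piecewise_cont_diff[OF gT[OF j] g[OF j]]]) (use t in auto)
    then show ?thesis by simp
  qed
  have decay: "((volterra ^^ k) (e j) \<longlongrightarrow> 0) at_top" if "j < m" "k \<le> N" for j k
    by (rule vpoly_decay[OF d0 stable e fT de fT_lim]) (use that in \<open>auto simp: N_def\<close>)

  define P where "P = Polynomial.smult q (d * para d) + Polynomial.smult s (d * para nn) + Polynomial.smult s (nn * para d) + Polynomial.smult r (nn * para nn)"
  have "para P = P" by (simp add: P_def para_add para_smult para_mult algebra_simps)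
  moreover have "0 < Re (poly P (\<i> * complex_of_real \<omega>))" for \<omega>
    using pos[of \<omega>] unfolding P_def cmod_power2
    by (simp add: poly_para_imag_axis power2_eq_square algebra_simps)
  ultimately obtain h where h: "P = h * para h" using spectral_factorization by blast
  have degh: "degree h \<le> N"
  proof -
    have "degree P \<le> 2 * N"
      unfolding P_def using deg
      by (intro degree_add_le order_trans[OF degree_smult_le] order_trans[OF degree_mult_le]) (auto simp: N_def)
    moreover have "degree P = 2 * degree h"
    proof (cases "h = 0")
      case False
      then have "para h \<noteq> 0" using para_para[of h] by (metis para_smult[of 0 0, simplified])
      then show ?thesis unfolding h using False by (simp add: degree_mult_eq)
    qed (simp add: h)
    ultimately show ?thesis by simp
  qed

  define \<Phi> where "\<Phi> f g j k t = q * (f j t * cnj (f k t)) + s * (f j t * cnj (g k t)) + s * (g j t * cnj (f k t)) + r * (g j t * cnj (g k t))"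
    for f g :: "nat \<Rightarrow> real \<Rightarrow> complex" and j k t
  have \<Phi>: "piecewise_cont (\<Phi> fT gT j k)" if "j < m" "k < m" for j k
    unfolding \<Phi>_def[abs_def]
    by (intro piecewise_cont_add piecewise_cont_cmult piecewise_cont_mult piecewise_cont_cnj fT gT that)
  define H where "H j k t = vpoly h (e j) t * cnj (vpoly h (e k) t)" for j k t
  have H: "piecewise_cont (H j k)" if "j < m" "k < m" for j k
    unfolding H_def[abs_def] by (intro piecewise_cont_mult piecewise_cont_cnj piecewise_cont_vpoly e that)
  have conv: "((\<lambda>S. volterra (\<Phi> fT gT j k) S - volterra (H j k) S) \<longlongrightarrow> 0) at_top" if j: "j < m" and k: "k < m" for j k
  proof -
    define J where "J u v = volterra (\<lambda>t. vpoly u (e j) t * cnj (vpoly v (e k) t))" for u v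
    obtain B :: "nat \<Rightarrow> real \<Rightarrow> complex" where B: "\<And>u v. degree u \<le> N \<Longrightarrow> degree v \<le> N \<Longrightarrow>
        ((\<lambda>S. J u v S - (\<Sum>i\<le>2*N. coeff (u * para v) i * B i S)) \<longlongrightarrow> 0) at_top"
      using pairing_asymptotics[OF e[OF j] e[OF k] decay[OF j] decay[OF k], of N] unfolding J_def by blast
    define L where "L p S = (\<Sum>i\<le>2*N. coeff p i * B i S)" for p S
    have pcJ: "piecewise_cont (\<lambda>t. c * (vpoly u (e j) t * cnj (vpoly v (e k) t)))" for c u v
      by (intro piecewise_cont_cmult piecewise_cont_mult piecewise_cont_cnj piecewise_cont_vpoly e j k)
    have \<Phi>J: "volterra (\<Phi> fT gT j k) S = q * J d d S + s * J d nn S + s * J nn d S + r * J nn nn S" if "S \<ge> 0" for S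
    proof -
      have "volterra (\<Phi> fT gT j k) S = volterra (\<lambda>t. q * (vpoly d (e j) t * cnj (vpoly d (e k) t))
          + s * (vpoly d (e j) t * cnj (vpoly nn (e k) t)) + s * (vpoly nn (e j) t * cnj (vpoly d (e k) t))
          + r * (vpoly nn (e j) t * cnj (vpoly nn (e k) t))) S"
        by (rule volterra_cong[of S]) (use that j k in \<open>auto simp: \<Phi>_def gT_def de\<close>)
      also have "\<dots> = q * J d d S + s * J d nn S + s * J nn d S + r * J nn nn S"
        unfolding J_def by (simp only: volterra_add volterra_cmult pcJ piecewise_cont_add)
      finally show ?thesis .
    qed
    \<comment> \<open>the functional \<open>L\<close> is linear, so the spectral factorization carries over to the pairings\<close>
    have LP: "q * L (d * para d) S + s * L (d * para nn) S + s * L (nn * para d) S + r * L (nn * para nn) S = L (h * para h) S" for S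
      unfolding h[symmetric] by (simp add: P_def L_def sum.distrib sum_distrib_left algebra_simps)
    have "((\<lambda>S. q * (J d d S - L (d * para d) S) + s * (J d nn S - L (d * para nn) S)
        + s * (J nn d S - L (nn * para d) S) + r * (J nn nn S - L (nn * para nn) S) - (J h h S - L (h * para h) S))
        \<longlongrightarrow> complex_of_real q * 0 + complex_of_real s * 0 + complex_of_real s * 0 + complex_of_real r * 0 - 0) at_top"
      unfolding L_def by (intro tendsto_diff tendsto_add tendsto_mult tendsto_const B) (use deg degh in \<open>auto simp: N_def\<close>)
    then have "((\<lambda>S. (q * J d d S + s * J d nn S + s * J nn d S + r * J nn nn S) - J h h S) \<longlongrightarrow> 0) at_top"
      unfolding LP[symmetric] by (simp add: algebra_simps)
    moreover have "\<forall>\<^sub>F S in at_top. (q * J d d S + s * J d nn S + s * J nn d S + r * J nn nn S) - J h h S = volterra (\<Phi> fT gT j k) S - volterra (H j k) S"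
      using eventually_ge_at_top[of 0] by eventually_elim (simp add: \<Phi>J J_def H_def[abs_def])
    ultimately show ?thesis by (simp add: tendsto_cong)
  qed

  define F where "F = volterra (\<lambda>t. \<Sum>j<m. \<Sum>k<m. Q j k * \<Phi> fT gT j k t)"
  define G where "G = volterra (\<lambda>t. \<Sum>j<m. \<Sum>k<m. Q j k * H j k t)"
  have F: "F = (\<lambda>S. \<Sum>j<m. \<Sum>k<m. Q j k * volterra (\<Phi> fT gT j k) S)"
    unfolding F_def by (rule volterra_double_sum) (rule \<Phi>)
  have G: "G = (\<lambda>S. \<Sum>j<m. \<Sum>k<m. Q j k * volterra (H j k) S)"
    unfolding G_def by (rule volterra_double_sum) (rule H)
  have "((\<lambda>S. \<Sum>j<m. \<Sum>k<m. Q j k * (volterra (\<Phi> fT gT j k) S - volterra (H j k) S)) \<longlongrightarrow> (\<Sum>j<m. \<Sum>k<m. complex_of_real (Q j k) * 0)) at_top"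
    by (intro tendsto_sum tendsto_mult tendsto_const conv) auto
  then have "((\<lambda>S. F S - G S) \<longlongrightarrow> 0) at_top"
    unfolding F G by (simp add: sum_subtractf right_diff_distrib)
  then have lim: "((\<lambda>S. Re (F S - G S)) \<longlongrightarrow> 0) at_top"
    using tendsto_Re by fastforce
  have G_nonneg: "0 \<le> Re (G S)" if "0 \<le> S" for S
  proof -
    have "Re (volterra (\<lambda>t. - (\<Sum>j<m. \<Sum>k<m. Q j k * H j k t)) S) \<le> Re (volterra (\<lambda>t. - (\<Sum>j<m. \<Sum>k<m. Q j k * H j k t)) 0)"
    proof (rule Re_volterra_antimono)
      show "piecewise_cont (\<lambda>t. - (\<Sum>j<m. \<Sum>k<m. Q j k * H j k t))"
        by (intro piecewise_cont_minus piecewise_cont_sum piecewise_cont_cmult H) auto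
      show "Re (- (\<Sum>j<m. \<Sum>k<m. Q j k * H j k t)) \<le> 0" for t
        using Re_hermitian_form_nonneg[OF psd, of "\<lambda>j. vpoly h (e j) t"] by (simp add: H_def)
    qed (use that in auto)
    then show ?thesis unfolding G_def using volterra_cmult[of "-1" "\<lambda>t. \<Sum>j<m. \<Sum>k<m. Q j k * H j k t"] by simp
  qed
  \<comment> \<open>after \<open>T\<close> the input vanishes and only the nonpositive term with \<open>r\<close> remains\<close>
  have tail: "Re (F S) \<le> Re (F T)" if "T \<le> S" for S
    unfolding F_def
  proof (rule Re_volterra_antimono)
    show "piecewise_cont (\<lambda>t. \<Sum>j<m. \<Sum>k<m. Q j k * \<Phi> fT gT j k t)"
      by (intro piecewise_cont_sum piecewise_cont_cmult \<Phi>) auto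
    fix t assume "T < t"
    then have "(\<Sum>j<m. \<Sum>k<m. Q j k * \<Phi> fT gT j k t) = r * (\<Sum>j<m. \<Sum>k<m. Q j k * (gT j t * cnj (gT k t)))"
      by (simp add: \<Phi>_def fT_def sum_distrib_left algebra_simps)
    moreover have "Re (complex_of_real r * x) = r * Re x" for x by simp
    ultimately have "Re (\<Sum>j<m. \<Sum>k<m. Q j k * \<Phi> fT gT j k t) = r * Re (\<Sum>j<m. \<Sum>k<m. Q j k * (gT j t * cnj (gT k t)))"
      by (simp only:)
    then show "Re (\<Sum>j<m. \<Sum>k<m. Q j k * \<Phi> fT gT j k t) \<le> 0"
      using Re_hermitian_form_nonneg[OF psd, of "\<lambda>j. gT j t"] r by (simp only: mult_nonpos_nonneg)
  qed (use T that in auto)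
  have "0 \<le> Re (F T)"
  proof (rule tendsto_upperbound[OF lim])
    show "\<forall>\<^sub>F S in at_top. Re (F S - G S) \<le> Re (F T)"
      using eventually_ge_at_top[of T]
    proof eventually_elim
      case (elim S)
      then show ?case using tail[OF elim] G_nonneg[of S] T by simp
    qed
  qed simp
  also have "F T = volterra (\<lambda>t. \<Sum>j<m. \<Sum>k<m. Q j k * \<Phi> f g j k t) T"
    unfolding F_def by (rule volterra_cong[of T]) (use T gT_eq in \<open>auto simp: \<Phi>_def fT_def intro!: sum.cong\<close>)
  finally show ?thesis unfolding \<Phi>_def .
qed

section \<open>Transfer functions as polynomials in integration\<close>

lemma comm_ring_hom_poly_eval: "comm_ring_hom (\<lambda>p :: real poly. poly p x)"
  by unfold_locales auto

lemma semiring_hom_poly_eval: "semiring_hom (\<lambda>p :: real poly. poly p x)"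
  by unfold_locales auto

interpretation of_real_poly: map_poly_comm_ring_hom "of_real :: real \<Rightarrow> complex" ..

definition rpoly :: "real poly \<Rightarrow> (real \<Rightarrow> complex) \<Rightarrow> real \<Rightarrow> complex" where
  "rpoly p = vpoly (map_poly of_real p)"

lemma piecewise_cont_rpoly [intro]: "piecewise_cont f \<Longrightarrow> piecewise_cont (rpoly p f)"
  by (auto simp: rpoly_def)

lemma rpoly_mult: "piecewise_cont f \<Longrightarrow> rpoly (p * q) f = rpoly p (rpoly q f)"
  by (simp add: rpoly_def vpoly_mult of_real_poly.hom_mult)

lemma rpoly_add: "rpoly (p + q) f t = rpoly p f t + rpoly q f t"
  by (simp add: rpoly_def vpoly_add of_real_poly.hom_add)

lemma rpoly_0 [simp]: "rpoly 0 f = (\<lambda>t. 0)"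
  by (simp add: rpoly_def)

lemma rpoly_sum: "rpoly (\<Sum>i\<in>A. p i) f t = (\<Sum>i\<in>A. rpoly (p i) f t)"
  by (induction A rule: infinite_finite_induct) (auto simp: rpoly_add)

lemma rpoly_const: "rpoly [:c:] f t = of_real c * f t"
  by (simp add: rpoly_def of_real_hom.map_poly_pCons_hom)

lemma rpoly_linear: "rpoly [:a, b:] f t = of_real a * f t + of_real b * volterra f t"
  by (simp add: rpoly_def vpoly_linear of_real_hom.map_poly_pCons_hom)

lemma rpoly_cong: "(\<And>t. t \<in> {0..T} \<Longrightarrow> f t = g t) \<Longrightarrow> t \<in> {0..T} \<Longrightarrow> rpoly p f t = rpoly p g t"
  unfolding rpoly_def by (rule vpoly_cong)

lemma rpoly_fun_sum:
  "(\<And>i. i \<in> A \<Longrightarrow> piecewise_cont (f i)) \<Longrightarrow> rpoly p (\<lambda>t. \<Sum>i\<in>A. f i t) t = (\<Sum>i\<in>A. rpoly p (f i) t)"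
  unfolding rpoly_def by (simp add: vpoly_fun_sum)

lemma rpoly_fun_diff: "piecewise_cont f \<Longrightarrow> piecewise_cont g \<Longrightarrow>
    rpoly p (\<lambda>t. f t - g t) t = rpoly p f t - rpoly p g t"
  unfolding rpoly_def by (simp add: vpoly_fun_diff)

lemma rpoly_fun_zero [simp]: "rpoly p (\<lambda>t. 0) = (\<lambda>t. 0)"
  by (simp add: rpoly_def)

lemma rpoly_uniqueness:
  assumes "poly p 0 \<noteq> 0" "piecewise_cont g" "\<And>t. t \<in> {0..T} \<Longrightarrow> rpoly p g t = 0" "t \<in> {0..T}"
  shows "g t = 0"
proof (rule vpoly_uniqueness)
  show "poly (map_poly complex_of_real p) 0 \<noteq> 0" using assms(1) by (simp add: poly_0_coeff_0 coeff_map_poly)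
qed (use assms in \<open>auto simp: rpoly_def\<close>)

text \<open>
  Cramer's rule for a system of equations whose coefficients are operators: multiply by the adjugate.
\<close>

lemma rpoly_cramer:
  fixes M :: "real poly mat"
  assumes M: "M \<in> carrier_mat n n" and y: "\<And>i. i < n \<Longrightarrow> piecewise_cont (y i)"
    and eq: "\<And>i t. i < n \<Longrightarrow> t \<in> {0..T} \<Longrightarrow> (\<Sum>j<n. rpoly (M $$ (i, j)) (y j) t) = b i t"
    and b: "\<And>i. i < n \<Longrightarrow> piecewise_cont (b i)"
    and k: "k < n" and t: "t \<in> {0..T}"
  shows "rpoly (det M) (y k) t = (\<Sum>i<n. rpoly (adj_mat M $$ (k, i)) (b i) t)"
proof -
  have adj: "(\<Sum>i<n. adj_mat M $$ (k, i) * M $$ (i, j)) = (if j = k then det M else 0)" if "j < n" for j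
  proof -
    have "(adj_mat M * M) $$ (k, j) = (det M \<cdot>\<^sub>m 1\<^sub>m n) $$ (k, j)" using adj_mat(3)[OF M] by simp
    then show ?thesis using M adj_mat(1)[OF M] k that
      by (simp add: scalar_prod_def lessThan_atLeast0 split: if_splits)
  qed
  have "(\<Sum>i<n. rpoly (adj_mat M $$ (k, i)) (b i) t) =
      (\<Sum>i<n. rpoly (adj_mat M $$ (k, i)) (\<lambda>t. \<Sum>j<n. rpoly (M $$ (i, j)) (y j) t) t)"
    by (intro sum.cong refl rpoly_cong[of T]) (use eq t in auto)
  also have "\<dots> = (\<Sum>i<n. \<Sum>j<n. rpoly (adj_mat M $$ (k, i) * M $$ (i, j)) (y j) t)"
    using y by (intro sum.cong refl, subst rpoly_fun_sum) (auto simp: rpoly_mult)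
  also have "\<dots> = (\<Sum>j<n. rpoly (\<Sum>i<n. adj_mat M $$ (k, i) * M $$ (i, j)) (y j) t)"
    unfolding rpoly_sum by (rule sum.swap)
  also have "\<dots> = (\<Sum>j<n. if j = k then rpoly (det M) (y k) t else 0)"
    by (intro sum.cong refl) (simp add: adj)
  also have "\<dots> = rpoly (det M) (y k) t" using k by simp
  finally show ?thesis ..
qed

text \<open>
  The matrix \<open>1 - X A\<close>. Integrating \<open>x' = A x + B u\<close> from \<open>x(0) = 0\<close> gives \<open>(1 - X A) x = X B u\<close>.
\<close>

definition integral_mat :: "real mat \<Rightarrow> real poly mat" where
  "integral_mat A = mat (dim_row A) (dim_col A) (\<lambda>(i, j). [:if i = j then 1 else 0, - (A $$ (i, j)):])"

lemma integral_mat_carrier [simp]: "A \<in> carrier_mat n n \<Longrightarrow> integral_mat A \<in> carrier_mat n n"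
  by (auto simp: integral_mat_def)

lemma integral_mat_index: "A \<in> carrier_mat n n \<Longrightarrow> i < n \<Longrightarrow> j < n \<Longrightarrow>
    integral_mat A $$ (i, j) = [:if i = j then 1 else 0, - (A $$ (i, j)):]"
  by (simp add: integral_mat_def)

lemma eval_adj_mat:
  fixes M :: "real poly mat"
  assumes M: "M \<in> carrier_mat n n"
  shows "map_mat (\<lambda>p. poly p x) (adj_mat M) * map_mat (\<lambda>p. poly p x) M = poly (det M) x \<cdot>\<^sub>m 1\<^sub>m n"
    and "map_mat (\<lambda>p. poly p x) M * map_mat (\<lambda>p. poly p x) (adj_mat M) = poly (det M) x \<cdot>\<^sub>m 1\<^sub>m n"
proof -
  have "map_mat (\<lambda>p. poly p x) (det M \<cdot>\<^sub>m 1\<^sub>m n) = poly (det M) x \<cdot>\<^sub>m 1\<^sub>m n"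
    by (intro eq_matI) auto
  then show "map_mat (\<lambda>p. poly p x) (adj_mat M) * map_mat (\<lambda>p. poly p x) M = poly (det M) x \<cdot>\<^sub>m 1\<^sub>m n"
    and "map_mat (\<lambda>p. poly p x) M * map_mat (\<lambda>p. poly p x) (adj_mat M) = poly (det M) x \<cdot>\<^sub>m 1\<^sub>m n"
    using semiring_hom.mat_hom_mult[OF semiring_hom_poly_eval adj_mat(1)[OF M] M] semiring_hom.mat_hom_mult[OF semiring_hom_poly_eval M adj_mat(1)[OF M]] adj_mat[OF M]
    by simp_all
qed

lemma eval_integral_mat:
  assumes A: "A \<in> carrier_mat n n" and x: "x \<noteq> 0"
  shows "map_mat (\<lambda>p. poly p x) (integral_mat A) = x \<cdot>\<^sub>m map_mat (\<lambda>p. poly p (inverse x)) (char_poly_matrix A)"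
  using A x by (intro eq_matI) (auto simp: integral_mat_def char_poly_matrix_def field_simps)

lemma det_integral_mat:
  assumes A: "A \<in> carrier_mat n n" and x: "x \<noteq> 0"
  shows "poly (det (integral_mat A)) x = x ^ n * poly (char_poly A) (inverse x)"
proof -
  have "poly (det (integral_mat A)) x = det (map_mat (\<lambda>p. poly p x) (integral_mat A))"
    by (simp add: comm_ring_hom.hom_det[OF comm_ring_hom_poly_eval])
  also have "\<dots> = x ^ n * det (map_mat (\<lambda>p. poly p (inverse x)) (char_poly_matrix A))"
    unfolding eval_integral_mat[OF A x] using carrier_matD(2)[OF char_poly_matrix_closed[OF A]] by simp
  finally show ?thesis by (simp add: comm_ring_hom.hom_det[OF comm_ring_hom_poly_eval] char_poly_def)
qed

lemma det_integral_mat_0: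
  assumes A: "A \<in> carrier_mat n n"
  shows "poly (det (integral_mat A)) 0 = 1"
proof -
  have "map_mat (\<lambda>p. poly p 0) (integral_mat A) = 1\<^sub>m n"
    using A by (intro eq_matI) (auto simp: integral_mat_def)
  then show ?thesis by (metis comm_ring_hom.hom_det[OF comm_ring_hom_poly_eval] det_one)
qed

text \<open>
  Since \<open>1 - x A = x (1/x - A)\<close>, both sides become equal after multiplication with the invertible
  matrix \<open>1/x - A\<close>.
\<close>

lemma adj_integral_mat:
  assumes A: "A \<in> carrier_mat n n" and x: "x \<noteq> 0" and c: "poly (char_poly A) (inverse x) \<noteq> 0"
    and ij: "i < n" "j < n"
  shows "x * poly (adj_mat (integral_mat A) $$ (i, j)) x = x ^ n * poly (adj_mat (char_poly_matrix A) $$ (i, j)) (inverse x)"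
proof -
  let ?I = "integral_mat A" and ?S = "char_poly_matrix A"
  define E where "E = map_mat (\<lambda>p. poly p x) (adj_mat ?I)"
  define S where "S = map_mat (\<lambda>p. poly p (inverse x)) ?S"
  define S' where "S' = map_mat (\<lambda>p. poly p (inverse x)) (adj_mat ?S)"
  define c where "c = poly (char_poly A) (inverse x)"
  have carr: "E \<in> carrier_mat n n" "S \<in> carrier_mat n n" "S' \<in> carrier_mat n n"
    using A adj_mat(1)[of ?I n] adj_mat(1)[of ?S n] by (auto simp: E_def S_def S'_def)
  have 1: "E * (x \<cdot>\<^sub>m S) = (x ^ n * c) \<cdot>\<^sub>m 1\<^sub>m n"
    using eval_adj_mat(1)[of ?I n x] A x
    by (simp add: E_def S_def c_def eval_integral_mat det_integral_mat)
  have 2: "S * S' = c \<cdot>\<^sub>m 1\<^sub>m n"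
    using eval_adj_mat(2)[of ?S n "inverse x"] A by (simp add: S_def S'_def c_def char_poly_def)
  have "(E * (x \<cdot>\<^sub>m S)) * S' = E * (x \<cdot>\<^sub>m (S * S'))"
    using carr by (simp add: assoc_mult_mat[of _ n n _ n _ n] mult_smult_assoc_mat[of _ n n _ n])
  also have "\<dots> = (x * c) \<cdot>\<^sub>m E"
    unfolding 2 using carr by (intro eq_matI) (auto simp: mult_smult_distrib[of _ n n _ n])
  finally have "(x * c) \<cdot>\<^sub>m E = (x ^ n * c) \<cdot>\<^sub>m S'"
    unfolding 1 using carr by (simp add: mult_smult_assoc_mat[of _ n n _ n])
  then have "((x * c) \<cdot>\<^sub>m E) $$ (i, j) = ((x ^ n * c) \<cdot>\<^sub>m S') $$ (i, j)" by simp
  then have "x * c * E $$ (i, j) = x ^ n * c * S' $$ (i, j)" using carr ij by simp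
  then have "x * E $$ (i, j) = x ^ n * S' $$ (i, j)" using c unfolding c_def by simp
  then show ?thesis using carr ij by (simp add: E_def S'_def)
qed

text \<open>
  The substitution \<open>s = 1/X\<close> in a proper transfer function of denominator degree \<open>N\<close>, after which
  numerator and denominator are multiplied by \<open>X\<^sup>N\<close>.
\<close>

definition hat_num :: "tf \<Rightarrow> real poly" where
  "hat_num \<delta> = Polynomial.monom 1 (degree (tf_den \<delta>) - degree (tf_num \<delta>)) * reflect_poly (tf_num \<delta>)"

definition hat_den :: "tf \<Rightarrow> real poly" where
  "hat_den \<delta> = reflect_poly (tf_den \<delta>)"

text \<open>
  The resolvent is the adjugate of \<open>s - A\<close> divided by the characteristic polynomial.
\<close>

lemma realization_numerator:
  assumes r: "realization n A B C D (mat 1 1 (\<lambda>_. \<delta>))"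
  shows "char_poly A * tf_num \<delta> =
    ((\<Sum>i<n. \<Sum>j<n. [:C $$ (0, i):] * adj_mat (char_poly_matrix A) $$ (i, j) * [:B $$ (j, 0):]) + [:D $$ (0, 0):] * char_poly A) * tf_den \<delta>"
proof -
  let ?S = "char_poly_matrix A"
  let ?f = "map_mat to_fract :: real poly mat \<Rightarrow> tf mat"
  from r obtain R where A: "A \<in> carrier_mat n n" and B: "B \<in> carrier_mat n 1" and C: "C \<in> carrier_mat 1 n"
    and D: "D \<in> carrier_mat 1 1" and R: "R \<in> carrier_mat n n" and inv: "inverts_mat (?f ?S) R"
    and G: "mat 1 1 (\<lambda>_. \<delta>) = tf_const_mat C * R * tf_const_mat B + tf_const_mat D"
    unfolding realization_def by auto
  interpret to_fract_hom: comm_ring_hom "to_fract :: real poly \<Rightarrow> tf" by unfold_locales auto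
  have S: "?S \<in> carrier_mat n n" using A by simp
  have adjS: "adj_mat ?S \<in> carrier_mat n n" using adj_mat(1)[OF S] .
  have SR: "?f ?S * R = 1\<^sub>m n" using inv S by (simp add: inverts_mat_def)
  have aS: "?f (adj_mat ?S) * ?f ?S = to_fract (char_poly A) \<cdot>\<^sub>m 1\<^sub>m n"
  proof -
    have "?f (adj_mat ?S) * ?f ?S = ?f (det ?S \<cdot>\<^sub>m 1\<^sub>m n)"
      using to_fract_hom.mat_hom_mult[OF adjS S] adj_mat(3)[OF S] by simp
    also have "\<dots> = to_fract (char_poly A) \<cdot>\<^sub>m 1\<^sub>m n"
      by (intro eq_matI) (auto simp: char_poly_def)
    finally show ?thesis .
  qed
  have "?f (adj_mat ?S) = ?f (adj_mat ?S) * (?f ?S * R)" unfolding SR using adjS by simp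
  also have "\<dots> = (?f (adj_mat ?S) * ?f ?S) * R"
    by (rule assoc_mult_mat[symmetric]) (use adjS S R in auto)
  also have "\<dots> = to_fract (char_poly A) \<cdot>\<^sub>m R"
    unfolding aS using R by (simp add: mult_smult_assoc_mat[of _ n n _ n])
  finally have Rij: "to_fract (char_poly A) * R $$ (i, j) = to_fract (adj_mat ?S $$ (i, j))" if "i < n" "j < n" for i j
    using that R adjS by (metis index_map_mat(1) index_smult_mat(1) carrier_matD)
  have "\<delta> = mat 1 1 (\<lambda>_. \<delta>) $$ (0, 0)" by simp
  also have "\<dots> = (tf_const_mat C * R * tf_const_mat B + tf_const_mat D) $$ (0, 0)"
    by (simp only: G)
  also have "\<dots> = (\<Sum>i<n. \<Sum>j<n. to_fract [:C $$ (0, i):] * R $$ (i, j) * to_fract [:B $$ (j, 0):]) + to_fract [:D $$ (0, 0):]"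
    using A B C D R by (simp add: tf_const_mat_def scalar_prod_def lessThan_atLeast0 sum_distrib_left mult.assoc)
  finally have \<delta>: "\<delta> = (\<Sum>i<n. \<Sum>j<n. to_fract [:C $$ (0, i):] * R $$ (i, j) * to_fract [:B $$ (j, 0):]) + to_fract [:D $$ (0, 0):]" .
  have "to_fract (char_poly A) * \<delta> =
      (\<Sum>i<n. \<Sum>j<n. to_fract [:C $$ (0, i):] * (to_fract (char_poly A) * R $$ (i, j)) * to_fract [:B $$ (j, 0):]) + to_fract [:D $$ (0, 0):] * to_fract (char_poly A)"
    by (subst \<delta>) (simp add: sum_distrib_left distrib_left mult_ac)
  also have "\<dots> = (\<Sum>i<n. \<Sum>j<n. to_fract [:C $$ (0, i):] * to_fract (adj_mat ?S $$ (i, j)) * to_fract [:B $$ (j, 0):]) + to_fract [:D $$ (0, 0):] * to_fract (char_poly A)"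
    by (simp add: Rij)
  also have "\<dots> = to_fract ((\<Sum>i<n. \<Sum>j<n. [:C $$ (0, i):] * adj_mat ?S $$ (i, j) * [:B $$ (j, 0):]) + [:D $$ (0, 0):] * char_poly A)"
    by (simp only: to_fract_add to_fract_mult to_fract_sum)
  finally have *: "to_fract (char_poly A) * \<delta> = to_fract ((\<Sum>i<n. \<Sum>j<n. [:C $$ (0, i):] * adj_mat ?S $$ (i, j) * [:B $$ (j, 0):]) + [:D $$ (0, 0):] * char_poly A)" .
  have "\<delta> = to_fract (tf_num \<delta>) / to_fract (tf_den \<delta>)"
    by (simp add: tf_num_def tf_den_def flip: Fract_conv_to_fract)
  moreover have "to_fract (tf_den \<delta>) \<noteq> 0" by (simp add: tf_den_def)
  ultimately have "to_fract (tf_num \<delta>) = \<delta> * to_fract (tf_den \<delta>)" by (metis nonzero_eq_divide_eq)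
  then have "to_fract (char_poly A * tf_num \<delta>) = to_fract (char_poly A) * \<delta> * to_fract (tf_den \<delta>)" by (simp add: mult_ac)
  also have "\<dots> = to_fract (((\<Sum>i<n. \<Sum>j<n. [:C $$ (0, i):] * adj_mat ?S $$ (i, j) * [:B $$ (j, 0):]) + [:D $$ (0, 0):] * char_poly A) * tf_den \<delta>)"
    unfolding * by (simp only: to_fract_mult)
  finally show ?thesis unfolding to_fract_eq_iff .
qed

lemma poly_hat:
  assumes "tf_proper \<delta>" "x \<noteq> 0"
  shows "poly (hat_num \<delta>) x = x ^ degree (tf_den \<delta>) * poly (tf_num \<delta>) (inverse x)"
    and "poly (hat_den \<delta>) x = x ^ degree (tf_den \<delta>) * poly (tf_den \<delta>) (inverse x)"
  using assms by (simp_all add: hat_num_def hat_den_def poly_reflect_poly_nz poly_monom tf_proper_def flip: mult.assoc power_add)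

text \<open>
  The polynomial identity behind \<open>\<delta> = C (s - A)\<^sup>-\<^sup>1 B + D\<close>, rewritten in \<open>X = 1/s\<close>. It is checked at all
  points except \<open>0\<close> and the finitely many roots of \<open>det (1 - X A)\<close>, and it follows everywhere because
  multiplying by \<open>X det (1 - X A)\<close> loses nothing.
\<close>

lemma realization_integral_form:
  assumes r: "realization n A B C D (mat 1 1 (\<lambda>_. \<delta>))" and proper: "tf_proper \<delta>"
  shows "hat_num \<delta> * det (integral_mat A) = hat_den \<delta> *
    ((\<Sum>i<n. \<Sum>j<n. [:C $$ (0, i):] * adj_mat (integral_mat A) $$ (i, j) * [:0, B $$ (j, 0):]) + [:D $$ (0, 0):] * det (integral_mat A))"
    (is "?l = hat_den \<delta> * ?m")
proof -
  have A: "A \<in> carrier_mat n n" using r by (simp add: realization_def)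
  let ?c = "det (integral_mat A)"
  have "poly ([:0, 1:] * ?c * (?l - hat_den \<delta> * ?m)) x = 0" for x
  proof (cases "x = 0 \<or> poly ?c x = 0")
    case False
    then have x: "x \<noteq> 0" and c: "poly (char_poly A) (inverse x) \<noteq> 0"
      using det_integral_mat[OF A, of x] by auto
    let ?p = "(\<Sum>i<n. \<Sum>j<n. [:C $$ (0, i):] * adj_mat (char_poly_matrix A) $$ (i, j) * [:B $$ (j, 0):]) + [:D $$ (0, 0):] * char_poly A"
    have "poly ?m x = (\<Sum>i<n. \<Sum>j<n. C $$ (0, i) * (x * poly (adj_mat (integral_mat A) $$ (i, j)) x) * B $$ (j, 0)) + D $$ (0, 0) * poly ?c x"
      by (simp add: poly_sum mult_ac)
    also have "\<dots> = (\<Sum>i<n. \<Sum>j<n. C $$ (0, i) * (x ^ n * poly (adj_mat (char_poly_matrix A) $$ (i, j)) (inverse x)) * B $$ (j, 0)) + D $$ (0, 0) * (x ^ n * poly (char_poly A) (inverse x))"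
      by (intro arg_cong2[of _ _ _ _ "(+)"] sum.cong refl) (simp_all add: adj_integral_mat[OF A x c] det_integral_mat[OF A x])
    also have "\<dots> = x ^ n * poly ?p (inverse x)"
      by (simp add: poly_sum sum_distrib_left distrib_left mult_ac)
    finally have m: "poly ?m x = x ^ n * poly ?p (inverse x)" .
    have "poly (char_poly A * tf_num \<delta>) (inverse x) = poly (?p * tf_den \<delta>) (inverse x)"
      unfolding realization_numerator[OF r] ..
    then have "poly ?l x = poly (hat_den \<delta> * ?m) x"
      unfolding poly_mult m poly_hat[OF proper x] det_integral_mat[OF A x] by (simp add: mult_ac)
    then show ?thesis by simp
  qed auto
  then have "[:0, 1:] * ?c * (?l - hat_den \<delta> * ?m) = 0" using poly_all_0_iff_0 by blast
  moreover have "?c \<noteq> 0" using det_integral_mat_0[OF A] by auto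
  ultimately show ?thesis by (simp only: mult_eq_0_iff) simp
qed

section \<open>State equations in integral form\<close>

lemma state_response_integral:
  assumes sr: "state_response A B u x" and A: "A \<in> carrier_mat n n" and B: "B \<in> carrier_mat n m"
    and fin: "\<And>j T. j < m \<Longrightarrow> finite {t \<in> {0..T}. \<not> continuous (at t within {0..}) (\<lambda>\<tau>. u \<tau> $ j)}"
    and i: "i < n" and t: "0 \<le> t"
  shows "volterra (\<lambda>\<tau>. complex_of_real ((A *\<^sub>v x \<tau> + B *\<^sub>v u \<tau>) $ i)) t = complex_of_real (x t $ i)"
proof -
  let ?F = "\<Union>j<m. {\<tau> \<in> {0..t}. \<not> continuous (at \<tau> within {0..}) (\<lambda>\<tau>. u \<tau> $ j)}"
  let ?y = "\<lambda>\<tau>. complex_of_real (x \<tau> $ i)"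
  have "volterra (\<lambda>\<tau>. complex_of_real ((A *\<^sub>v x \<tau> + B *\<^sub>v u \<tau>) $ i)) t = ?y t - ?y 0"
  proof (rule volterra_eqI_finite)
    show "finite ?F" using fin by auto
    have "continuous_on {0..} (\<lambda>\<tau>. x \<tau> $ i)" using sr A i by (auto simp: state_response_def)
    then show "continuous_on {0..t} ?y" by (intro continuous_intros) (auto intro: continuous_on_subset)
    fix \<tau> assume \<tau>: "0 < \<tau>" "\<tau> < t" "\<tau> \<notin> ?F"
    then have "((\<lambda>\<tau>. x \<tau> $ i) has_real_derivative (A *\<^sub>v x \<tau> + B *\<^sub>v u \<tau>) $ i) (at \<tau> within {0..})"
      using sr A B i unfolding state_response_def by auto
    moreover have "at \<tau> within {0..} = at \<tau>" by (rule at_within_interior) (use \<tau> in auto)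
    ultimately have "((\<lambda>\<tau>. x \<tau> $ i) has_real_derivative (A *\<^sub>v x \<tau> + B *\<^sub>v u \<tau>) $ i) (at \<tau>)"
      by simp
    then show "(?y has_vector_derivative complex_of_real ((A *\<^sub>v x \<tau> + B *\<^sub>v u \<tau>) $ i)) (at \<tau>)"
      by (rule has_vector_derivative_of_real)
  qed (use t in auto)
  moreover have "x 0 $ i = 0" using sr A i by (auto simp: state_response_def)
  ultimately show ?thesis by simp
qed

lemma piecewise_cont_state:
  assumes "state_response A B u x" "A \<in> carrier_mat n n" "i < n"
  shows "piecewise_cont (\<lambda>t. complex_of_real (x t $ i))"
  using assms by (intro piecewise_cont_of_continuous continuous_intros) (auto simp: state_response_def)

lemma integral_form_of_state_equation:
  fixes X :: "nat \<Rightarrow> real \<Rightarrow> complex"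
  assumes A: "A \<in> carrier_mat n n" and X: "\<And>j. j < n \<Longrightarrow> piecewise_cont (X j)" and Z: "piecewise_cont Z"
    and eq: "\<And>i. i < n \<Longrightarrow> volterra (\<lambda>t. (\<Sum>j<n. of_real (A $$ (i, j)) * X j t) + of_real (b i) * Z t) t = X i t"
    and i: "i < n"
  shows "(\<Sum>j<n. rpoly (integral_mat A $$ (i, j)) (X j) t) = rpoly [:0, b i:] Z t"
proof -
  have "volterra (\<lambda>t. (\<Sum>j<n. of_real (A $$ (i, j)) * X j t) + of_real (b i) * Z t) t =
      (\<Sum>j<n. of_real (A $$ (i, j)) * volterra (X j) t) + of_real (b i) * volterra Z t"
    using X Z volterra_sum[of "{..<n}" "\<lambda>j t. of_real (A $$ (i, j)) * X j t"]
    by (subst volterra_add) (auto simp: volterra_cmult piecewise_cont_cmult intro!: piecewise_cont_sum)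
  moreover have "(\<Sum>j<n. rpoly (integral_mat A $$ (i, j)) (X j) t) =
      (\<Sum>j<n. (if j = i then X j t else 0) - of_real (A $$ (i, j)) * volterra (X j) t)"
    using A i by (intro sum.cong refl) (auto simp: integral_mat_index rpoly_linear)
  ultimately show ?thesis
    using eq[OF i] i by (simp add: sum_subtractf rpoly_linear)
qed

text \<open>
  The difference of both sides satisfies \<open>(1 - X A) y = 0\<close>, because the operators \<open>p\<close> and \<open>q\<close> commute
  with \<open>1 - X A\<close> and with \<open>X B\<close>. Cramer's rule and uniqueness then force \<open>y = 0\<close>.
\<close>

lemma filter_commutes_with_transfer_function:
  fixes X Y :: "nat \<Rightarrow> real \<Rightarrow> complex"
  assumes A: "A \<in> carrier_mat n n" and X: "\<And>i. i < n \<Longrightarrow> piecewise_cont (X i)" and Y: "\<And>i. i < n \<Longrightarrow> piecewise_cont (Y i)"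
    and Z: "piecewise_cont Z" and W: "piecewise_cont W"
    and eqX: "\<And>i t. i < n \<Longrightarrow> 0 \<le> t \<Longrightarrow> (\<Sum>j<n. rpoly (integral_mat A $$ (i, j)) (X j) t) = rpoly [:0, b i:] Z t"
    and eqY: "\<And>i t. i < n \<Longrightarrow> 0 \<le> t \<Longrightarrow> (\<Sum>j<n. rpoly (integral_mat A $$ (i, j)) (Y j) t) = rpoly [:0, b i:] W t"
    and rel: "\<And>t. 0 \<le> t \<Longrightarrow> rpoly p W t = rpoly q Z t"
    and k: "k < n" and t: "0 \<le> t"
  shows "rpoly p (Y k) t = rpoly q (X k) t"
proof -
  let ?I = "integral_mat A"
  define y where "y k t = rpoly p (Y k) t - rpoly q (X k) t" for k t
  have y: "piecewise_cont (y k)" if "k < n" for k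
    unfolding y_def[abs_def] using X[OF that] Y[OF that] by (intro piecewise_cont_diff piecewise_cont_rpoly)
  have transport: "(\<Sum>j<n. rpoly (?I $$ (i, j)) (rpoly p' (Y' j)) t) = rpoly [:0, b i:] (rpoly p' W') t"
    if "i < n" "0 \<le> t" and Y': "\<And>j. j < n \<Longrightarrow> piecewise_cont (Y' j)" and W': "piecewise_cont W'"
      and e: "\<And>t. 0 \<le> t \<Longrightarrow> (\<Sum>j<n. rpoly (?I $$ (i, j)) (Y' j) t) = rpoly [:0, b i:] W' t" for i t p' Y' W'
  proof -
    have "(\<Sum>j<n. rpoly (?I $$ (i, j)) (rpoly p' (Y' j)) t) = rpoly p' (\<lambda>t. \<Sum>j<n. rpoly (?I $$ (i, j)) (Y' j) t) t"
      using Y' by (subst rpoly_fun_sum) (auto simp: mult.commute simp flip: rpoly_mult intro!: sum.cong)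
    also have "\<dots> = rpoly p' (rpoly [:0, b i:] W') t"
      by (rule rpoly_cong[of t]) (use e that in auto)
    also have "\<dots> = rpoly [:0, b i:] (rpoly p' W') t"
      using W' by (simp only: mult.commute flip: rpoly_mult)
    finally show ?thesis .
  qed
  have eqy: "(\<Sum>j<n. rpoly (?I $$ (i, j)) (y j) s) = 0" if i: "i < n" and s: "s \<in> {0..t}" for i s
  proof -
    have "(\<Sum>j<n. rpoly (?I $$ (i, j)) (y j) s) =
        (\<Sum>j<n. rpoly (?I $$ (i, j)) (rpoly p (Y j)) s) - (\<Sum>j<n. rpoly (?I $$ (i, j)) (rpoly q (X j)) s)"
      unfolding y_def[abs_def] using X Y by (simp add: rpoly_fun_diff piecewise_cont_rpoly sum_subtractf)
    also have "\<dots> = rpoly [:0, b i:] (rpoly p W) s - rpoly [:0, b i:] (rpoly q Z) s"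
      using i s X Y Z W eqX[OF i] eqY[OF i] by (simp add: transport)
    also have "rpoly [:0, b i:] (rpoly p W) s = rpoly [:0, b i:] (rpoly q Z) s"
      by (rule rpoly_cong[of s]) (use rel s in auto)
    finally show ?thesis by simp
  qed
  have "rpoly (det ?I) (y k) s = 0" if "s \<in> {0..t}" for s
    using rpoly_cramer[of ?I n y t "\<lambda>i t. 0" k s] A y eqy k that by simp
  then have "y k t = 0"
    by (intro rpoly_uniqueness[of "det ?I" "y k" t]) (use det_integral_mat_0[OF A] y[OF k] t in auto)
  then show ?thesis by (simp add: y_def)
qed

text \<open>
  Eliminating the state of the realization gives \<open>det (1 - X A) w = m z\<close>, where \<open>\<delta>\<close> is the quotient
  of \<open>m\<close> by the determinant. In order to pass to the reduced fraction the determinant has to be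
  cancelled, which uniqueness permits because its constant coefficient is \<open>1\<close>.
\<close>

lemma tf_output_relation:
  fixes z w :: "real \<Rightarrow> real"
  defines "Z \<equiv> \<lambda>t. complex_of_real (z t)" and "W \<equiv> \<lambda>t. complex_of_real (w t)"
  assumes out: "tf_output \<delta> z w" and proper: "tf_proper \<delta>" and Z: "piecewise_cont Z"
  shows "piecewise_cont W" and "0 \<le> t \<Longrightarrow> rpoly (hat_den \<delta>) W t = rpoly (hat_num \<delta>) Z t"
proof -
  obtain n A B C D x where real: "realization n A B C D (mat 1 1 (\<lambda>_. \<delta>))"
    and resp: "response A B C D (\<lambda>t. vec_of_list [z t]) x (\<lambda>t. vec_of_list [w t])"
    using out unfolding tf_output_def minimal_realization_def by blast
  have A: "A \<in> carrier_mat n n" and B: "B \<in> carrier_mat n 1" and C: "C \<in> carrier_mat 1 n" and D: "D \<in> carrier_mat 1 1"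
    using real by (auto simp: realization_def)
  have sr: "state_response A B (\<lambda>t. vec_of_list [z t]) x" using resp by (simp add: response_def)
  have xc: "x t \<in> carrier_vec n" if "0 \<le> t" for t using sr A that by (auto simp: state_response_def)
  define X where "X i t = complex_of_real (x t $ i)" for i t
  have X: "piecewise_cont (X i)" if "i < n" for i
    unfolding X_def[abs_def] by (rule piecewise_cont_state[OF sr A that])
  have zfin: "finite {t \<in> {0..T}. \<not> continuous (at t within {0..}) z}" for T
  proof (rule finite_subset)
    have "continuous (at t within {0..}) z" if "continuous (at t within {0..}) Z" for t
      using continuous_Re[OF that] by (simp add: Z_def)
    then show "{t \<in> {0..T}. \<not> continuous (at t within {0..}) z} \<subseteq> {t \<in> {0..T}. \<not> continuous (at t within {0..}) Z}" by blast
  qed (rule piecewise_contD(2)[OF Z])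
  have state: "(\<Sum>j<n. rpoly (integral_mat A $$ (i, j)) (X j) t) = rpoly [:0, B $$ (i, 0):] Z t" if i: "i < n" and t: "0 \<le> t" for i t
  proof -
    have eq: "volterra (\<lambda>t. (\<Sum>j<n. of_real (A $$ (i, j)) * X j t) + of_real (B $$ (i, 0)) * Z t) t = X i t" if i: "i < n" for i
    proof -
      have "volterra (\<lambda>t. (\<Sum>j<n. of_real (A $$ (i, j)) * X j t) + of_real (B $$ (i, 0)) * Z t) t =
          volterra (\<lambda>\<tau>. complex_of_real ((A *\<^sub>v x \<tau> + B *\<^sub>v vec_of_list [z \<tau>]) $ i)) t"
        by (rule volterra_cong[of t])
           (use A B i t in \<open>auto simp: carrier_vecD[OF xc] X_def Z_def scalar_prod_def lessThan_atLeast0 vec_of_list_index\<close>)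
      also have "\<dots> = X i t"
        unfolding X_def by (rule state_response_integral[OF sr A B _ i t]) (use zfin in \<open>auto simp: vec_of_list_index\<close>)
      finally show ?thesis .
    qed
    show ?thesis using integral_form_of_state_equation[OF A X Z eq i] .
  qed
  let ?c = "det (integral_mat A)"
  let ?b = "\<lambda>k. \<Sum>i<n. adj_mat (integral_mat A) $$ (k, i) * [:0, B $$ (i, 0):]"
  let ?m = "(\<Sum>k<n. \<Sum>i<n. [:C $$ (0, k):] * adj_mat (integral_mat A) $$ (k, i) * [:0, B $$ (i, 0):]) + [:D $$ (0, 0):] * ?c"
  have cX: "rpoly ?c (X k) t = rpoly (?b k) Z t" if k: "k < n" and t: "0 \<le> t" for k t
  proof -
    have "rpoly ?c (X k) t = (\<Sum>i<n. rpoly (adj_mat (integral_mat A) $$ (k, i)) (rpoly [:0, B $$ (i, 0):] Z) t)"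
      by (rule rpoly_cramer[of _ n _ t]) (use A X state k t Z in auto)
    then show ?thesis using Z by (simp only: rpoly_sum rpoly_mult)
  qed
  have Wsum: "W t = (\<Sum>k<n. rpoly [:C $$ (0, k):] (X k) t) + rpoly [:D $$ (0, 0):] Z t" if t: "0 \<le> t" for t
  proof -
    have "vec_of_list [w t] = C *\<^sub>v x t + D *\<^sub>v vec_of_list [z t]" using resp t by (simp add: response_def)
    then have "vec_of_list [w t] $ 0 = (C *\<^sub>v x t + D *\<^sub>v vec_of_list [z t]) $ 0" by simp
    then have "w t = (\<Sum>k<n. C $$ (0, k) * x t $ k) + D $$ (0, 0) * z t"
      using C D xc[OF t] by (simp add: scalar_prod_def lessThan_atLeast0 vec_of_list_index)
    then show ?thesis by (simp add: W_def X_def Z_def rpoly_const)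
  qed
  have pcS: "piecewise_cont (\<lambda>t. \<Sum>k<n. rpoly [:C $$ (0, k):] (X k) t)"
    by (intro piecewise_cont_sum piecewise_cont_rpoly X) auto
  show W: "piecewise_cont W"
    by (rule piecewise_cont_cong[OF piecewise_cont_add[OF pcS piecewise_cont_rpoly[OF Z, of "[:D $$ (0, 0):]"]]])
       (use Wsum in auto)
  have cW: "rpoly ?c W t = rpoly ?m Z t" if t: "0 \<le> t" for t
  proof -
    have "rpoly ?c W t = rpoly ?c (\<lambda>t. (\<Sum>k<n. rpoly [:C $$ (0, k):] (X k) t) + rpoly [:D $$ (0, 0):] Z t) t"
      by (rule rpoly_cong[of t]) (use Wsum t in auto)
    also have "\<dots> = rpoly ?c (\<lambda>t. \<Sum>k<n. rpoly [:C $$ (0, k):] (X k) t) t + rpoly ?c (rpoly [:D $$ (0, 0):] Z) t"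
      using vpoly_fun_add[OF pcS piecewise_cont_rpoly[OF Z, of "[:D $$ (0, 0):]"]] unfolding rpoly_def by simp
    also have "rpoly ?c (\<lambda>t. \<Sum>k<n. rpoly [:C $$ (0, k):] (X k) t) t = (\<Sum>k<n. rpoly [:C $$ (0, k):] (rpoly ?c (X k)) t)"
      using X by (subst rpoly_fun_sum) (auto simp: mult.commute simp flip: rpoly_mult intro!: sum.cong)
    also have "\<dots> = (\<Sum>k<n. rpoly [:C $$ (0, k):] (rpoly (?b k) Z) t)"
      by (intro sum.cong refl rpoly_cong[of t]) (use cX t in auto)
    also have "\<dots> = rpoly (\<Sum>k<n. [:C $$ (0, k):] * ?b k) Z t"
      using Z by (simp only: rpoly_sum rpoly_mult)
    also have "(\<Sum>k<n. [:C $$ (0, k):] * ?b k) = (\<Sum>k<n. \<Sum>i<n. [:C $$ (0, k):] * adj_mat (integral_mat A) $$ (k, i) * [:0, B $$ (i, 0):])"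
      by (simp only: sum_distrib_left mult.assoc)
    also have "rpoly ?c (rpoly [:D $$ (0, 0):] Z) t = rpoly ([:D $$ (0, 0):] * ?c) Z t"
      using Z by (simp only: mult.commute flip: rpoly_mult)
    finally show ?thesis by (simp only: rpoly_add)
  qed
  assume t: "0 \<le> t"
  define y where "y t = rpoly (hat_den \<delta>) W t - rpoly (hat_num \<delta>) Z t" for t
  have y: "piecewise_cont y" unfolding y_def[abs_def] using W Z by (intro piecewise_cont_diff piecewise_cont_rpoly)
  have "rpoly ?c y s = 0" if s: "s \<in> {0..t}" for s
  proof -
    have "rpoly ?c y s = rpoly ?c (rpoly (hat_den \<delta>) W) s - rpoly ?c (rpoly (hat_num \<delta>) Z) s"
      unfolding y_def[abs_def] using W Z by (intro rpoly_fun_diff piecewise_cont_rpoly)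
    also have "rpoly ?c (rpoly (hat_den \<delta>) W) s = rpoly (hat_den \<delta>) (rpoly ?c W) s"
      using W by (simp only: mult.commute flip: rpoly_mult)
    also have "\<dots> = rpoly (hat_den \<delta>) (rpoly ?m Z) s"
      by (rule rpoly_cong[of s]) (use cW s in auto)
    also have "\<dots> = rpoly (hat_den \<delta> * ?m) Z s"
      using Z by (simp only: rpoly_mult)
    also have "\<dots> = rpoly (hat_num \<delta> * ?c) Z s"
      by (simp only: realization_integral_form[OF real proper])
    also have "\<dots> = rpoly ?c (rpoly (hat_num \<delta>) Z) s"
      using Z by (simp only: mult.commute flip: rpoly_mult)
    finally show ?thesis by simp
  qed
  then have "y t = 0"
    by (intro rpoly_uniqueness[of ?c y t]) (use det_integral_mat_0[OF A] y t in auto)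
  then show "rpoly (hat_den \<delta>) W t = rpoly (hat_num \<delta>) Z t" by (simp add: y_def)
qed

section \<open>The frequency domain inequality in the variable 1/s\<close>

lemma map_poly_of_real_reflect:
  "map_poly complex_of_real (reflect_poly p) = reflect_poly (map_poly complex_of_real p)"
  by (intro poly_eqI) (simp add: coeff_map_poly coeff_reflect_poly)

lemma poly_complex_hat:
  assumes "tf_proper \<delta>" "x \<noteq> 0"
  shows "poly (map_poly complex_of_real (hat_num \<delta>)) x = x ^ degree (tf_den \<delta>) * poly (map_poly complex_of_real (tf_num \<delta>)) (inverse x)"
    and "poly (map_poly complex_of_real (hat_den \<delta>)) x = x ^ degree (tf_den \<delta>) * poly (map_poly complex_of_real (tf_den \<delta>)) (inverse x)"
  using assms by (simp_all add: hat_num_def hat_den_def of_real_poly.hom_mult map_poly_of_real_reflect map_poly_monom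
      poly_reflect_poly_nz poly_monom tf_proper_def flip: mult.assoc power_add)

lemma tf_den_nonzero: "tf_den \<delta> \<noteq> 0"
  by (simp add: tf_den_def)

lemma hat_den_at_0: "poly (map_poly complex_of_real (hat_den \<delta>)) 0 \<noteq> 0"
  by (simp add: hat_den_def map_poly_of_real_reflect tf_den_nonzero)

lemma hat_den_stable:
  assumes "tf_proper \<delta>" "tf_stable \<delta>" and x: "poly (map_poly complex_of_real (hat_den \<delta>)) x = 0"
  shows "Re x < 0"
proof -
  have x0: "x \<noteq> 0" using x hat_den_at_0 by auto
  then have "poly (map_poly complex_of_real (tf_den \<delta>)) (inverse x) = 0"
    using x poly_complex_hat(2)[OF assms(1) x0] by simp
  then have "Re (inverse x) < 0" using assms(2) unfolding tf_stable_def tf_poles_def by blast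
  then show ?thesis by (simp add: divide_less_0_iff not_sum_power2_lt_zero)
qed

lemma degree_hat:
  assumes "tf_proper \<delta>" "tf_stable \<delta>"
  shows "degree (hat_num \<delta>) \<le> degree (hat_den \<delta>)"
proof -
  have "0 \<notin> tf_poles \<delta>" using assms(2) by (auto simp: tf_stable_def)
  then have "coeff (tf_den \<delta>) 0 \<noteq> 0" by (simp add: tf_poles_def poly_0_coeff_0 coeff_map_poly)
  then have "degree (hat_den \<delta>) = degree (tf_den \<delta>)" by (simp add: hat_den_def)
  moreover have "degree (hat_num \<delta>) \<le> (degree (tf_den \<delta>) - degree (tf_num \<delta>)) + degree (tf_num \<delta>)"
    unfolding hat_num_def by (intro order_trans[OF degree_mult_le] add_mono degree_monom_le degree_reflect_poly_le)
  ultimately show ?thesis using assms(1) by (simp add: tf_proper_def)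
qed

text \<open>
  The point at infinity becomes the point \<open>0\<close> in the variable \<open>1/s\<close>.
\<close>

lemma tf_at_inf_hat:
  assumes "tf_proper \<delta>"
  shows "tf_at_inf \<delta> = poly (map_poly complex_of_real (hat_num \<delta>)) 0 / poly (map_poly complex_of_real (hat_den \<delta>)) 0"
proof -
  let ?n = "map_poly complex_of_real (hat_num \<delta>)" and ?d = "map_poly complex_of_real (hat_den \<delta>)"
  have inv: "((\<lambda>x. inverse x) \<longlongrightarrow> (0 :: complex)) at_infinity" by (rule tendsto_inverse_0)
  have "((\<lambda>x. poly ?n (inverse x) / poly ?d (inverse x)) \<longlongrightarrow> poly ?n 0 / poly ?d 0) at_infinity"
    by (intro tendsto_divide hat_den_at_0 tendsto_poly inv) 
  moreover have "\<forall>\<^sub>F x in at_infinity. poly ?n (inverse x) / poly ?d (inverse x) = tf_at \<delta> x"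
    unfolding eventually_at_infinity
  proof (intro exI[of _ 1] allI impI)
    fix x :: complex assume "1 \<le> cmod x"
    then have "x \<noteq> 0" by auto
    then show "poly ?n (inverse x) / poly ?d (inverse x) = tf_at \<delta> x"
      using poly_complex_hat[OF assms, of "inverse x"] by (simp add: tf_at_def)
  qed
  ultimately have "(tf_at \<delta> \<longlongrightarrow> poly ?n 0 / poly ?d 0) at_infinity"
    by (rule Lim_transform_eventually)
  then show ?thesis unfolding tf_at_inf_def by (intro tendsto_Lim) (auto simp: trivial_limit_at_infinity)
qed

lemma index_mat_adjoint:
  assumes "V \<in> carrier_mat nr nc" "i < nc" "j < nr"
  shows "mat_adjoint V $$ (i, j) = conjugate (V $$ (j, i))"
  using assms by (simp add: mat_adjoint_def mat_of_rows_index)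

lemma mat_adjoint_carrier: "V \<in> carrier_mat nr nc \<Longrightarrow> mat_adjoint V \<in> carrier_mat nc nr"
  by (auto simp: mat_adjoint_def)

text \<open>
  Evaluation of the \<open>1 \<times> 1\<close> matrix on its only basis vector.
\<close>

lemma pos_def_column:
  assumes pd: "pos_def (mat_adjoint V * map_mat complex_of_real (mat_of_rows_list 2 [[q, s], [s, r]]) * V)"
    and V: "V = mat_of_rows_list 1 [[1], [v]]"
  shows "0 < q + 2 * s * Re v + r * (cmod v)\<^sup>2"
proof -
  let ?P = "map_mat complex_of_real (mat_of_rows_list 2 [[q, s], [s, r]])"
  let ?X = "mat_adjoint V * ?P * V"
  have Vc: "V \<in> carrier_mat 2 1" and P: "?P \<in> carrier_mat 2 2" by (auto simp: V mat_of_rows_list_def)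
  have Va: "mat_adjoint V \<in> carrier_mat 1 2" using mat_adjoint_carrier[OF Vc] .
  have X: "?X \<in> carrier_mat 1 1" using Vc P Va by auto
  have u: "unit_vec 1 0 \<in> carrier_vec 1" "unit_vec 1 0 \<noteq> (0\<^sub>v 1 :: complex vec)"
    by (auto simp: vec_eq_iff)
  have entry: "(X *\<^sub>v unit_vec 1 0) \<bullet>c unit_vec 1 0 = X $$ (0, 0)" if "X \<in> carrier_mat 1 1" for X :: "complex mat"
    using carrier_matD[OF that] by (simp add: scalar_prod_def)
  have V0: "V $$ (0, 0) = 1" "V $$ (Suc 0, 0) = v" by (simp_all add: V mat_of_rows_list_def)
  have adj: "mat_adjoint V $$ (0, 0) = 1" "mat_adjoint V $$ (0, Suc 0) = cnj v"
    using index_mat_adjoint[OF Vc, of 0 0] index_mat_adjoint[OF Vc, of 0 1] by (simp_all add: V0)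
  have P0: "?P $$ (0, 0) = q" "?P $$ (0, Suc 0) = s" "?P $$ (Suc 0, 0) = s" "?P $$ (Suc 0, Suc 0) = r"
    by (simp_all add: mat_of_rows_list_def)
  have two: "(\<Sum>i<2. g i) = g 0 + g (Suc 0)" for g :: "nat \<Rightarrow> complex" by (simp add: numeral_2_eq_2)
  have "0 < (?X *\<^sub>v unit_vec 1 0) \<bullet>c unit_vec 1 0"
    using pd u X unfolding pos_def_def by (metis carrier_matD(2))
  also have "(?X *\<^sub>v unit_vec 1 0) \<bullet>c unit_vec 1 0 = ?X $$ (0, 0)"
    by (rule entry[OF X])
  also have "\<dots> = (\<Sum>i<2. mat_adjoint V $$ (0, i) * (\<Sum>j<2. ?P $$ (i, j) * V $$ (j, 0)))"
    using Vc P Va by (simp add: scalar_prod_def lessThan_atLeast0 del: index_map_mat)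
  also have "\<dots> = (q + s * v) + cnj v * (s + r * v)"
    by (simp only: two V0 adj P0) simp
  finally have "0 < Re ((q + s * v) + cnj v * (s + r * v))" by (simp add: less_complex_def)
  then show ?thesis unfolding cmod_power2 by (simp add: power2_eq_square algebra_simps)
qed

lemma uncertainty_fdi:
  assumes fdi: "fdi (mat_of_rows_list 1 [[1], [\<delta>]]) (mat_of_rows_list 2 [[q, s], [s, r]])"
  shows "0 < q + 2 * s * Re (tf_at \<delta> (\<i> * complex_of_real \<omega>)) + r * (cmod (tf_at \<delta> (\<i> * complex_of_real \<omega>)))\<^sup>2"
    and "0 < q + 2 * s * Re (tf_at_inf \<delta>) + r * (cmod (tf_at_inf \<delta>))\<^sup>2"
proof -
  let ?G = "mat_of_rows_list 1 [[1], [\<delta>]]"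
  have one: "tf_at 1 = (\<lambda>x. 1)" by (auto simp: tf_at_def tf_num_def tf_den_def)
  then have one_inf: "tf_at_inf 1 = 1"
    unfolding tf_at_inf_def one by (intro tendsto_Lim) (auto simp: trivial_limit_at_infinity)
  have map: "map_mat h ?G = mat_of_rows_list 1 [[1], [h \<delta>]]" if "h 1 = 1" for h :: "tf \<Rightarrow> complex"
    using that by (intro eq_matI) (auto simp: mat_of_rows_list_def less_Suc_eq)
  have "map_mat (\<lambda>f. tf_at f (\<i> * complex_of_real \<omega>)) ?G \<in> axis_values ?G" "map_mat tf_at_inf ?G \<in> axis_values ?G"
    by (auto simp: axis_values_def)
  then have pd: "pos_def (mat_adjoint (map_mat h ?G) * map_mat complex_of_real (mat_of_rows_list 2 [[q, s], [s, r]]) * map_mat h ?G)"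
    if "h = (\<lambda>f. tf_at f (\<i> * complex_of_real \<omega>)) \<or> h = tf_at_inf" for h
    using fdi that unfolding fdi_def by blast
  show "0 < q + 2 * s * Re (tf_at \<delta> (\<i> * complex_of_real \<omega>)) + r * (cmod (tf_at \<delta> (\<i> * complex_of_real \<omega>)))\<^sup>2"
    by (rule pos_def_column[OF pd map]) (simp_all add: one)
  show "0 < q + 2 * s * Re (tf_at_inf \<delta>) + r * (cmod (tf_at_inf \<delta>))\<^sup>2"
    by (rule pos_def_column[OF pd map]) (simp_all add: one_inf)
qed

text \<open>
  Multiplying the frequency domain inequality at \<open>1/(\<i> \<omega>)\<close>, which is the point at infinity if
  \<open>\<omega> = 0\<close>, by the squared modulus of the denominator clears the fractions.
\<close>

lemma hat_fdi:
  assumes proper: "tf_proper \<delta>" and stable: "tf_stable \<delta>"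
    and fdi: "fdi (mat_of_rows_list 1 [[1], [\<delta>]]) (mat_of_rows_list 2 [[q, s], [s, r]])"
  defines "N \<equiv> map_poly complex_of_real (hat_num \<delta>)" and "E \<equiv> map_poly complex_of_real (hat_den \<delta>)"
  shows "0 < q * (cmod (poly E (\<i> * complex_of_real \<omega>)))\<^sup>2
           + 2 * s * Re (poly N (\<i> * complex_of_real \<omega>) * cnj (poly E (\<i> * complex_of_real \<omega>)))
           + r * (cmod (poly N (\<i> * complex_of_real \<omega>)))\<^sup>2"
proof -
  let ?x = "\<i> * complex_of_real \<omega>"
  have E0: "poly E ?x \<noteq> 0" using hat_den_stable[OF proper stable, of ?x] unfolding E_def by auto
  obtain v where v: "0 < q + 2 * s * Re v + r * (cmod v)\<^sup>2" and NE: "poly N ?x = v * poly E ?x"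
  proof (cases "\<omega> = 0")
    case True
    then have "poly N ?x = tf_at_inf \<delta> * poly E ?x"
      using tf_at_inf_hat[OF proper] E0 by (simp add: N_def E_def)
    then show ?thesis using that uncertainty_fdi(2)[OF fdi] by blast
  next
    case False
    then have x: "?x \<noteq> 0" by simp
    have "inverse ?x = \<i> * complex_of_real (- inverse \<omega>)" by (simp add: of_real_inverse)
    moreover have "poly N ?x = tf_at \<delta> (inverse ?x) * poly E ?x"
      using E0 x unfolding N_def E_def poly_complex_hat[OF proper x] by (simp add: tf_at_def)
    ultimately show ?thesis using that uncertainty_fdi(1)[OF fdi, of "- inverse \<omega>"] by metis
  qed
  have "poly N ?x * cnj (poly E ?x) = complex_of_real ((cmod (poly E ?x))\<^sup>2) * v"
    unfolding NE by (simp only: complex_norm_square mult_ac)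
  then have "Re (poly N ?x * cnj (poly E ?x)) = (cmod (poly E ?x))\<^sup>2 * Re v" by simp
  moreover have "(cmod (poly N ?x))\<^sup>2 = (cmod (poly E ?x))\<^sup>2 * (cmod v)\<^sup>2"
    unfolding NE by (simp add: norm_mult power_mult_distrib)
  moreover have "0 < (cmod (poly E ?x))\<^sup>2 * (q + 2 * s * Re v + r * (cmod v)\<^sup>2)"
    using v E0 by simp
  ultimately show ?thesis by (simp add: algebra_simps)
qed

text \<open>
  The one-sided limits bound the signal near every point; Bolzano's principle turns this into a
  bound on each compact interval.
\<close>

lemma signals_piecewise_cont:
  assumes z: "z \<in> signals"
  shows "piecewise_cont (\<lambda>t. complex_of_real (z t))"
proof (rule piecewise_contI_bound)
  fix T :: real
  have right: "continuous (at_right t) z" if "0 \<le> t" for t using z that by (auto simp: signals_def)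
  have left: "\<exists>l. (z \<longlongrightarrow> l) (at_left t)" if "0 < t" for t using z that by (auto simp: signals_def)
  show "finite {t \<in> {0..T}. \<not> continuous (at t within {0..}) (\<lambda>t. complex_of_real (z t))}"
  proof (rule finite_subset)
    show "{t \<in> {0..T}. \<not> continuous (at t within {0..}) (\<lambda>t. complex_of_real (z t))} \<subseteq> {t \<in> {0..T}. \<not> continuous (at t within {0..}) z}"
      by (auto intro: continuous_of_real)
    show "finite {t \<in> {0..T}. \<not> continuous (at t within {0..}) z}" using z by (auto simp: signals_def)
  qed
  show "\<exists>c. \<forall>t\<in>{0..T}. cmod (complex_of_real (z t)) \<le> c"
  proof (cases "0 \<le> T")
    case True
    let ?P = "\<lambda>a b. \<exists>c. \<forall>t\<in>{a..b} \<inter> {0..}. \<bar>z t\<bar> \<le> c"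
    have "?P 0 T"
    proof (rule Bolzano[where P = ?P, OF True])
      fix a b c :: real assume "?P a b" "?P b c"
      then obtain k k' where "\<forall>t\<in>{a..b} \<inter> {0..}. \<bar>z t\<bar> \<le> k" "\<forall>t\<in>{b..c} \<inter> {0..}. \<bar>z t\<bar> \<le> k'" by blast
      then show "?P a c" by (intro exI[of _ "max k k'"]) (force simp: le_max_iff_disj)
    next
      fix x :: real assume x: "0 \<le> x" "x \<le> T"
      have "\<forall>\<^sub>F y in at_right x. \<bar>z y\<bar> < \<bar>z x\<bar> + 1"
        using right[OF x(1)] unfolding continuous_within
        by (intro order_tendstoD(2)[OF tendsto_rabs]) auto
      then obtain b where b: "x < b" "\<And>y. x < y \<Longrightarrow> y < b \<Longrightarrow> \<bar>z y\<bar> < \<bar>z x\<bar> + 1"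
        using eventually_at_right[of x "x + 1"] by auto
      obtain a k where a: "a < x" "\<And>y. a < y \<Longrightarrow> y < x \<Longrightarrow> 0 \<le> y \<Longrightarrow> \<bar>z y\<bar> < k"
      proof (cases "x = 0")
        case True
        then show ?thesis using that[of "-1" 0] by auto
      next
        case False
        then obtain l where "(z \<longlongrightarrow> l) (at_left x)" using left[of x] x by auto
        then have "\<forall>\<^sub>F y in at_left x. \<bar>z y\<bar> < \<bar>l\<bar> + 1"
          by (intro order_tendstoD(2)[OF tendsto_rabs]) auto
        then obtain a where "a < x" "\<And>y. a < y \<Longrightarrow> y < x \<Longrightarrow> \<bar>z y\<bar> < \<bar>l\<bar> + 1"
          using eventually_at_left[of "x - 1" x] by auto
        then show ?thesis using that by blast
      qed
      show "\<exists>d>0. \<forall>a b. a \<le> x \<and> x \<le> b \<and> b - a < d \<longrightarrow> ?P a b"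
      proof (rule exI[of _ "min (x - a) (b - x)"], intro conjI allI impI)
        show "0 < min (x - a) (b - x)" using a b by simp
        fix a' b' assume ab: "a' \<le> x \<and> x \<le> b' \<and> b' - a' < min (x - a) (b - x)"
        show "?P a' b'"
        proof (intro exI[of _ "max k (\<bar>z x\<bar> + 1)"] ballI)
          fix t assume t: "t \<in> {a'..b'} \<inter> {0..}"
          consider "t < x" | "t = x" | "t > x" by linarith
          then show "\<bar>z t\<bar> \<le> max k (\<bar>z x\<bar> + 1)"
          proof cases
            case 1
            then show ?thesis using a(2)[of t] t ab by (force simp: le_max_iff_disj)
          next
            case 3
            then show ?thesis using b(2)[of t] t ab by (force simp: le_max_iff_disj)
          qed auto
        qed
      qed
    qed
    then show ?thesis by auto
  qed auto
qed

section \<open>Block matrices and the certificate\<close>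

lemma diag2_eq_four_block:
  "A \<in> carrier_mat nr nc \<Longrightarrow> diag2 A = four_block_mat A (0\<^sub>m nr nc) (0\<^sub>m nr nc) A"
  by (subst diag_block_mat.simps(2)) (simp add: Let_def del: diag_block_mat.simps)

lemma diag2_carrier: "A \<in> carrier_mat nr nc \<Longrightarrow> diag2 A \<in> carrier_mat (nr + nr) (nc + nc)"
  by (simp only: diag2_eq_four_block) (rule four_block_carrier_mat)

lemma diag2_mult_append:
  fixes A :: "real mat"
  assumes "A \<in> carrier_mat nr nc" "a \<in> carrier_vec nc" "b \<in> carrier_vec nc"
  shows "diag2 A *\<^sub>v (a @\<^sub>v b) = (A *\<^sub>v a) @\<^sub>v (A *\<^sub>v b)"
proof -
  have "diag2 A *\<^sub>v (a @\<^sub>v b) = (A *\<^sub>v a + 0\<^sub>m nr nc *\<^sub>v b) @\<^sub>v (0\<^sub>m nr nc *\<^sub>v a + A *\<^sub>v b)"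
    unfolding diag2_eq_four_block[OF assms(1)] by (rule four_block_mat_mult_vec) (use assms in auto)
  moreover have "0\<^sub>m nr nc *\<^sub>v b = 0\<^sub>v nr" "0\<^sub>m nr nc *\<^sub>v a = 0\<^sub>v nr" using assms by auto
  ultimately show ?thesis
    using right_zero_vec[OF mult_mat_vec_carrier[OF assms(1,2)]] left_zero_vec[OF mult_mat_vec_carrier[OF assms(1,3)]]
    by simp
qed

lemma diag2_affine_append:
  fixes A B :: "real mat"
  assumes "A \<in> carrier_mat nr nc" "a \<in> carrier_vec nc" "b \<in> carrier_vec nc"
    and "B \<in> carrier_mat nr mc" "u \<in> carrier_vec mc" "v \<in> carrier_vec mc"
  shows "diag2 A *\<^sub>v (a @\<^sub>v b) + diag2 B *\<^sub>v (u @\<^sub>v v) = (A *\<^sub>v a + B *\<^sub>v u) @\<^sub>v (A *\<^sub>v b + B *\<^sub>v v)"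
  unfolding diag2_mult_append[OF assms(1-3)] diag2_mult_append[OF assms(4-6)]
  by (rule append_vec_add) (use assms in \<open>auto intro: mult_mat_vec_carrier\<close>)

lemma kronecker_two_eq_four_block:
  fixes M :: "real mat"
  assumes M: "M \<in> carrier_mat l l"
  shows "mat_of_rows_list 2 [[q, s], [s, r]] \<otimes>\<^sub>K M = four_block_mat (q \<cdot>\<^sub>m M) (s \<cdot>\<^sub>m M) (s \<cdot>\<^sub>m M) (r \<cdot>\<^sub>m M)"
proof (rule eq_matI)
  fix i j assume "i < dim_row (four_block_mat (q \<cdot>\<^sub>m M) (s \<cdot>\<^sub>m M) (s \<cdot>\<^sub>m M) (r \<cdot>\<^sub>m M))"
    "j < dim_col (four_block_mat (q \<cdot>\<^sub>m M) (s \<cdot>\<^sub>m M) (s \<cdot>\<^sub>m M) (r \<cdot>\<^sub>m M))"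
  then have ij: "i < l + l" "j < l + l" using M by auto
  have idx: "(k < l \<and> k div l = 0 \<and> k mod l = k) \<or> (\<not> k < l \<and> k div l = 1 \<and> k mod l = k - l)" if "k < l + l" for k
  proof (cases "k < l")
    case False
    then have "k = (k - l) + l" "k - l < l" using that by auto
    then have "k div l = 1" "k mod l = k - l"
      by (metis div_add_self2 div_less add_0 not_less_zero One_nat_def plus_1_eq_Suc add.commute, metis mod_add_self2 mod_less)
    then show ?thesis using False by simp
  qed simp
  show "(mat_of_rows_list 2 [[q, s], [s, r]] \<otimes>\<^sub>K M) $$ (i, j) = four_block_mat (q \<cdot>\<^sub>m M) (s \<cdot>\<^sub>m M) (s \<cdot>\<^sub>m M) (r \<cdot>\<^sub>m M) $$ (i, j)"
    using M ij idx[OF ij(1)] idx[OF ij(2)]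
    by (auto simp: kronecker_def mat_of_rows_list_def)
qed (use M in \<open>auto simp: kronecker_def mat_of_rows_list_def\<close>)

lemma kronecker_two_form:
  fixes M :: "real mat"
  assumes M: "M \<in> carrier_mat l l" and v: "a \<in> carrier_vec l" "b \<in> carrier_vec l" "c \<in> carrier_vec l" "d \<in> carrier_vec l"
  shows "(a @\<^sub>v b) \<bullet> ((mat_of_rows_list 2 [[q, s], [s, r]] \<otimes>\<^sub>K M) *\<^sub>v (c @\<^sub>v d)) =
    q * (a \<bullet> (M *\<^sub>v c)) + s * (a \<bullet> (M *\<^sub>v d)) + s * (b \<bullet> (M *\<^sub>v c)) + r * (b \<bullet> (M *\<^sub>v d))"
proof -
  have sm: "(k \<cdot>\<^sub>m M) *\<^sub>v x = k \<cdot>\<^sub>v (M *\<^sub>v x)" if "x \<in> carrier_vec l" for k x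
    using M that by (intro eq_vecI) auto
  have Mc: "M *\<^sub>v x \<in> carrier_vec l" for x using M by (intro carrier_vecI) simp
  have "(mat_of_rows_list 2 [[q, s], [s, r]] \<otimes>\<^sub>K M) *\<^sub>v (c @\<^sub>v d) =
      (q \<cdot>\<^sub>v (M *\<^sub>v c) + s \<cdot>\<^sub>v (M *\<^sub>v d)) @\<^sub>v (s \<cdot>\<^sub>v (M *\<^sub>v c) + r \<cdot>\<^sub>v (M *\<^sub>v d))"
    unfolding kronecker_two_eq_four_block[OF M] sm[OF v(3), symmetric] sm[OF v(4), symmetric]
    by (rule four_block_mat_mult_vec) (use M v in auto)
  moreover have "a \<bullet> (x \<cdot>\<^sub>v (M *\<^sub>v c) + y \<cdot>\<^sub>v (M *\<^sub>v d)) = x * (a \<bullet> (M *\<^sub>v c)) + y * (a \<bullet> (M *\<^sub>v d))"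
    if "a \<in> carrier_vec l" for x y a
    using that Mc by (simp add: scalar_prod_add_distrib[of _ l])
  ultimately show ?thesis
    using v Mc by (simp add: scalar_prod_append[of _ l _ l])
qed

text \<open>
  The polarized dissipation identity: \<open>R - L\<close> measures the output form minus the derivative of the
  storage \<open>x\<^sup>T K x\<close>, where the derivatives are expressed through the state equation.
\<close>

lemma certificate_form:
  fixes A B C D M K :: "real mat"
  assumes A: "A \<in> carrier_mat n n" and B: "B \<in> carrier_mat n 1" and C: "C \<in> carrier_mat l n" and D: "D \<in> carrier_mat l 1"
    and M: "M \<in> carrier_mat l l" and K: "K \<in> carrier_mat n n"
    and v: "a \<in> carrier_vec n" "b \<in> carrier_vec n" "u \<in> carrier_vec 1" "v \<in> carrier_vec 1"
  defines "L \<equiv> transpose_mat (four_block_mat A B (1\<^sub>m n) (0\<^sub>m n 1)) * four_block_mat (0\<^sub>m n n) K K (0\<^sub>m n n) * four_block_mat A B (1\<^sub>m n) (0\<^sub>m n 1)"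
    and "R \<equiv> transpose_mat (append_cols C D) * M * append_cols C D"
  shows "(a @\<^sub>v u) \<bullet> ((R - L) *\<^sub>v (b @\<^sub>v v)) =
      (C *\<^sub>v a + D *\<^sub>v u) \<bullet> (M *\<^sub>v (C *\<^sub>v b + D *\<^sub>v v))
      - ((A *\<^sub>v a + B *\<^sub>v u) \<bullet> (K *\<^sub>v b) + a \<bullet> (K *\<^sub>v (A *\<^sub>v b + B *\<^sub>v v)))"
    and "R - L \<in> carrier_mat (n + 1) (n + 1)"
proof -
  let ?E = "four_block_mat A B (1\<^sub>m n) (0\<^sub>m n 1)" and ?P = "four_block_mat (0\<^sub>m n n) K K (0\<^sub>m n n)" and ?G = "append_cols C D"
  have E: "?E \<in> carrier_mat (n + n) (n + 1)" using A B by (intro four_block_carrier_mat) auto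
  have P: "?P \<in> carrier_mat (n + n) (n + n)" by (intro four_block_carrier_mat) auto
  have G: "?G \<in> carrier_mat l (n + 1)" using C D four_block_carrier_mat[of C l n "0\<^sub>m 0 1" 0 1 D "0\<^sub>m 0 n"] by (simp add: append_cols_def)
  have L: "L \<in> carrier_mat (n + 1) (n + 1)" unfolding L_def
    using mult_carrier_mat[OF mult_carrier_mat[OF transpose_carrier_mat[THEN iffD2, OF E] P] E] .
  have R: "R \<in> carrier_mat (n + 1) (n + 1)" unfolding R_def
    using mult_carrier_mat[OF mult_carrier_mat[OF transpose_carrier_mat[THEN iffD2, OF G] M] G] .
  show "R - L \<in> carrier_mat (n + 1) (n + 1)" using L R by auto
  have au: "a @\<^sub>v u \<in> carrier_vec (n + 1)" "b @\<^sub>v v \<in> carrier_vec (n + 1)"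
    using v by (blast intro: append_carrier_vec)+
  have Eapp: "?E *\<^sub>v (x @\<^sub>v y) = (A *\<^sub>v x + B *\<^sub>v y) @\<^sub>v x" if "x \<in> carrier_vec n" "y \<in> carrier_vec 1" for x y
  proof -
    have "?E *\<^sub>v (x @\<^sub>v y) = (A *\<^sub>v x + B *\<^sub>v y) @\<^sub>v (1\<^sub>m n *\<^sub>v x + 0\<^sub>m n 1 *\<^sub>v y)"
      by (rule four_block_mat_mult_vec) (use A B that in auto)
    moreover have "1\<^sub>m n *\<^sub>v x + 0\<^sub>m n 1 *\<^sub>v y = x" using that by (intro eq_vecI) (auto simp: scalar_prod_def)
    ultimately show ?thesis by simp
  qed
  have Papp: "?P *\<^sub>v (x @\<^sub>v y) = (K *\<^sub>v y) @\<^sub>v (K *\<^sub>v x)" if "x \<in> carrier_vec n" "y \<in> carrier_vec n" for x y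
  proof -
    have "?P *\<^sub>v (x @\<^sub>v y) = (0\<^sub>m n n *\<^sub>v x + K *\<^sub>v y) @\<^sub>v (K *\<^sub>v x + 0\<^sub>m n n *\<^sub>v y)"
      by (rule four_block_mat_mult_vec) (use K that in auto)
    moreover have "0\<^sub>m n n *\<^sub>v x + K *\<^sub>v y = K *\<^sub>v y" "K *\<^sub>v x + 0\<^sub>m n n *\<^sub>v y = K *\<^sub>v x"
      using that K by (auto intro!: eq_vecI simp: scalar_prod_def)
    ultimately show ?thesis by simp
  qed
  have Gapp: "?G *\<^sub>v (x @\<^sub>v y) = C *\<^sub>v x + D *\<^sub>v y" if "x \<in> carrier_vec n" "y \<in> carrier_vec 1" for x y
  proof -
    have "?G *\<^sub>v (x @\<^sub>v y) = (C *\<^sub>v x + D *\<^sub>v y) @\<^sub>v (0\<^sub>m 0 n *\<^sub>v x + 0\<^sub>m 0 1 *\<^sub>v y)"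
      unfolding append_cols_def carrier_matD(2)[OF C] carrier_matD(2)[OF D] by (rule four_block_mat_mult_vec) (use C D that in auto)
    then show ?thesis by (intro eq_vecI) auto
  qed
  have cA: "A *\<^sub>v x + B *\<^sub>v y \<in> carrier_vec n" if "x \<in> carrier_vec n" "y \<in> carrier_vec 1" for x y
    using A B that by auto
  have cC: "C *\<^sub>v x + D *\<^sub>v y \<in> carrier_vec l" if "x \<in> carrier_vec n" "y \<in> carrier_vec 1" for x y
    using C D that by auto
  have tr: "x \<bullet> ((transpose_mat N * S * N) *\<^sub>v y) = (N *\<^sub>v x) \<bullet> (S *\<^sub>v (N *\<^sub>v y))"
    if N: "N \<in> carrier_mat p m" and S: "S \<in> carrier_mat p p" and x: "x \<in> carrier_vec m" and y: "y \<in> carrier_vec m" for N S :: "real mat" and p m x y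
  proof -
    have Ny: "N *\<^sub>v y \<in> carrier_vec p" and SN: "S *\<^sub>v (N *\<^sub>v y) \<in> carrier_vec p" and Nx: "N *\<^sub>v x \<in> carrier_vec p" using N S x y by auto
    have T: "transpose_mat N \<in> carrier_mat m p" using N by simp
    have "(transpose_mat N * S * N) *\<^sub>v y = transpose_mat N *\<^sub>v (S *\<^sub>v (N *\<^sub>v y))"
      using assoc_mult_mat_vec[OF mult_carrier_mat[OF T S] N y] assoc_mult_mat_vec[OF T S Ny] by simp
    then have "x \<bullet> ((transpose_mat N * S * N) *\<^sub>v y) = (transpose_mat N *\<^sub>v (S *\<^sub>v (N *\<^sub>v y))) \<bullet> x"
      using comm_scalar_prod[OF x mult_mat_vec_carrier[OF T SN]] by simp
    also have "\<dots> = (S *\<^sub>v (N *\<^sub>v y)) \<bullet> (N *\<^sub>v x)" by (rule transpose_vec_mult_scalar[OF N x SN])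
    also have "\<dots> = (N *\<^sub>v x) \<bullet> (S *\<^sub>v (N *\<^sub>v y))" by (rule comm_scalar_prod[OF SN Nx])
    finally show ?thesis .
  qed
  have "(a @\<^sub>v u) \<bullet> ((R - L) *\<^sub>v (b @\<^sub>v v)) = (a @\<^sub>v u) \<bullet> (R *\<^sub>v (b @\<^sub>v v)) - (a @\<^sub>v u) \<bullet> (L *\<^sub>v (b @\<^sub>v v))"
    using minus_mult_distrib_mat_vec[OF R L au(2)] scalar_prod_minus_distrib[OF au(1) mult_mat_vec_carrier[OF R au(2)] mult_mat_vec_carrier[OF L au(2)]]
    by simp
  also have "(a @\<^sub>v u) \<bullet> (R *\<^sub>v (b @\<^sub>v v)) = (C *\<^sub>v a + D *\<^sub>v u) \<bullet> (M *\<^sub>v (C *\<^sub>v b + D *\<^sub>v v))"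
    unfolding R_def tr[OF G M au] using v by (simp add: Gapp)
  also have "(a @\<^sub>v u) \<bullet> (L *\<^sub>v (b @\<^sub>v v)) = (A *\<^sub>v a + B *\<^sub>v u) \<bullet> (K *\<^sub>v b) + a \<bullet> (K *\<^sub>v (A *\<^sub>v b + B *\<^sub>v v))"
    unfolding L_def tr[OF E P au] Eapp[OF v(1,3)] Eapp[OF v(2,4)] Papp[OF cA[OF v(2,4)] v(2)]
    by (rule scalar_prod_append[of _ n _ n]) (use v K cA in auto)
  finally show "(a @\<^sub>v u) \<bullet> ((R - L) *\<^sub>v (b @\<^sub>v v)) =
      (C *\<^sub>v a + D *\<^sub>v u) \<bullet> (M *\<^sub>v (C *\<^sub>v b + D *\<^sub>v v))
      - ((A *\<^sub>v a + B *\<^sub>v u) \<bullet> (K *\<^sub>v b) + a \<bullet> (K *\<^sub>v (A *\<^sub>v b + B *\<^sub>v v)))" .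
qed

lemma scalar_prod_mult_mat_vec_sum:
  fixes Q :: "real mat"
  assumes "Q \<in> carrier_mat m m" "x \<in> carrier_vec m" "y \<in> carrier_vec m"
  shows "x \<bullet> (Q *\<^sub>v y) = (\<Sum>j<m. \<Sum>k<m. Q $$ (j, k) * (x $ j * y $ k))"
  using assms by (simp add: scalar_prod_def lessThan_atLeast0 sum_distrib_left mult_ac)

lemma pos_def_nonneg:
  fixes X :: "real mat"
  assumes pd: "pos_def X" and X: "X \<in> carrier_mat m m"
  shows "0 \<le> (\<Sum>j<m. \<Sum>k<m. X $$ (j, k) * (x j * x k))"
proof -
  have "0 \<le> vec m x \<bullet> (X *\<^sub>v vec m x)"
  proof (cases "vec m x = 0\<^sub>v m")
    case True
    then show ?thesis using X by (simp add: scalar_prod_left_zero[of _ m] mult_mat_vec_carrier[OF X])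
  next
    case False
    then have "0 < (X *\<^sub>v vec m x) \<bullet>c vec m x"
      using pd X unfolding pos_def_def by auto
    then show ?thesis using comm_scalar_prod[OF _ mult_mat_vec_carrier[OF X], of "vec m x" "vec m x"]
      by (simp add: conjugate_vec_def)
  qed
  then show ?thesis using scalar_prod_mult_mat_vec_sum[OF X, of "vec m x" "vec m x"] by simp
qed

section \<open>The filter driven by both signals\<close>

lemma quadratic_form_has_integral:
  fixes x y :: "real \<Rightarrow> real vec" and Z :: "real mat"
  assumes Z: "Z \<in> carrier_mat m m" and F: "finite F" and T: "0 \<le> T"
    and x: "\<And>t. 0 \<le> t \<Longrightarrow> x t \<in> carrier_vec m" and y: "\<And>t. 0 \<le> t \<Longrightarrow> y t \<in> carrier_vec m"
    and cont: "\<And>i. i < m \<Longrightarrow> continuous_on {0..T} (\<lambda>t. x t $ i)"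
    and deriv: "\<And>i t. i < m \<Longrightarrow> 0 < t \<Longrightarrow> t < T \<Longrightarrow> t \<notin> F \<Longrightarrow> ((\<lambda>t. x t $ i) has_real_derivative y t $ i) (at t)"
    and zero: "x 0 = 0\<^sub>v m"
  shows "((\<lambda>t. y t \<bullet> (Z *\<^sub>v x t) + x t \<bullet> (Z *\<^sub>v y t)) has_integral x T \<bullet> (Z *\<^sub>v x T)) {0..T}"
proof -
  define g where "g t = (\<Sum>j<m. \<Sum>k<m. Z $$ (j, k) * (x t $ j * x t $ k))" for t
  define g' where "g' t = (\<Sum>j<m. \<Sum>k<m. Z $$ (j, k) * (y t $ j * x t $ k + y t $ k * x t $ j))" for t
  have int: "(g' has_integral (g T - g 0)) {0..T}"
  proof (rule fundamental_theorem_of_calculus_interior_strong[OF F T])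
    show "continuous_on {0..T} g"
      unfolding g_def[abs_def] by (intro continuous_intros cont) auto
    show "(g has_vector_derivative g' t) (at t)" if "t \<in> {0<..<T} - F" for t
      unfolding g_def[abs_def] g'_def has_real_derivative_iff_has_vector_derivative[symmetric]
      by (intro DERIV_sum DERIV_cmult DERIV_mult deriv) (use that in auto)
  qed
  have "g 0 = 0" by (simp add: g_def zero)
  moreover have "g T = x T \<bullet> (Z *\<^sub>v x T)"
    using scalar_prod_mult_mat_vec_sum[OF Z x[OF T] x[OF T]] by (simp add: g_def)
  moreover have "g' t = y t \<bullet> (Z *\<^sub>v x t) + x t \<bullet> (Z *\<^sub>v y t)" if "t \<in> {0..T}" for t
  proof -
    have "y t \<bullet> (Z *\<^sub>v x t) = (\<Sum>j<m. \<Sum>k<m. Z $$ (j, k) * (y t $ j * x t $ k))"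
      "x t \<bullet> (Z *\<^sub>v y t) = (\<Sum>j<m. \<Sum>k<m. Z $$ (j, k) * (y t $ k * x t $ j))"
      using that scalar_prod_mult_mat_vec_sum[OF Z y x, of t t] scalar_prod_mult_mat_vec_sum[OF Z x y, of t t]
      by (simp_all add: mult.commute)
    then show ?thesis by (simp add: g'_def distrib_left sum.distrib)
  qed
  ultimately show ?thesis using has_integral_eq[OF _ int] by simp
qed

lemma singleton_carrier: "vec_of_list [x] \<in> carrier_vec 1"
  by (rule carrier_vecI) simp

lemma vec_of_list_two: "vec_of_list [a, b] = vec_of_list [a] @\<^sub>v vec_of_list [b]"
  by (intro eq_vecI) (auto simp: vec_of_list_index less_Suc_eq)

lemma continuous_of_real_iff:
  "continuous F (\<lambda>t. complex_of_real (f t)) \<longleftrightarrow> continuous F f"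
  using continuous_Re[of F "\<lambda>t. complex_of_real (f t)"] by (auto intro: continuous_of_real)

text \<open>
  A block diagonal filter driven by \<open>(z, w)\<close> consists of two copies of one filter, driven by \<open>z\<close> and
  by \<open>w\<close>. The state equation is imposed only at the times at which both inputs are continuous.
\<close>

locale filtered_pair =
  fixes A B :: "real mat" and n :: nat and z w :: "real \<Rightarrow> real" and \<xi> :: "real \<Rightarrow> real vec"
  assumes A: "A \<in> carrier_mat n n" and B: "B \<in> carrier_mat n 1"
    and z: "piecewise_cont (\<lambda>t. complex_of_real (z t))" and w: "piecewise_cont (\<lambda>t. complex_of_real (w t))"
    and response: "state_response (diag2 A) (diag2 B) (\<lambda>t. vec_of_list [z t, w t]) \<xi>"
begin

definition state_z :: "real \<Rightarrow> real vec" where "state_z t = vec_first (\<xi> t) n"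
definition state_w :: "real \<Rightarrow> real vec" where "state_w t = vec_last (\<xi> t) n"
definition rate_z :: "real \<Rightarrow> real vec" where "rate_z t = A *\<^sub>v state_z t + B *\<^sub>v vec_of_list [z t]"
definition rate_w :: "real \<Rightarrow> real vec" where "rate_w t = A *\<^sub>v state_w t + B *\<^sub>v vec_of_list [w t]"

lemma carriers:
  "state_z t \<in> carrier_vec n" "state_w t \<in> carrier_vec n" "rate_z t \<in> carrier_vec n" "rate_w t \<in> carrier_vec n"
proof -
  show ab: "state_z t \<in> carrier_vec n" "state_w t \<in> carrier_vec n" by (auto simp: state_z_def state_w_def vec_first_def vec_last_def)
  show "rate_z t \<in> carrier_vec n" "rate_w t \<in> carrier_vec n"
    unfolding rate_z_def rate_w_def
    by (rule add_carrier_vec, rule mult_mat_vec_carrier[OF A], rule ab, rule mult_mat_vec_carrier[OF B singleton_carrier])+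
qed

lemma diag_carriers: "diag2 A \<in> carrier_mat (n + n) (n + n)" "diag2 B \<in> carrier_mat (n + n) 2"
  using diag2_carrier[OF A] diag2_carrier[OF B] by (simp_all add: numeral_2_eq_2 del: diag_block_mat.simps)

lemma state_response_dims:
  "\<forall>t\<ge>0. \<xi> t \<in> carrier_vec (n + n)" "\<xi> 0 = 0\<^sub>v (n + n)"
  "\<forall>i<n + n. continuous_on {0..} (\<lambda>t. \<xi> t $ i)"
  "\<forall>t\<ge>0. (\<forall>j<2. continuous (at t within {0..}) (\<lambda>\<tau>. vec_of_list [z \<tau>, w \<tau>] $ j)) \<longrightarrow>
     (\<forall>i<n + n. ((\<lambda>t. \<xi> t $ i) has_real_derivative (diag2 A *\<^sub>v \<xi> t + diag2 B *\<^sub>v vec_of_list [z t, w t]) $ i) (at t within {0..}))"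
  using response
  unfolding state_response_def carrier_matD(1)[OF diag_carriers(1)] carrier_matD(2)[OF diag_carriers(2)]
  by blast+

lemma \<xi>_carrier: "0 \<le> t \<Longrightarrow> \<xi> t \<in> carrier_vec (n + n)"
  using state_response_dims(1) by blast

lemma \<xi>_split: "0 \<le> t \<Longrightarrow> \<xi> t = state_z t @\<^sub>v state_w t"
  using vec_first_last_append[OF \<xi>_carrier] by (simp add: state_z_def state_w_def)

lemma \<xi>_index:
  assumes "0 \<le> t" "i < n"
  shows "\<xi> t $ i = state_z t $ i" "\<xi> t $ (n + i) = state_w t $ i"
  using carriers(1,2)[of t] assms by (auto simp: \<xi>_split)

lemma derivative_split:
  assumes "0 \<le> t"
  shows "diag2 A *\<^sub>v \<xi> t + diag2 B *\<^sub>v vec_of_list [z t, w t] = rate_z t @\<^sub>v rate_w t"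
  unfolding \<xi>_split[OF assms] vec_of_list_two rate_z_def rate_w_def
  by (rule diag2_affine_append[OF A _ _ B]) (rule carriers singleton_carrier)+

lemma rate_z_index: "i < n \<Longrightarrow> rate_z t $ i = (\<Sum>j<n. A $$ (i, j) * state_z t $ j) + B $$ (i, 0) * z t"
  and rate_w_index: "i < n \<Longrightarrow> rate_w t $ i = (\<Sum>j<n. A $$ (i, j) * state_w t $ j) + B $$ (i, 0) * w t"
  using A B carriers(1,2)[of t]
  by (auto simp: rate_z_def rate_w_def scalar_prod_def lessThan_atLeast0 vec_of_list_index)

definition jumps :: "real \<Rightarrow> real set" where
  "jumps T = {t \<in> {0..T}. \<not> continuous (at t within {0..}) z} \<union> {t \<in> {0..T}. \<not> continuous (at t within {0..}) w}"

lemma finite_jumps: "finite (jumps T)"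
  using piecewise_contD(2)[OF z, of T] piecewise_contD(2)[OF w, of T]
  by (simp add: jumps_def continuous_of_real_iff)

lemma \<xi>_continuous: "i < n + n \<Longrightarrow> continuous_on {0..} (\<lambda>t. \<xi> t $ i)"
  using state_response_dims(3) by blast

lemma \<xi>_derivative:
  assumes "i < n + n" "0 < t" "t < T" "t \<notin> jumps T"
  shows "((\<lambda>t. \<xi> t $ i) has_real_derivative (rate_z t @\<^sub>v rate_w t) $ i) (at t)"
proof -
  have "continuous (at t within {0..}) (\<lambda>\<tau>. vec_of_list [z \<tau>, w \<tau>] $ j)" if "j < 2" for j
    using assms that by (auto simp: jumps_def vec_of_list_index less_2_cases_iff)
  then have "((\<lambda>t. \<xi> t $ i) has_real_derivative (diag2 A *\<^sub>v \<xi> t + diag2 B *\<^sub>v vec_of_list [z t, w t]) $ i) (at t within {0..})"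
    using state_response_dims(4) assms(1,2) less_imp_le by blast
  moreover have "at t within {0..} = at t" by (rule at_within_interior) (use assms in auto)
  ultimately show ?thesis using derivative_split[of t] assms(2) by simp
qed

lemma state_piecewise_cont:
  assumes "i < n"
  shows "piecewise_cont (\<lambda>t. complex_of_real (state_z t $ i))" "piecewise_cont (\<lambda>t. complex_of_real (state_w t $ i))"
proof -
  have "piecewise_cont (\<lambda>t. complex_of_real (\<xi> t $ j))" if "j < n + n" for j
    by (intro piecewise_cont_of_continuous continuous_intros \<xi>_continuous that)
  then have "piecewise_cont (\<lambda>t. complex_of_real (\<xi> t $ i))" "piecewise_cont (\<lambda>t. complex_of_real (\<xi> t $ (n + i)))"
    using assms by simp_all
  from piecewise_cont_cong[OF this(1)] piecewise_cont_cong[OF this(2)]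
  show "piecewise_cont (\<lambda>t. complex_of_real (state_z t $ i))" "piecewise_cont (\<lambda>t. complex_of_real (state_w t $ i))"
    by (simp_all add: \<xi>_index[OF _ assms])
qed

lemma volterra_\<xi>:
  assumes i: "i < n + n" and t: "0 \<le> t"
  shows "volterra (\<lambda>t. complex_of_real ((rate_z t @\<^sub>v rate_w t) $ i)) t = complex_of_real (\<xi> t $ i)"
proof -
  have "volterra (\<lambda>t. complex_of_real ((rate_z t @\<^sub>v rate_w t) $ i)) t = complex_of_real (\<xi> t $ i) - complex_of_real (\<xi> 0 $ i)"
  proof (rule volterra_eqI_finite[OF finite_jumps[of t]])
    show "continuous_on {0..t} (\<lambda>t. complex_of_real (\<xi> t $ i))"
      by (intro continuous_intros continuous_on_subset[OF \<xi>_continuous[OF i]]) auto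
  qed (use t \<xi>_derivative[OF i] in \<open>auto intro: has_vector_derivative_of_real\<close>)
  moreover have "\<xi> 0 = 0\<^sub>v (n + n)"
    by (rule state_response_dims(2))
  ultimately show ?thesis using i by simp
qed

lemma state_equations:
  assumes i: "i < n" and t: "0 \<le> t"
  shows "(\<Sum>j<n. rpoly (integral_mat A $$ (i, j)) (\<lambda>t. complex_of_real (state_z t $ j)) t) = rpoly [:0, B $$ (i, 0):] (\<lambda>t. complex_of_real (z t)) t"
    and "(\<Sum>j<n. rpoly (integral_mat A $$ (i, j)) (\<lambda>t. complex_of_real (state_w t $ j)) t) = rpoly [:0, B $$ (i, 0):] (\<lambda>t. complex_of_real (w t)) t"
proof -
  have "volterra (\<lambda>t. (\<Sum>j<n. of_real (A $$ (i, j)) * complex_of_real (state_z t $ j)) + of_real (B $$ (i, 0)) * complex_of_real (z t)) t = complex_of_real (state_z t $ i)"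
    if "i < n" for i
    using volterra_\<xi>[of i t] that t rate_z_index[OF that]
    by (simp add: \<xi>_index carrier_vecD[OF carriers(3)] carrier_vecD[OF carriers(4)])
  then show "(\<Sum>j<n. rpoly (integral_mat A $$ (i, j)) (\<lambda>t. complex_of_real (state_z t $ j)) t) = rpoly [:0, B $$ (i, 0):] (\<lambda>t. complex_of_real (z t)) t"
    by (intro integral_form_of_state_equation[OF A state_piecewise_cont(1) z _ i]) auto
  have "volterra (\<lambda>t. (\<Sum>j<n. of_real (A $$ (i, j)) * complex_of_real (state_w t $ j)) + of_real (B $$ (i, 0)) * complex_of_real (w t)) t = complex_of_real (state_w t $ i)"
    if "i < n" for i
    using volterra_\<xi>[of "n + i" t] that t rate_w_index[OF that]
    by (simp add: \<xi>_index carrier_vecD[OF carriers(3)] carrier_vecD[OF carriers(4)])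
  then show "(\<Sum>j<n. rpoly (integral_mat A $$ (i, j)) (\<lambda>t. complex_of_real (state_w t $ j)) t) = rpoly [:0, B $$ (i, 0):] (\<lambda>t. complex_of_real (w t)) t"
    by (intro integral_form_of_state_equation[OF A state_piecewise_cont(2) w _ i]) auto
qed

lemma storage_has_integral:
  assumes Z: "Z \<in> carrier_mat (n + n) (n + n)" and T: "0 \<le> T"
  shows "((\<lambda>t. (rate_z t @\<^sub>v rate_w t) \<bullet> (Z *\<^sub>v \<xi> t) + \<xi> t \<bullet> (Z *\<^sub>v (rate_z t @\<^sub>v rate_w t))) has_integral \<xi> T \<bullet> (Z *\<^sub>v \<xi> T)) {0..T}"
proof (rule quadratic_form_has_integral[OF Z finite_jumps T])
  show "\<xi> 0 = 0\<^sub>v (n + n)"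
    by (rule state_response_dims(2))
  show "continuous_on {0..T} (\<lambda>t. \<xi> t $ i)" if "i < n + n" for i
    by (rule continuous_on_subset[OF \<xi>_continuous[OF that]]) auto
qed (auto intro: \<xi>_carrier \<xi>_derivative append_carrier_vec carriers)

end

lemma kronecker_two_carrier:
  fixes K :: "real mat"
  shows "K \<in> carrier_mat n n \<Longrightarrow> mat_of_rows_list 2 [[q, s], [s, r]] \<otimes>\<^sub>K K \<in> carrier_mat (n + n) (n + n)"
  by (simp only: kronecker_two_eq_four_block) (intro four_block_carrier_mat, auto)

lemma volterra_real_part:
  assumes f: "piecewise_cont f" and eq: "\<And>t. 0 \<le> t \<Longrightarrow> Re (f t) = g t"
  shows "(g has_integral Re (volterra f T)) {0..T}"
proof -
  have "((\<lambda>t. Re (f t)) has_integral Re (volterra f T)) {0..T}"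
    using has_integral_linear[OF integrable_integral[OF piecewise_cont_integrable[OF f, of 0 T]] bounded_linear_Re]
    by (simp add: o_def volterra_def)
  then show ?thesis by (rule has_integral_eq[rotated]) (use eq in auto)
qed

lemma bilinear_form_combination:
  fixes Q :: "real mat"
  assumes "Q \<in> carrier_mat m m" "x \<in> carrier_vec m" "y \<in> carrier_vec m"
  shows "(\<Sum>j<m. \<Sum>k<m. Q $$ (j, k) * (q * (x $ j * x $ k) + s * (x $ j * y $ k) + s * (y $ j * x $ k) + r * (y $ j * y $ k))) =
    q * (x \<bullet> (Q *\<^sub>v x)) + s * (x \<bullet> (Q *\<^sub>v y)) + s * (y \<bullet> (Q *\<^sub>v x)) + r * (y \<bullet> (Q *\<^sub>v y))"
  using assms by (simp add: scalar_prod_mult_mat_vec_sum[of Q m] sum.distrib sum_distrib_left algebra_simps)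

theorem theorem21:
  fixes q s r :: real
    and l n :: nat
    and \<psi> :: "tf mat"
    and A B C D M K P\<^sub>0 :: "real mat"
  defines "P\<^sub>0 \<equiv> mat_of_rows_list 2 [[q, s], [s, r]]"
  assumes "r \<le> 0"
    and "stable_transfer_mat l 1 \<psi>"
    and "full_column_rank_on_axis \<psi>"
    and "minimal_realization n A B C D \<psi>"
    and "M \<in> symmetric_mats l"
    and "fdi \<psi> M"
    and "K \<in> symmetric_mats n"
    and "transpose_mat (four_block_mat A B (1\<^sub>m n) (0\<^sub>m n 1))
           * four_block_mat (0\<^sub>m n n) K K (0\<^sub>m n n)
           * four_block_mat A B (1\<^sub>m n) (0\<^sub>m n 1)
         \<prec> transpose_mat (append_cols C D) * M * append_cols C D"
  shows "satisfies_iqc (dynamic_uncertainty P\<^sub>0)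
           (diag2 A) (diag2 B) (diag2 C) (diag2 D) (P\<^sub>0 \<otimes>\<^sub>K M) (P\<^sub>0 \<otimes>\<^sub>K K)"
  unfolding satisfies_iqc_def
proof (intro ballI allI impI)
  fix z w :: "real \<Rightarrow> real" and \<xi> v :: "real \<Rightarrow> real vec" and T :: real
  assume z: "z \<in> signals" and w: "w \<in> dynamic_uncertainty P\<^sub>0 z" and T: "0 \<le> T"
    and resp: "response (diag2 A) (diag2 B) (diag2 C) (diag2 D) (\<lambda>t. vec_of_list [z t, w t]) \<xi> v"
  have "\<psi> \<in> carrier_mat l 1" using assms(3) by (simp add: stable_transfer_mat_def)
  then have A: "A \<in> carrier_mat n n" and B: "B \<in> carrier_mat n 1" and C: "C \<in> carrier_mat l n" and D: "D \<in> carrier_mat l 1"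
    using assms(5) by (auto simp: minimal_realization_def realization_def)
  have M: "M \<in> carrier_mat l l" and K: "K \<in> carrier_mat n n" using assms(6,8) by (auto simp: symmetric_mats_def)
  obtain \<delta> where \<delta>: "tf_proper \<delta>" "tf_stable \<delta>" "fdi (mat_of_rows_list 1 [[1], [\<delta>]]) P\<^sub>0" "tf_output \<delta> z w"
    using w by (auto simp: dynamic_uncertainty_def)
  define Z where "Z t = complex_of_real (z t)" for t
  define W where "W t = complex_of_real (w t)" for t
  have Z: "piecewise_cont Z" unfolding Z_def[abs_def] using z by (rule signals_piecewise_cont)
  have W: "piecewise_cont W" and WZ: "\<And>t. 0 \<le> t \<Longrightarrow> rpoly (hat_den \<delta>) W t = rpoly (hat_num \<delta>) Z t"
    using tf_output_relation[OF \<delta>(4,1)] Z unfolding W_def[abs_def] Z_def[abs_def] by blast+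
  interpret filtered_pair A B n z w \<xi>
    using A B Z W resp by unfold_locales (simp_all add: Z_def[abs_def] W_def[abs_def] response_def)

  define Q where "Q = transpose_mat (append_cols C D) * M * append_cols C D
    - transpose_mat (four_block_mat A B (1\<^sub>m n) (0\<^sub>m n 1)) * four_block_mat (0\<^sub>m n n) K K (0\<^sub>m n n) * four_block_mat A B (1\<^sub>m n) (0\<^sub>m n 1)"
  have Qc: "Q \<in> carrier_mat (n + 1) (n + 1)"
    unfolding Q_def by (rule certificate_form(2)[OF A B C D M K]) (rule zero_carrier_vec)+
  have Q_psd: "0 \<le> (\<Sum>j<n+1. \<Sum>k<n+1. Q $$ (j, k) * (x j * x k))" for x
    using assms(9) unfolding def_less_def Q_def[symmetric] by (rule pos_def_nonneg[OF _ Qc])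
  \<comment> \<open>filter states augmented by the filter inputs\<close>
  define f where "f t = state_z t @\<^sub>v vec_of_list [z t]" for t
  define g where "g t = state_w t @\<^sub>v vec_of_list [w t]" for t
  have fg: "f t \<in> carrier_vec (n + 1)" "g t \<in> carrier_vec (n + 1)" for t
    unfolding f_def g_def by (intro append_carrier_vec carriers singleton_carrier)+
  have f_index: "f t $ j = (if j < n then state_z t $ j else z t)" "g t $ j = (if j < n then state_w t $ j else w t)" if "j < n + 1" for j t
    using that carriers(1,2)[of t] by (auto simp: f_def g_def vec_of_list_index)
  have cf: "(\<lambda>t. complex_of_real (f t $ j)) = (if j < n then (\<lambda>t. complex_of_real (state_z t $ j)) else Z)"
    "(\<lambda>t. complex_of_real (g t $ j)) = (if j < n then (\<lambda>t. complex_of_real (state_w t $ j)) else W)" if "j < n + 1" for j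
    using that by (auto simp: f_index Z_def W_def)
  have pf: "piecewise_cont (\<lambda>t. complex_of_real (f t $ j))" and pg: "piecewise_cont (\<lambda>t. complex_of_real (g t $ j))" if "j < n + 1" for j
    using that state_piecewise_cont Z W unfolding cf[OF that] by auto
  have rel: "rpoly (hat_den \<delta>) (\<lambda>t. complex_of_real (g t $ j)) t = rpoly (hat_num \<delta>) (\<lambda>t. complex_of_real (f t $ j)) t"
    if j: "j < n + 1" and t: "0 \<le> t" for j t
  proof (cases "j < n")
    case True
    then show ?thesis
      using filter_commutes_with_transfer_function[OF A state_piecewise_cont(1) state_piecewise_cont(2) Z W
          state_equations(1)[folded Z_def] state_equations(2)[folded W_def] WZ True t]
      unfolding cf[OF j] by simp
  next
    case False
    then show ?thesis using WZ[OF t] unfolding cf[OF j] by simp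
  qed

  define \<Phi> where "\<Phi> t = (\<Sum>j<n+1. \<Sum>k<n+1. complex_of_real (Q $$ (j, k)) *
      (complex_of_real q * (complex_of_real (f t $ j) * cnj (complex_of_real (f t $ k)))
      + complex_of_real s * (complex_of_real (f t $ j) * cnj (complex_of_real (g t $ k)))
      + complex_of_real s * (complex_of_real (g t $ j) * cnj (complex_of_real (f t $ k)))
      + complex_of_real r * (complex_of_real (g t $ j) * cnj (complex_of_real (g t $ k)))))" for t
  have \<Phi>: "piecewise_cont \<Phi>"
    unfolding \<Phi>_def[abs_def]
    by (intro piecewise_cont_sum piecewise_cont_cmult piecewise_cont_add piecewise_cont_mult piecewise_cont_cnj pf pg) auto
  have nonneg: "0 \<le> Re (volterra \<Phi> T)"
    unfolding \<Phi>_def[abs_def]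
  proof (rule truncated_quadratic_constraint[OF assms(2) Q_psd])
    show "degree (map_poly complex_of_real (hat_num \<delta>)) \<le> degree (map_poly complex_of_real (hat_den \<delta>))"
      using degree_hat[OF \<delta>(1,2)] by simp
    show "poly (map_poly complex_of_real (hat_den \<delta>)) 0 \<noteq> 0" by (rule hat_den_at_0)
    show "Re x < 0" if "poly (map_poly complex_of_real (hat_den \<delta>)) x = 0" for x
      using hat_den_stable[OF \<delta>(1,2) that] .
    show "0 < q * (cmod (poly (map_poly complex_of_real (hat_den \<delta>)) (\<i> * complex_of_real \<omega>)))\<^sup>2
           + 2 * s * Re (poly (map_poly complex_of_real (hat_num \<delta>)) (\<i> * complex_of_real \<omega>) * cnj (poly (map_poly complex_of_real (hat_den \<delta>)) (\<i> * complex_of_real \<omega>)))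
           + r * (cmod (poly (map_poly complex_of_real (hat_num \<delta>)) (\<i> * complex_of_real \<omega>)))\<^sup>2" for \<omega>
      using hat_fdi[OF \<delta>(1,2) \<delta>(3)[unfolded P\<^sub>0_def]] .
    show "vpoly (map_poly complex_of_real (hat_den \<delta>)) (\<lambda>t. complex_of_real (g t $ j)) t = vpoly (map_poly complex_of_real (hat_num \<delta>)) (\<lambda>t. complex_of_real (f t $ j)) t"
      if "j < n + 1" "t \<in> {0..T}" for j t
      using rel[of j t] that unfolding rpoly_def by simp
  qed (use pf pg T in auto)

  \<comment> \<open>the supply rate minus the derivative of the terminal cost is the form of \<open>Q\<close>\<close>
  have outer: "v t \<bullet> ((P\<^sub>0 \<otimes>\<^sub>K M) *\<^sub>v v t)
      - ((rate_z t @\<^sub>v rate_w t) \<bullet> ((P\<^sub>0 \<otimes>\<^sub>K K) *\<^sub>v \<xi> t) + \<xi> t \<bullet> ((P\<^sub>0 \<otimes>\<^sub>K K) *\<^sub>v (rate_z t @\<^sub>v rate_w t))) = Re (\<Phi> t)" if t: "0 \<le> t" for t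
  proof -
    define va where "va = C *\<^sub>v state_z t + D *\<^sub>v vec_of_list [z t]"
    define vb where "vb = C *\<^sub>v state_w t + D *\<^sub>v vec_of_list [w t]"
    have vab: "va \<in> carrier_vec l" "vb \<in> carrier_vec l"
      unfolding va_def vb_def
      by (rule add_carrier_vec, rule mult_mat_vec_carrier[OF C], rule carriers, rule mult_mat_vec_carrier[OF D singleton_carrier])+
    have "v t = diag2 C *\<^sub>v \<xi> t + diag2 D *\<^sub>v vec_of_list [z t, w t]"
      using resp t unfolding response_def by blast
    also have "\<dots> = va @\<^sub>v vb"
      unfolding \<xi>_split[OF t] vec_of_list_two[of "z t"] va_def vb_def
      by (rule diag2_affine_append[OF C carriers(1,2) D singleton_carrier singleton_carrier])
    finally have v: "v t \<bullet> ((P\<^sub>0 \<otimes>\<^sub>K M) *\<^sub>v v t) = q * (va \<bullet> (M *\<^sub>v va)) + s * (va \<bullet> (M *\<^sub>v vb)) + s * (vb \<bullet> (M *\<^sub>v va)) + r * (vb \<bullet> (M *\<^sub>v vb))"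
      unfolding P\<^sub>0_def by (simp only: kronecker_two_form[OF M vab vab])
    have "Re (\<Phi> t) = (\<Sum>j<n+1. \<Sum>k<n+1. Q $$ (j, k) * (q * (f t $ j * f t $ k) + s * (f t $ j * g t $ k) + s * (g t $ j * f t $ k) + r * (g t $ j * g t $ k)))"
      unfolding \<Phi>_def by simp
    also have "\<dots> = q * (f t \<bullet> (Q *\<^sub>v f t)) + s * (f t \<bullet> (Q *\<^sub>v g t)) + s * (g t \<bullet> (Q *\<^sub>v f t)) + r * (g t \<bullet> (Q *\<^sub>v g t))"
      by (rule bilinear_form_combination[OF Qc fg])
    finally show ?thesis
      unfolding v unfolding \<xi>_split[OF t] P\<^sub>0_def
      unfolding kronecker_two_form[OF K carriers(3,4) carriers(1,2)] kronecker_two_form[OF K carriers(1,2) carriers(3,4)]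
      unfolding f_def g_def Q_def
        certificate_form(1)[OF A B C D M K carriers(1) carriers(1) singleton_carrier singleton_carrier] certificate_form(1)[OF A B C D M K carriers(1) carriers(2) singleton_carrier singleton_carrier]
        certificate_form(1)[OF A B C D M K carriers(2) carriers(1) singleton_carrier singleton_carrier] certificate_form(1)[OF A B C D M K carriers(2) carriers(2) singleton_carrier singleton_carrier]
      by (simp add: va_def vb_def rate_z_def rate_w_def algebra_simps)
  qed
  have "((\<lambda>t. v t \<bullet> ((P\<^sub>0 \<otimes>\<^sub>K M) *\<^sub>v v t)
      - ((rate_z t @\<^sub>v rate_w t) \<bullet> ((P\<^sub>0 \<otimes>\<^sub>K K) *\<^sub>v \<xi> t) + \<xi> t \<bullet> ((P\<^sub>0 \<otimes>\<^sub>K K) *\<^sub>v (rate_z t @\<^sub>v rate_w t)))) has_integral Re (volterra \<Phi> T)) {0..T}"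
    by (rule volterra_real_part[OF \<Phi>]) (simp add: outer)
  from has_integral_add[OF this storage_has_integral[OF kronecker_two_carrier[OF K] T, of q s r, folded P\<^sub>0_def]]
  have "((\<lambda>t. v t \<bullet> ((P\<^sub>0 \<otimes>\<^sub>K M) *\<^sub>v v t)) has_integral Re (volterra \<Phi> T) + \<xi> T \<bullet> ((P\<^sub>0 \<otimes>\<^sub>K K) *\<^sub>v \<xi> T)) {0..T}"
    by simp
  then have "integral {0..T} (\<lambda>t. v t \<bullet> ((P\<^sub>0 \<otimes>\<^sub>K M) *\<^sub>v v t)) = Re (volterra \<Phi> T) + \<xi> T \<bullet> ((P\<^sub>0 \<otimes>\<^sub>K K) *\<^sub>v \<xi> T)"
    by (rule integral_unique)
  then show "0 \<le> integral {0..T} (\<lambda>t. v t \<bullet> ((P\<^sub>0 \<otimes>\<^sub>K M) *\<^sub>v v t)) - \<xi> T \<bullet> ((P\<^sub>0 \<otimes>\<^sub>K K) *\<^sub>v \<xi> T)"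
    using nonneg by simp
qed

end
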